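(* Let $\alpha>0$, let $\mathcal{G}\in\mathcal{K}(\alpha)$, and let $\Lambda,\Gamma\subset\mathbb{R}$ be separated sets, with $\Gamma$ relatively dense. Assume that the $\Gamma$-shifts of $\mathcal{G}$ are stable and that $$D^-(\Lambda)>\frac{q(\mathcal{G})}{k(\mathcal{G})}D^+(\Gamma).$$ Then $\Lambda$ is a sampling set for $V^p_\Gamma(\mathcal{G})$, for every $p\in[1,\infty]$.
   Context: A countable set $\Gamma\subset\mathbb{R}$ is separated if $\inf_{\gamma\ne\gamma'}|\gamma-\gamma'|>0$. Its lower and upper uniform densities are $D^-(\Gamma)=\lim_{R\to\infty}\inf_{x\in\mathbb{R}}\frac{\#(\Gamma\cap[x-R,x+R])}{2R}$ and $D^+(\Gamma)=\lim_{R\to\infty}\sup_{x\in\mathbb{R}}\frac{\#(\Gamma\cap[x-R,x+R])}{2R}$. $\Gamma$ is relatively dense if $D^-(\Gamma)>0$. Class $\mathcal{K}(\alpha)$: all functions $\mathcal{G}(z)=\mathcal{R}(e^{\alpha z})$, $\mathcal{R}=P/Q$, where $P,Q$ are non-trivial complex polynomials without common zeros such that (A) $1\le\deg P<\deg Q$; (B) $P(0)=0$; (C) $Q(x)\ne0$ for all real $x\ge0$. For such $\mathcal{G}$, $q(\mathcal{G}):=\deg Q$, and $k(\mathcal{G})$ is the greatest integer $k$ such that $\mathcal{G}(z+2\pi i/(k\alpha))=c\,\mathcal{G}(z)$, $z\in\mathbb{C}$, for some constant $c\in\mathbb{C}$. $V^p_\Gamma(\mathcal{G})$ is the space of all functions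 $f(x)=\sum_{\gamma\in\Gamma}c_\gamma\mathcal{G}(x-\gamma)$, $x\in\mathbb{R}$, with $\{c_\gamma\}\in l^p(\Gamma)$. The $\Gamma$-shifts of $\mathcal{G}$ are stable if for every $p\in[1,\infty]$ there are constants $C_1,C_2>0$ with $C_1\|\mathbf{c}\|_p\le\|\sum_{\gamma\in\Gamma}c_\gamma\mathcal{G}(\cdot-\gamma)\|_{L^p(\mathbb{R})}\le C_2\|\mathbf{c}\|_p$ for all $\mathbf{c}=\{c_\gamma\}\in l^p(\Gamma)$. A separated set $\Lambda$ is a sampling set for $V^p_\Gamma(\mathcal{G})$ if there are positive constants $A,B$ such that $A\|f\|_p^p\le\sum_{\lambda\in\Lambda}|f(\lambda)|^p\le B\|f\|_p^p$ for all $f\in V^p_\Gamma(\mathcal{G})$ (when $1\le p<\infty$), respectively a constant $K>0$ such that $\|f\|_\infty\le K\sup_{\lambda\in\Lambda}|f(\lambda)|$ for all $f\in V^\infty_\Gamma(\mathcal{G})$ (when $p=\infty$). *)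

theory Defs
  imports
    "HOL-Analysis.Analysis"
    "HOL-Computational_Algebra.Fundamental_Theorem_Algebra"
    "HOL-Computational_Algebra.Polynomial_Factorial"
    "HOL-Computational_Algebra.Field_as_Ring"
    "HOL-Probability.Essential_Supremum"
begin

section \<open>Separated sets and uniform densities\<close>

text \<open>The infimum is taken in the extended reals, so sets with at most one point are separated.\<close>

definition separated_set :: "real set \<Rightarrow> bool" where
  "separated_set S \<longleftrightarrow> countable S \<and>
     (INF (x, y) \<in> {(x, y). x \<in> S \<and> y \<in> S \<and> x \<noteq> y}. ereal \<bar>x - y\<bar>) > 0"

text \<open>The densities are only used for separated sets: there the cardinalities are finite and
  bounded in \<open>x\<close> for each \<open>R\<close>, and the limits exist in the reals.\<close>

definition lower_density :: "real set \<Rightarrow> real" where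
  "lower_density S = Lim at_top (\<lambda>R. INF x. real (card (S \<inter> {x - R..x + R})) / (2 * R))"

definition upper_density :: "real set \<Rightarrow> real" where
  "upper_density S = Lim at_top (\<lambda>R. SUP x. real (card (S \<inter> {x - R..x + R})) / (2 * R))"

definition relatively_dense :: "real set \<Rightarrow> bool" where
  "relatively_dense S \<longleftrightarrow> lower_density S > 0"

lemma separated_set_iff_uniform_discrete:
  "separated_set S \<longleftrightarrow> uniform_discrete S"
proof
  let ?I = "INF (x, y) \<in> {(x, y). x \<in> S \<and> y \<in> S \<and> x \<noteq> y}. ereal \<bar>x - y\<bar>"
  assume "separated_set S"
  then have "?I > 0" by (simp add: separated_set_def)
  then obtain e where e: "0 < ereal e" "ereal e < ?I"
    using ereal_dense2 by blast
  have "x = y" if "x \<in> S" "y \<in> S" "dist x y < e" for x y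
  proof (rule ccontr)
    assume "x \<noteq> y"
    then have "?I \<le> ereal \<bar>x - y\<bar>"
      using that by (intro INF_lower2[of "(x, y)"]) auto
    with e(2) have "ereal e < ereal \<bar>x - y\<bar>" by (rule less_le_trans)
    with that(3) show False by (simp add: dist_real_def)
  qed
  with e(1) show "uniform_discrete S" by (auto simp: uniform_discrete_def)
next
  let ?I = "INF (x, y) \<in> {(x, y). x \<in> S \<and> y \<in> S \<and> x \<noteq> y}. ereal \<bar>x - y\<bar>"
  assume ud: "uniform_discrete S"
  then obtain e where e: "e > 0" "\<And>x y. x \<in> S \<Longrightarrow> y \<in> S \<Longrightarrow> dist x y < e \<Longrightarrow> x = y"
    by (auto simp: uniform_discrete_def)
  have le: "e \<le> \<bar>x - y\<bar>" if "x \<in> S" "y \<in> S" "x \<noteq> y" for x y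
    using e(2)[OF that(1,2)] that(3) by (fastforce simp: dist_real_def)
  have "0 < ereal e" using e(1) by simp
  also have "ereal e \<le> ?I" by (intro INF_greatest) (auto intro: le)
  finally have "0 < ?I" .
  moreover have "countable S"
    using sparse_imp_countable[OF open_UNIV uniform_discrete_imp_sparse[OF ud]] by simp
  ultimately show "separated_set S" by (simp add: separated_set_def)
qed

section \<open>The class \<open>\<K>(\<alpha>)\<close>\<close>

text \<open>Elements of the class are meromorphic; as total functions they take the value \<open>0\<close>
  at their poles, since division by \<open>0\<close> yields \<open>0\<close>.\<close>

definition represents :: "real \<Rightarrow> complex poly \<Rightarrow> complex poly \<Rightarrow> (complex \<Rightarrow> complex) \<Rightarrow> bool" where
  "represents \<alpha> P Q G \<longleftrightarrow>
     P \<noteq> 0 \<and> Q \<noteq> 0 \<and> (\<nexists>w. poly P w = 0 \<and> poly Q w = 0) \<and>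
     1 \<le> degree P \<and> degree P < degree Q \<and>
     poly P 0 = 0 \<and>
     (\<forall>x::real. x \<ge> 0 \<longrightarrow> poly Q (of_real x) \<noteq> 0) \<and>
     (\<forall>z. G z = poly P (exp (of_real \<alpha> * z)) / poly Q (exp (of_real \<alpha> * z)))"

definition class_K :: "real \<Rightarrow> (complex \<Rightarrow> complex) set" where
  "class_K \<alpha> = {G. \<exists>P Q. represents \<alpha> P Q G}"

definition q_num :: "real \<Rightarrow> (complex \<Rightarrow> complex) \<Rightarrow> nat" where
  "q_num \<alpha> G = (THE n. \<exists>P Q. represents \<alpha> P Q G \<and> n = degree Q)"

text \<open>Since \<open>k = 1\<close> always qualifies (with \<open>c = 1\<close>), the greatest integer with the property is
  positive; the value \<open>k = 0\<close>, where the shift is meaningless, is left out.\<close>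

definition k_num :: "real \<Rightarrow> (complex \<Rightarrow> complex) \<Rightarrow> nat" where
  "k_num \<alpha> G = (GREATEST k. k > 0 \<and>
     (\<exists>c. \<forall>z. G (z + 2 * of_real pi * \<i> / (of_nat k * of_real \<alpha>)) = c * G z))"

lemma coprime_poly_if_no_common_zero:
  fixes P Q :: "complex poly"
  assumes "\<nexists>w. poly P w = 0 \<and> poly Q w = 0" "Q \<noteq> 0"
  shows "coprime P Q"
proof (rule coprimeI)
  fix d assume d: "d dvd P" "d dvd Q"
  have "degree d = 0"
  proof (rule ccontr)
    assume "degree d \<noteq> 0"
    then obtain w where "poly d w = 0"
      using fundamental_theorem_of_algebra constant_degree by metis
    with d assms(1) show False by (meson poly_eq_0_iff_dvd dvd_trans)
  qed
  moreover have "d \<noteq> 0" using d(2) assms(2) by auto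
  ultimately show "is_unit d" by (simp add: is_unit_iff_degree)
qed

lemma q_num_eq:
  assumes "\<alpha> \<noteq> 0" "represents \<alpha> P Q G"
  shows "q_num \<alpha> G = degree Q"
  unfolding q_num_def
proof (rule the_equality)
  show "\<exists>P' Q'. represents \<alpha> P' Q' G \<and> degree Q = degree Q'"
    using assms(2) by blast
next
  fix n assume "\<exists>P' Q'. represents \<alpha> P' Q' G \<and> n = degree Q'"
  then obtain P' Q' where r': "represents \<alpha> P' Q' G" and n: "n = degree Q'" by blast
  note r = assms(2)
  have nz: "Q \<noteq> 0" "Q' \<noteq> 0" using r r' by (auto simp: represents_def)
  have "poly ((P * Q' - P' * Q) * (Q * Q' * [:0, 1:])) w = 0" for w
  proof (cases "w = 0 \<or> poly Q w = 0 \<or> poly Q' w = 0")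
    case False
    define z where "z = Ln w / of_real \<alpha>"
    have "exp (of_real \<alpha> * z) = w" using False assms(1) by (simp add: z_def)
    moreover have "G z = poly P (exp (of_real \<alpha> * z)) / poly Q (exp (of_real \<alpha> * z))"
      using r unfolding represents_def by blast
    moreover have "G z = poly P' (exp (of_real \<alpha> * z)) / poly Q' (exp (of_real \<alpha> * z))"
      using r' unfolding represents_def by blast
    ultimately have "poly P w / poly Q w = poly P' w / poly Q' w" by simp
    with False show ?thesis by (simp add: field_simps)
  qed auto
  then have "(P * Q' - P' * Q) * (Q * Q' * [:0, 1:]) = 0"
    using poly_all_0_iff_0 by blast
  then have eq: "P * Q' = P' * Q" using nz by simp
  have cop: "coprime Q P" "coprime Q' P'"
    using r r' coprime_poly_if_no_common_zero[of P Q] coprime_poly_if_no_common_zero[of P' Q']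
    by (auto simp: represents_def coprime_commute)
  have "Q dvd P * Q'" by (simp add: eq)
  then have "Q dvd Q'" by (simp only: coprime_dvd_mult_right_iff[OF cop(1)])
  moreover have "Q' dvd P' * Q" by (simp flip: eq)
  then have "Q' dvd Q" by (simp only: coprime_dvd_mult_right_iff[OF cop(2)])
  ultimately show "n = degree Q" unfolding n using nz
    by (intro antisym dvd_imp_degree_le) auto
qed

section \<open>Norms\<close>

text \<open>Norms take values in \<^typ>\<open>ennreal\<close>, so that non-membership in \<open>l\<^sup>p\<close> or \<open>L\<^sup>p\<close> is expressed
  by an infinite norm.\<close>

definition ennreal_powr :: "ennreal \<Rightarrow> real \<Rightarrow> ennreal" where
  "ennreal_powr x r = (if x = \<infinity> then \<infinity> else ennreal (enn2real x powr r))"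

definition lp_norm :: "ennreal \<Rightarrow> real set \<Rightarrow> (real \<Rightarrow> complex) \<Rightarrow> ennreal" where
  "lp_norm p S c =
     (if p = \<infinity> then (SUP s\<in>S. ennreal (norm (c s)))
      else ennreal_powr (\<Sum>\<^sub>\<infinity>s\<in>S. ennreal (norm (c s) powr enn2real p)) (1 / enn2real p))"

definition Lp_norm :: "ennreal \<Rightarrow> (real \<Rightarrow> complex) \<Rightarrow> ennreal" where
  "Lp_norm p f =
     (if p = \<infinity> then esssup lborel (\<lambda>x. ennreal (norm (f x)))
      else ennreal_powr (\<integral>\<^sup>+x. ennreal (norm (f x) powr enn2real p) \<partial>lborel) (1 / enn2real p))"

text \<open>A sequence indexed by \<open>S\<close> is a function on the reals of which only the values on \<open>S\<close> matter.\<close>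

definition lp_space :: "ennreal \<Rightarrow> real set \<Rightarrow> (real \<Rightarrow> complex) set" where
  "lp_space p S = {c. lp_norm p S c < \<infinity>}"

section \<open>Shift-invariant spaces, stability and sampling\<close>

definition shift_series ::
  "(complex \<Rightarrow> complex) \<Rightarrow> real set \<Rightarrow> (real \<Rightarrow> complex) \<Rightarrow> real \<Rightarrow> complex" where
  "shift_series G \<Gamma> c x = (\<Sum>\<^sub>\<infinity>\<gamma>\<in>\<Gamma>. c \<gamma> * G (of_real (x - \<gamma>)))"

definition V_space :: "ennreal \<Rightarrow> real set \<Rightarrow> (complex \<Rightarrow> complex) \<Rightarrow> (real \<Rightarrow> complex) set" where
  "V_space p \<Gamma> G = {shift_series G \<Gamma> c |c. c \<in> lp_space p \<Gamma>}"

definition stable_shifts :: "real set \<Rightarrow> (complex \<Rightarrow> complex) \<Rightarrow> bool" where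
  "stable_shifts \<Gamma> G \<longleftrightarrow>
     (\<forall>p::ennreal. 1 \<le> p \<longrightarrow>
       (\<exists>C1 C2 :: real. C1 > 0 \<and> C2 > 0 \<and>
         (\<forall>c\<in>lp_space p \<Gamma>.
            ennreal C1 * lp_norm p \<Gamma> c \<le> Lp_norm p (shift_series G \<Gamma> c) \<and>
            Lp_norm p (shift_series G \<Gamma> c) \<le> ennreal C2 * lp_norm p \<Gamma> c)))"

definition sampling_set :: "real set \<Rightarrow> ennreal \<Rightarrow> real set \<Rightarrow> (complex \<Rightarrow> complex) \<Rightarrow> bool" where
  "sampling_set \<Lambda> p \<Gamma> G \<longleftrightarrow> separated_set \<Lambda> \<and>
     (if p = \<infinity> then
        (\<exists>K::real. K > 0 \<and>
          (\<forall>f\<in>V_space p \<Gamma> G. Lp_norm p f \<le> ennreal K * (SUP \<mu>\<in>\<Lambda>. ennreal (norm (f \<mu>)))))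
      else
        (\<exists>A B :: real. A > 0 \<and> B > 0 \<and>
          (\<forall>f\<in>V_space p \<Gamma> G.
             ennreal A * ennreal_powr (Lp_norm p f) (enn2real p)
               \<le> (\<Sum>\<^sub>\<infinity>\<mu>\<in>\<Lambda>. ennreal (norm (f \<mu>) powr enn2real p)) \<and>
             (\<Sum>\<^sub>\<infinity>\<mu>\<in>\<Lambda>. ennreal (norm (f \<mu>) powr enn2real p))
               \<le> ennreal B * ennreal_powr (Lp_norm p f) (enn2real p))))"

end

theory Submission
  imports
    Defs
    "HOL-Complex_Analysis.Conformal_Mappings"
    "HOL-Probability.Distributions"
begin

text \<open>
  In the variable \<open>w = exp (\<alpha> z)\<close> an element \<open>f\<close> of the space is a sum of rational functions. It is
  meromorphic in \<open>z\<close>, its modulus has period \<open>2 \<pi> \<i> / (k \<alpha>)\<close>, and in a horizontal strip of that height it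
  has at most \<open>q / k\<close> poles for each \<open>\<gamma>\<close>, counted with multiplicity. If \<open>f\<close> vanishes on \<open>\<Lambda>\<close>, it has a zero
  for each \<open>\<lambda>\<close> in the same strip. Let \<open>u x\<close> be the integral of \<open>ln \<bar>f\<bar>\<close> over the vertical segment of the
  strip above \<open>x\<close>. By Jensen's formula \<open>u''\<close> is \<open>2 \<pi>\<close> times the counting measure of the zeros minus that
  of the poles, projected to the real line; by the density assumption this measure gives every long
  interval a mass of at least a constant times its length. Since \<open>u\<close> is bounded above, it follows that
  \<open>u x \<le> C - c n^2\<close> for all large \<open>n\<close>, so \<open>f = 0\<close>.

  The proof is a quantitative form of this argument. Around a real point \<open>x\<close> take the samples in a window
  of radius \<open>n\<close>, multiply \<open>f\<close> by the denominators that belong to the \<open>\<gamma>\<close> near the window, subtract the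
  polynomial in \<open>w\<close> that interpolates the product at the samples and at their translates by the period,
  and divide by \<open>\<Prod>(1 - w / node)\<close>. What remains is holomorphic in an annulus, and the three circles
  theorem bounds it at \<open>x\<close> (\<open>interpolation_error_at_one\<close>, \<open>local_estimate_at_origin\<close>). The gain is the
  exponential of \<open>\<alpha> / 2\<close> times \<open>q \<Sum>(n - \<bar>\<gamma> - x\<bar>) - k \<Sum>(n - \<bar>\<lambda> - x\<bar>)\<close>, up to an error \<open>O(n)\<close>; the densities
  make this at most \<open>- c n^2\<close>, and every other factor costs only \<open>exp (O(n))\<close>. Hence for each \<open>\<eta> > 0\<close>
  there is \<open>K\<close> such that \<open>\<bar>f x\<bar> \<le> \<eta> \<Sum>\<bar>c \<gamma>\<bar> exp (- \<alpha> \<bar>x - \<gamma>\<bar>) + K \<Sum>\<bar>f \<lambda>\<bar> exp (- \<alpha> \<bar>x - \<lambda>\<bar>)\<close> for all \<open>x\<close> and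
  all bounded coefficients \<open>c\<close> (\<open>shift_series_local_estimate\<close>).

  By the Schur test (\<open>schur_test_kernel\<close>) the exponential kernel is bounded from \<open>l^p\<close> over \<open>\<Gamma>\<close> or \<open>\<Lambda>\<close> to
  \<open>L^p\<close> and from \<open>l^p\<close> over \<open>\<Gamma>\<close> to \<open>l^p\<close> over \<open>\<Lambda>\<close>. Stability bounds the norm of the coefficients by that
  of \<open>f\<close>, so for small \<open>\<eta>\<close> the first term is absorbed in the left-hand side: this is the lower sampling
  inequality. The upper one is the Schur test for \<open>\<bar>f x\<bar> \<le> C \<Sum>\<bar>c \<gamma>\<bar> exp (- \<alpha> \<bar>x - \<gamma>\<bar>)\<close> together with
  stability.
\<close>

section \<open>Interpolation of holomorphic functions in an annulus\<close>

text \<open>The quotient is normalised by \<open>1 - w / a\<close> instead of \<open>w - a\<close> because its modulus is, away from \<open>a\<close>, comparable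
  to \<open>max 1 \<bar>w / a\<bar>\<close>, the quantity that is counted later.\<close>

lemma holomorphic_factor_nodes:
  fixes g :: "complex \<Rightarrow> complex"
  assumes "finite Z" "open U" "g holomorphic_on U" "Z \<subseteq> U" "0 \<notin> Z"
    and "\<And>a. a \<in> Z \<Longrightarrow> g a = 0"
  shows "\<exists>F. F holomorphic_on U \<and> (\<forall>w. g w = F w * (\<Prod>a\<in>Z. 1 - w / a))"
  using assms
proof (induction Z arbitrary: g rule: finite_induct)
  case empty
  then show ?case by auto
next
  case (insert a Z)
  define g0 where "g0 z = (if z = a then deriv g a else (g z - g a) / (z - a))" for z
  define g1 where "g1 z = - a * g0 z" for z
  have a0: "a \<noteq> 0" using insert.prems by auto
  have "g0 holomorphic_on U"
    unfolding g0_def by (intro pole_lemma_open insert.prems)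
  then have hol1: "g1 holomorphic_on U"
    unfolding g1_def by (intro holomorphic_intros)
  have ga: "g a = 0" using insert.prems by auto
  have g: "g z = g1 z * (1 - z / a)" for z
    using ga a0 by (auto simp: g1_def g0_def field_simps)
  have "g1 b = 0" if "b \<in> Z" for b
  proof -
    have "b \<noteq> a" using that insert.hyps by auto
    moreover have "g b = 0" using that insert.prems by auto
    ultimately show ?thesis using g[of b] a0 by (auto simp: field_simps)
  qed
  then obtain F where F: "F holomorphic_on U" "\<And>w. g1 w = F w * (\<Prod>a\<in>Z. 1 - w / a)"
    using insert.IH[OF insert.prems(1) hol1] insert.prems by auto
  show ?case
    using F insert.hyps by (intro exI[of _ F]) (auto simp: g mult_ac)
qed

definition lagrange_interpolant :: "complex set \<Rightarrow> (complex \<Rightarrow> complex) \<Rightarrow> complex \<Rightarrow> complex" where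
  "lagrange_interpolant Z v w = (\<Sum>a\<in>Z. v a * (\<Prod>b\<in>Z - {a}. (w - b) / (a - b)))"

lemma lagrange_interpolant_node:
  assumes "finite Z" "a \<in> Z"
  shows "lagrange_interpolant Z v a = v a"
proof -
  have "(\<Prod>b\<in>Z - {a'}. (a - b) / (a' - b)) = (if a' = a then 1 else 0)" if "a' \<in> Z" for a'
  proof (cases "a' = a")
    case True
    have "(\<Prod>b\<in>Z - {a}. (a - b) / (a - b)) = 1" by (intro prod.neutral) auto
    with True show ?thesis by simp
  next
    case False
    have "(\<Prod>b\<in>Z - {a'}. (a - b) / (a' - b)) = 0"
      using assms False by (intro prod_zero) (auto intro!: bexI[of _ a])
    with False show ?thesis by simp
  qed
  then have "lagrange_interpolant Z v a = (\<Sum>a'\<in>Z. v a' * (if a' = a then 1 else 0))"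
    unfolding lagrange_interpolant_def by (intro sum.cong) auto
  also have "\<dots> = v a" using assms by (simp add: if_distrib cong: if_cong)
  finally show ?thesis .
qed

lemma lagrange_interpolant_holomorphic:
  "lagrange_interpolant Z v holomorphic_on U"
  unfolding lagrange_interpolant_def divide_inverse by (intro holomorphic_intros)

lemma norm_lagrange_interpolant_le:
  assumes Z: "finite Z" "card Z \<le> N"
    and sep: "\<And>a b. a \<in> Z \<Longrightarrow> b \<in> Z \<Longrightarrow> a \<noteq> b \<Longrightarrow> \<sigma> \<le> norm (a - b)"
    and \<sigma>: "0 < \<sigma>" "\<sigma> \<le> 1" and r: "1 \<le> r"
    and norms: "\<And>a. a \<in> Z \<Longrightarrow> norm a \<le> r" "norm w \<le> r"
  shows "norm (lagrange_interpolant Z v w) \<le> (2 * r / \<sigma>) ^ N * (\<Sum>a\<in>Z. norm (v a))"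
proof -
  have ge1: "1 \<le> 2 * r / \<sigma>" using \<sigma> r by (simp add: field_simps)
  have "norm (\<Prod>b\<in>Z - {a}. (w - b) / (a - b)) \<le> (2 * r / \<sigma>) ^ N" if a: "a \<in> Z" for a
  proof -
    have "norm ((w - b) / (a - b)) \<le> 2 * r / \<sigma>" if b: "b \<in> Z - {a}" for b
    proof -
      have "norm (w - b) \<le> 2 * r"
        using norm_triangle_ineq4[of w b] norms(1)[of b] norms(2) b by auto
      moreover have "\<sigma> \<le> norm (a - b)" using sep a b by auto
      ultimately show ?thesis
        using \<sigma> r unfolding norm_divide by (intro frac_le) auto
    qed
    then have "(\<Prod>b\<in>Z - {a}. norm ((w - b) / (a - b))) \<le> (\<Prod>b\<in>Z - {a}. 2 * r / \<sigma>)"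
      by (intro prod_mono) auto
    also have "\<dots> = (2 * r / \<sigma>) ^ card (Z - {a})" by simp
    also have "\<dots> \<le> (2 * r / \<sigma>) ^ N"
      using ge1 Z by (intro power_increasing) (auto intro: order_trans[OF card_mono[of Z]])
    finally show ?thesis by (simp add: prod_norm)
  qed
  then have "norm (lagrange_interpolant Z v w) \<le> (\<Sum>a\<in>Z. norm (v a) * (2 * r / \<sigma>) ^ N)"
    unfolding lagrange_interpolant_def
    by (intro sum_norm_le) (auto simp: norm_mult intro!: mult_left_mono)
  also have "\<dots> = (2 * r / \<sigma>) ^ N * (\<Sum>a\<in>Z. norm (v a))"
    unfolding sum_distrib_right[symmetric] by (rule mult.commute)
  finally show ?thesis .
qed

text \<open>The maximum principle for \<open>F w * w powi (- s)\<close>, which is single-valued since \<open>s\<close> is an integer.  For the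
  best real exponent this would be the three circles theorem; rounding the exponent costs a factor \<open>r\<close>, which
  is harmless below because the gain is quadratic in \<open>ln r\<close>.\<close>

lemma three_circles_integer_exponent:
  fixes F :: "complex \<Rightarrow> complex"
  assumes r: "1 < r" and U: "F holomorphic_on U" "{w. 1 / r \<le> norm w \<and> norm w \<le> r} \<subseteq> U"
    and inner: "\<And>w. norm w = 1 / r \<Longrightarrow> norm (F w) * r powi s \<le> B"
    and outer: "\<And>w. norm w = r \<Longrightarrow> norm (F w) \<le> B * r powi s"
  shows "norm (F 1) \<le> B"
proof -
  define S where "S = {w::complex. 1 / r \<le> norm w \<and> norm w \<le> r}"
  define g where "g w = F w * w powi (- s)" for w
  have Seq: "S = cball 0 r - ball 0 (1 / r)"
    by (auto simp: S_def dist_norm)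
  have S0: "0 \<notin> S" using r by (auto simp: S_def)
  have "closed S" unfolding Seq by (intro closed_Diff) auto
  have hol: "g holomorphic_on S"
    unfolding g_def using S0 U(2)
    by (intro holomorphic_intros holomorphic_on_subset[OF U(1)]) (auto simp: S_def)
  have fr: "norm w = 1 / r \<or> norm w = r" if "w \<in> frontier S" for w
  proof (rule ccontr)
    assume *: "\<not> ?thesis"
    have "w \<in> S" using that \<open>closed S\<close> frontier_subset_closed by auto
    with * have "w \<in> ball 0 r - cball 0 (1 / r)" by (auto simp: S_def dist_norm)
    moreover have "open (ball 0 r - cball 0 (1 / r) :: complex set)" by (intro open_Diff) auto
    moreover have "ball 0 r - cball 0 (1 / r) \<subseteq> S" by (auto simp: S_def dist_norm)
    ultimately have "w \<in> interior S" by (auto simp: interior_def)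
    with that show False by (simp add: frontier_def)
  qed
  have "norm (g 1) \<le> B"
  proof (rule maximum_modulus_frontier[of g S])
    show "g holomorphic_on interior S" using hol holomorphic_on_subset interior_subset by blast
    show "continuous_on (closure S) g" using hol \<open>closed S\<close>
      by (simp add: holomorphic_on_imp_continuous_on)
    show "bounded S" unfolding Seq by (meson bounded_cball bounded_subset Diff_subset)
    show "1 \<in> S" using r by (auto simp: S_def)
    fix w assume "w \<in> frontier S"
    then consider "norm w = 1 / r" | "norm w = r" using fr by blast
    then show "norm (g w) \<le> B"
    proof cases
      case 1
      then have "norm (w powi (- s)) = r powi s"
        by (simp only: norm_inverse norm_power_int power_int_minus divide_inverse mult_1 power_int_inverse inverse_inverse_eq)
      then show ?thesis using inner[OF 1] unfolding g_def norm_mult by presburger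
    next
      case 2
      then have "norm (g w) = norm (F w) / r powi s"
        by (simp only: g_def norm_mult norm_inverse norm_power_int power_int_minus divide_inverse)
      moreover have "0 < r powi s" using r by simp
      ultimately show ?thesis using outer[OF 2] by (simp add: divide_le_eq)
    qed
  qed
  then show ?thesis by (simp add: g_def)
qed

text \<open>The function \<open>\<Phi>\<close> differs from its interpolant, which is bounded by \<open>h\<close>, by a multiple of \<open>\<Prod>(1 - w / a)\<close>.
  The cofactor is bounded on the two boundary circles and hence at the point 1.\<close>

lemma interpolation_error_at_one:
  fixes \<Phi> :: "complex \<Rightarrow> complex"
  assumes r: "1 < r" and U: "open U" "\<Phi> holomorphic_on U" "{w. 1 / r \<le> norm w \<and> norm w \<le> r} \<subseteq> U"
    and Z: "finite Z" "card Z \<le> N" "\<And>a. a \<in> Z \<Longrightarrow> 1 / r \<le> norm a" "\<And>a. a \<in> Z \<Longrightarrow> norm a \<le> r"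
    and sep: "\<And>a b. a \<in> Z \<Longrightarrow> b \<in> Z \<Longrightarrow> a \<noteq> b \<Longrightarrow> \<sigma> \<le> norm (a - b)"
    and \<sigma>: "0 < \<sigma>" "\<sigma> \<le> 1"
    and h: "h = (2 * r / \<sigma>) ^ N * (\<Sum>a\<in>Z. norm (\<Phi> a))"
    and inner: "\<And>w. norm w = 1 / r \<Longrightarrow>
          (norm (\<Phi> w) + h) * r powi s \<le> B * (\<Prod>a\<in>Z. norm (1 - w / a))"
    and outer: "\<And>w. norm w = r \<Longrightarrow>
          norm (\<Phi> w) + h \<le> B * r powi s * (\<Prod>a\<in>Z. norm (1 - w / a))"
    and pos: "\<And>w. norm w = 1 / r \<or> norm w = r \<Longrightarrow> (\<Prod>a\<in>Z. norm (1 - w / a)) > 0"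
  shows "norm (\<Phi> 1) \<le> h + B * (\<Prod>a\<in>Z. norm (1 - 1 / a))"
proof -
  define H where "H = lagrange_interpolant Z \<Phi>"
  have H: "norm (H w) \<le> h" if "norm w \<le> r" for w
    unfolding H_def h using norm_lagrange_interpolant_le[OF Z(1,2) sep \<sigma> _ Z(4) that, of \<Phi>] r by simp
  have "(\<lambda>w. \<Phi> w - H w) holomorphic_on U"
    unfolding H_def by (intro holomorphic_intros U lagrange_interpolant_holomorphic)
  moreover have "Z \<subseteq> U" using Z(3,4) U(3) by blast
  moreover have "0 \<notin> Z" using Z(3)[of 0] r by auto
  moreover have "\<Phi> a - H a = 0" if "a \<in> Z" for a
    unfolding H_def using lagrange_interpolant_node[OF Z(1) that, of \<Phi>] by simp
  ultimately have "\<exists>F. F holomorphic_on U \<and> (\<forall>w. \<Phi> w - H w = F w * (\<Prod>a\<in>Z. 1 - w / a))"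
    by (intro holomorphic_factor_nodes Z(1) U(1))
  then obtain F where F: "F holomorphic_on U"
      "\<And>w. \<Phi> w - H w = F w * (\<Prod>a\<in>Z. 1 - w / a)" by blast
  have Fn: "norm (F w) * (\<Prod>a\<in>Z. norm (1 - w / a)) \<le> norm (\<Phi> w) + h" if "norm w \<le> r" for w
  proof -
    have "norm (F w) * (\<Prod>a\<in>Z. norm (1 - w / a)) = norm (\<Phi> w - H w)"
      by (simp only: F(2) norm_mult prod_norm)
    also have "\<dots> \<le> norm (\<Phi> w) + norm (H w)" by (rule norm_triangle_ineq4)
    finally show ?thesis using H[OF that] by simp
  qed
  have "norm (F 1) \<le> B"
  proof (rule three_circles_integer_exponent[OF r F(1) U(3)])
    fix w :: complex assume w: "norm w = 1 / r"
    have "1 / r \<le> 1" using r by simp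
    with w r have "norm w \<le> r" by linarith
    then have "norm (F w) * (\<Prod>a\<in>Z. norm (1 - w / a)) * r powi s
        \<le> (norm (\<Phi> w) + h) * r powi s"
      using r by (intro mult_right_mono Fn) auto
    also have "\<dots> \<le> B * (\<Prod>a\<in>Z. norm (1 - w / a))" by (rule inner[OF w])
    finally have "(norm (F w) * r powi s) * (\<Prod>a\<in>Z. norm (1 - w / a)) \<le> B * (\<Prod>a\<in>Z. norm (1 - w / a))"
      by (simp only: mult.assoc mult.commute[of "r powi s"])
    then show "norm (F w) * r powi s \<le> B"
      using pos[of w] w by (meson mult_right_le_imp_le)
  next
    fix w :: complex assume w: "norm w = r"
    have "norm (F w) * (\<Prod>a\<in>Z. norm (1 - w / a)) \<le> B * r powi s * (\<Prod>a\<in>Z. norm (1 - w / a))"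
      using Fn[OF eq_refl[OF w]] outer[OF w] by (rule order_trans)
    then show "norm (F w) \<le> B * r powi s"
      using pos[of w] w by (meson mult_right_le_imp_le)
  qed
  then have "norm (F 1) * (\<Prod>a\<in>Z. norm (1 - 1 / a)) \<le> B * (\<Prod>a\<in>Z. norm (1 - 1 / a))"
    by (intro mult_right_mono prod_nonneg) auto
  moreover have "norm (\<Phi> 1) \<le> norm (H 1) + norm (\<Phi> 1 - H 1)"
    by (rule norm_triangle_sub)
  moreover have "norm (\<Phi> 1 - H 1) = norm (F 1) * (\<Prod>a\<in>Z. norm (1 - 1 / a))"
    by (simp only: F(2) norm_mult prod_norm)
  moreover have "norm (H 1) \<le> h" using r by (intro H) simp
  ultimately show ?thesis by linarith
qed

section \<open>Rational functions of an exponential\<close>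

lemma poly_norm_le_max_power:
  fixes P :: "complex poly"
  assumes "degree P \<le> q"
  shows "\<exists>C\<ge>1. \<forall>v. norm (poly P v) \<le> C * max 1 (norm v) ^ q"
proof (intro exI conjI allI)
  let ?C = "1 + (\<Sum>i\<le>degree P. norm (coeff P i))"
  show "1 \<le> ?C" by (simp add: sum_nonneg)
  fix v :: complex
  have "norm (poly P v) \<le> (\<Sum>i\<le>degree P. norm (coeff P i) * max 1 (norm v) ^ q)"
    unfolding poly_altdef
  proof (rule sum_norm_le)
    fix i assume "i \<in> {..degree P}"
    then have "i \<le> q" using assms by simp
    have "norm v ^ i \<le> max 1 (norm v) ^ i" by (intro power_mono) auto
    also have "\<dots> \<le> max 1 (norm v) ^ q" using \<open>i \<le> q\<close> by (intro power_increasing) auto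
    finally show "norm (coeff P i * v ^ i) \<le> norm (coeff P i) * max 1 (norm v) ^ q"
      unfolding norm_mult norm_power by (intro mult_left_mono) auto
  qed
  also have "\<dots> = (\<Sum>i\<le>degree P. norm (coeff P i)) * max 1 (norm v) ^ q"
    by (simp only: sum_distrib_right)
  also have "\<dots> \<le> ?C * max 1 (norm v) ^ q"
    by (intro mult_right_mono) auto
  finally show "norm (poly P v) \<le> ?C * max 1 (norm v) ^ q" .
qed

lemma poly_norm_ge_power:
  fixes Q :: "complex poly"
  assumes "Q \<noteq> 0"
  shows "\<exists>c>0. \<exists>B\<ge>1. \<forall>v. B \<le> norm v \<longrightarrow> c * norm v ^ degree Q \<le> norm (poly Q v)"
proof -
  let ?l = "norm (lead_coeff Q)"
  have l: "?l > 0" using assms by simp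
  have "((\<lambda>v. norm (poly Q v / v ^ degree Q)) \<longlongrightarrow> ?l) at_infinity"
    by (intro tendsto_norm poly_divide_tendsto_aux)
  then have "\<forall>\<^sub>F v in at_infinity. ?l / 2 < norm (poly Q v / v ^ degree Q)"
    using l by (rule_tac order_tendstoD(1)) auto
  then obtain B where B: "\<And>v. B \<le> norm v \<Longrightarrow> ?l / 2 < norm (poly Q v / v ^ degree Q)"
    unfolding eventually_at_infinity by blast
  show ?thesis
  proof (intro exI conjI allI impI)
    show "?l / 2 > 0" "max 1 B \<ge> 1" using l by auto
    fix v :: complex assume v: "max 1 B \<le> norm v"
    then have "norm v > 0" by auto
    then show "?l / 2 * norm v ^ degree Q \<le> norm (poly Q v)"
      using B[of v] v by (simp add: norm_divide norm_power field_simps)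
  qed
qed

text \<open>At the origin \<open>P\<close> vanishes and \<open>Q\<close> does not; at infinity the degree of \<open>Q\<close> is larger.  Both effects together
  make \<open>G\<close> decay like \<open>exp (- \<alpha> \<bar>x\<bar>)\<close>.\<close>

lemma rational_function_decay:
  assumes "represents \<alpha> P Q G"
  shows "\<exists>C\<ge>1. \<exists>B\<ge>1. \<forall>v.
    (B \<le> norm v \<longrightarrow> poly Q v \<noteq> 0 \<and> norm (poly P v / poly Q v) \<le> C / norm v) \<and>
    (norm v \<le> 1 / B \<longrightarrow> poly Q v \<noteq> 0 \<and> norm (poly P v / poly Q v) \<le> C * norm v)"
proof -
  have Q0: "Q \<noteq> 0" and dPQ: "degree P < degree Q" and P00: "poly P 0 = 0"
    and Qx: "\<And>x. x \<ge> 0 \<Longrightarrow> poly Q (of_real x) \<noteq> 0"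
    using assms unfolding represents_def by auto
  have Q00: "poly Q 0 \<noteq> 0" using Qx[of 0] by simp
  obtain C1 where C1: "C1 \<ge> 1" "\<And>v. norm (poly P v) \<le> C1 * max 1 (norm v) ^ (degree Q - 1)"
    using poly_norm_le_max_power[of P "degree Q - 1"] dPQ by (metis Suc_pred' gr_implies_not0 less_Suc_eq_le not_gr0)
  obtain c B1 where c: "c > 0" "B1 \<ge> 1" "\<And>v. B1 \<le> norm v \<Longrightarrow> c * norm v ^ degree Q \<le> norm (poly Q v)"
    using poly_norm_ge_power[OF Q0] by blast
  have far: "poly Q v \<noteq> 0 \<and> norm (poly P v / poly Q v) \<le> C1 / c / norm v" if v: "B1 \<le> norm v" for v
  proof -
    have v1: "1 \<le> norm v" using v c by simp
    then have vpos: "norm v ^ degree Q > 0" by (intro zero_less_power) linarith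
    then have *: "0 < c * norm v ^ degree Q" using c by simp
    then have "0 < norm (poly Q v)" using c(3)[OF v] by linarith
    moreover have "norm (poly P v) / norm (poly Q v) \<le> (C1 * norm v ^ (degree Q - 1)) / (c * norm v ^ degree Q)"
      using C1(2)[of v] v1 c(3)[OF v] * C1(1) by (intro frac_le) (auto simp: max_def split: if_splits)
    moreover have "norm v ^ degree Q = norm v * norm v ^ (degree Q - 1)"
      using dPQ by (cases "degree Q") auto
    then have "(C1 * norm v ^ (degree Q - 1)) / (c * norm v ^ degree Q) = C1 / c / norm v"
      using v1 vpos c(1) by (simp add: field_simps)
    ultimately show ?thesis by (simp add: norm_divide)
  qed
  obtain P' where P': "P = [:0, 1:] * P'"
    using P00 unfolding poly_eq_0_iff_dvd by auto
  obtain C2 where C2: "C2 \<ge> 1" "\<And>v. norm (poly P' v) \<le> C2 * max 1 (norm v) ^ degree P'"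
    using poly_norm_le_max_power[of P' "degree P'"] by auto
  have "((\<lambda>v. norm (poly Q v)) \<longlongrightarrow> norm (poly Q 0)) (nhds 0)"
    using poly_isCont[of 0 Q] unfolding isCont_def tendsto_at_iff_tendsto_nhds by (rule tendsto_norm)
  then have "\<forall>\<^sub>F v in nhds 0. norm (poly Q 0) / 2 < norm (poly Q v)"
    using Q00 by (rule_tac order_tendstoD(1)) auto
  then obtain d where d: "d > 0" "\<And>v. norm v < d \<Longrightarrow> norm (poly Q 0) / 2 < norm (poly Q v)"
    unfolding eventually_nhds_metric by (auto simp: dist_norm)
  have near: "poly Q v \<noteq> 0 \<and> norm (poly P v / poly Q v) \<le> 2 * C2 / norm (poly Q 0) * norm v"
    if v: "norm v < d" "norm v \<le> 1" for v
  proof -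
    have "norm (poly P v) \<le> norm v * C2" using C2(2)[of v] v
      unfolding P' by (auto simp: norm_mult intro!: mult_left_mono)
    then have "norm (poly P v) / norm (poly Q v) \<le> norm v * C2 / (norm (poly Q 0) / 2)"
      using d(2)[OF v(1)] Q00 C2(1) by (intro frac_le) auto
    then show ?thesis using d(2)[OF v(1)] Q00 by (auto simp: norm_divide field_simps)
  qed
  define C where "C = Max {1, C1 / c, 2 * C2 / norm (poly Q 0)}"
  define B where "B = Max {1, B1, 2 / d}"
  have C: "1 \<le> C" "C1 / c \<le> C" "2 * C2 / norm (poly Q 0) \<le> C" unfolding C_def by auto
  have B: "1 \<le> B" "B1 \<le> B" "2 / d \<le> B" unfolding B_def by auto
  have small: "norm v < d \<and> norm v \<le> 1" if "norm v \<le> 1 / B" for v :: complex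
  proof -
    have "1 / B \<le> 1" using B by simp
    moreover have "1 / B \<le> 1 / (2 / d)" using B d by (intro divide_left_mono) auto
    then have "1 / B < d" using d(1) by simp
    ultimately show ?thesis using that by linarith
  qed
  show ?thesis
  proof (rule exI[of _ C], rule conjI, rule C(1), rule exI[of _ B], intro conjI allI impI B(1))
    fix v :: complex assume v: "B \<le> norm v"
    then show "poly Q v \<noteq> 0" using far[of v] B by simp
    have "C1 / c / norm v \<le> C / norm v" using C by (intro divide_right_mono) auto
    then show "norm (poly P v / poly Q v) \<le> C / norm v" using far[of v] B v by simp
  next
    fix v :: complex assume v: "norm v \<le> 1 / B"
    then show "poly Q v \<noteq> 0" using near[of v] small[of v] by simp
    have "2 * C2 / norm (poly Q 0) * norm v \<le> C * norm v" using C by (intro mult_right_mono) auto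
    then show "norm (poly P v / poly Q v) \<le> C * norm v" using near[of v] small[of v] v by simp
  qed
qed

text \<open>For small \<open>x\<close> this is compactness and the absence of zeros on the ray, for large \<open>x\<close> the leading term.\<close>

lemma denominator_ray_lower_bound:
  assumes "represents \<alpha> P Q G"
  shows "\<exists>c>0. \<forall>x\<ge>0. c * max 1 x ^ degree Q \<le> norm (poly Q (of_real x))"
proof -
  have Q0: "Q \<noteq> 0" and Qx: "\<And>x. x \<ge> 0 \<Longrightarrow> poly Q (of_real x) \<noteq> 0"
    using assms unfolding represents_def by auto
  obtain c B where c: "c > 0" "B \<ge> 1" "\<And>v. B \<le> norm v \<Longrightarrow> c * norm v ^ degree Q \<le> norm (poly Q v)"
    using poly_norm_ge_power[OF Q0] by blast
  have "\<exists>x\<in>{0..B}. \<forall>y\<in>{0..B}. norm (poly Q (of_real x)) \<le> norm (poly Q (of_real y))"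
    using c by (intro continuous_attains_inf continuous_intros) auto
  then obtain x0 where x0: "x0 \<in> {0..B}" "\<And>y. y \<in> {0..B} \<Longrightarrow> norm (poly Q (of_real x0)) \<le> norm (poly Q (of_real y))"
    by blast
  let ?m = "norm (poly Q (of_real x0))"
  have m: "?m > 0" using Qx[of x0] x0 by simp
  show ?thesis
  proof (intro exI conjI allI impI)
    show "0 < min c (?m / B ^ degree Q)" using c m by simp
    fix x :: real assume x: "x \<ge> 0"
    show "min c (?m / B ^ degree Q) * max 1 x ^ degree Q \<le> norm (poly Q (of_real x))"
    proof (cases "x \<le> B")
      case True
      have "min c (?m / B ^ degree Q) * max 1 x ^ degree Q \<le> (?m / B ^ degree Q) * B ^ degree Q"
        using True c x m by (intro mult_mono power_mono) auto
      also have "\<dots> = ?m" using c by simp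
      finally show ?thesis using x0(2)[of x] True x by auto
    next
      case False
      have "min c (?m / B ^ degree Q) * max 1 x ^ degree Q \<le> c * x ^ degree Q"
        using False c x by (intro mult_mono) (auto simp: max_def)
      also have "\<dots> \<le> norm (poly Q (of_real x))" using c(3)[of "of_real x"] False x by simp
      finally show ?thesis .
    qed
  qed
qed

lemma rational_function_ray_decay:
  assumes "represents \<alpha> P Q G"
  shows "\<exists>C\<ge>1. \<forall>x>0. norm (poly P (of_real x) / poly Q (of_real x)) \<le> C * min x (1 / x)"
proof -
  obtain C B where C: "C \<ge> 1" "B \<ge> 1"
    and far: "\<And>v. B \<le> norm v \<Longrightarrow> norm (poly P v / poly Q v) \<le> C / norm v"
    and near: "\<And>v. norm v \<le> 1 / B \<Longrightarrow> norm (poly P v / poly Q v) \<le> C * norm v"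
    using rational_function_decay[OF assms] by blast
  have Qx: "\<And>x. x \<ge> 0 \<Longrightarrow> poly Q (of_real x) \<noteq> 0"
    using assms unfolding represents_def by auto
  have "1 / B \<le> 1" using C by simp
  have "\<exists>x\<in>{1 / B..B}. \<forall>y\<in>{1 / B..B}. norm (poly P (of_real y) / poly Q (of_real y)) \<le> norm (poly P (of_real x) / poly Q (of_real x))"
  proof (intro continuous_attains_sup continuous_intros)
    have "1 / B \<le> B" using C \<open>1 / B \<le> 1\<close> by linarith
    then show "{1 / B..B} \<noteq> {}" by simp
    show "\<forall>x\<in>{1 / B..B}. poly Q (of_real x) \<noteq> 0"
    proof
      fix x assume "x \<in> {1 / B..B}"
      moreover have "0 \<le> 1 / B" using C by simp
      ultimately have "x \<ge> 0" unfolding atLeastAtMost_iff by linarith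
      then show "poly Q (of_real x) \<noteq> 0" by (rule Qx)
    qed
  qed auto
  then obtain m where m: "m \<ge> 0" "\<And>y. y \<in> {1 / B..B} \<Longrightarrow> norm (poly P (of_real y) / poly Q (of_real y)) \<le> m"
    by (metis norm_ge_zero)
  show ?thesis
  proof (intro exI conjI allI impI)
    show "max C (m * B) \<ge> 1" using C by auto
    fix x :: real assume x: "0 < x"
    consider "x \<le> 1 / B" | "B \<le> x" | "x \<in> {1 / B..B}" by fastforce
    then show "norm (poly P (of_real x) / poly Q (of_real x)) \<le> max C (m * B) * min x (1 / x)"
    proof cases
      case 1
      have "x \<le> 1" using 1 \<open>1 / B \<le> 1\<close> by linarith
      then have "1 \<le> 1 / x" using x by simp
      with \<open>x \<le> 1\<close> have mn: "min x (1 / x) = x" by linarith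
      have "norm (poly P (of_real x) / poly Q (of_real x)) \<le> C * x" using near[of "of_real x"] 1 x by simp
      also have "\<dots> \<le> max C (m * B) * x" using x by (intro mult_right_mono) auto
      finally show ?thesis unfolding mn .
    next
      case 2
      have "1 \<le> x" using 2 C by linarith
      then have "1 / x \<le> 1" using x by simp
      with \<open>1 \<le> x\<close> have mn: "min x (1 / x) = 1 / x" by linarith
      have "norm (poly P (of_real x) / poly Q (of_real x)) \<le> C * (1 / x)" using far[of "of_real x"] 2 x by simp
      also have "\<dots> \<le> max C (m * B) * (1 / x)" using x by (intro mult_right_mono) auto
      finally show ?thesis unfolding mn .
    next
      case 3
      have "1 / B \<le> 1 / x" using 3 x C by (intro divide_left_mono) auto
      then have mn: "1 / B \<le> min x (1 / x)" using 3 by (simp only: atLeastAtMost_iff min.bounded_iff simp_thms)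
      have "norm (poly P (of_real x) / poly Q (of_real x)) \<le> m" by (rule m(2)[OF 3])
      also have "\<dots> = m * B * (1 / B)" using C by simp
      also have "\<dots> \<le> max C (m * B) * min x (1 / x)"
        using mn C m by (intro mult_mono) auto
      finally show ?thesis .
    qed
  qed
qed

text \<open>The greatest integer exists because a quasi-period \<open>2 \<pi> \<i> / (k \<alpha>)\<close> rotates the finite set of zeros of \<open>P * Q\<close>:
  a zero \<open>w0 \<noteq> 0\<close> of \<open>Q\<close> has \<open>k\<close> distinct images.\<close>

lemma k_num_quasi_period:
  assumes \<alpha>: "\<alpha> > 0" and r: "represents \<alpha> P Q G"
  shows "k_num \<alpha> G > 0 \<and>
    (\<exists>c. \<forall>z. G (z + 2 * of_real pi * \<i> / (of_nat (k_num \<alpha> G) * of_real \<alpha>)) = c * G z)"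
proof -
  let ?pr = "\<lambda>k. k > 0 \<and> (\<exists>c. \<forall>z. G (z + 2 * of_real pi * \<i> / (of_nat k * of_real \<alpha>)) = c * G z)"
  have Geq: "G z = poly P (exp (of_real \<alpha> * z)) / poly Q (exp (of_real \<alpha> * z))" for z
    using r unfolding represents_def by blast
  have Qx: "\<And>x. x \<ge> 0 \<Longrightarrow> poly Q (of_real x) \<noteq> 0"
    using r unfolding represents_def by auto
  have nz: "P \<noteq> 0" "Q \<noteq> 0" "0 < degree Q" "poly Q 0 \<noteq> 0"
    using r Qx[of 0] unfolding represents_def by auto
  have e: "exp (of_real \<alpha> * (z + 2 * of_real pi * \<i> / (of_nat k * of_real \<alpha>)))
      = exp (of_real \<alpha> * z) * cis (2 * pi / of_nat k)" if "k > 0" for z k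
  proof -
    have "of_real \<alpha> * (z + 2 * of_real pi * \<i> / (of_nat k * of_real \<alpha>))
        = of_real \<alpha> * z + \<i> * of_real (2 * pi / of_nat k)"
      unfolding distrib_left using \<alpha> by simp
    then show ?thesis by (simp only: exp_add cis_conv_exp)
  qed
  have "?pr 1"
  proof (intro conjI exI[of _ 1] allI)
    fix z show "G (z + 2 * of_real pi * \<i> / (of_nat 1 * of_real \<alpha>)) = 1 * G z"
      unfolding Geq e[of 1, OF zero_less_one] by simp
  qed simp
  moreover have "k \<le> card {w. poly (P * Q) w = 0}" if k: "?pr k" for k
  proof -
    from k obtain c where k0: "k > 0" and c: "\<And>z. G (z + 2 * of_real pi * \<i> / (of_nat k * of_real \<alpha>)) = c * G z" by blast
    obtain w0 where w0: "poly Q w0 = 0"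
      using Fundamental_Theorem_Algebra.fundamental_theorem_of_algebra[of Q] constant_degree[of Q] nz(3) by auto
    then have "w0 \<noteq> 0" using nz(4) by auto
    have zero: "poly (P * Q) (w0 * cis (2 * pi * real j / real k)) = 0" for j
    proof (induction j)
      case 0
      then show ?case using w0 by simp
    next
      case (Suc j)
      define w where "w = w0 * cis (2 * pi * real j / real k)"
      have "w \<noteq> 0" using \<open>w0 \<noteq> 0\<close> by (simp add: w_def)
      define z where "z = Ln w / of_real \<alpha>"
      have ez: "exp (of_real \<alpha> * z) = w" using \<open>w \<noteq> 0\<close> \<alpha> by (simp add: z_def)
      have "G z = 0" unfolding Geq ez using Suc unfolding w_def[symmetric] by auto
      then have "poly P (w * cis (2 * pi / k)) / poly Q (w * cis (2 * pi / k)) = 0"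
        using c[of z] unfolding Geq[of "z + _"] e[OF k0] ez by simp
      moreover have "w * cis (2 * pi / k) = w0 * cis (2 * pi * real (Suc j) / real k)"
        unfolding w_def mult.assoc cis_mult by (simp add: add_divide_distrib distrib_left add.commute)
      ultimately show ?case by auto
    qed
    have "inj_on (\<lambda>j. w0 * cis (2 * pi * real j / real k)) {..<k}"
      using Complex.bij_betw_roots_unity[OF k0] \<open>w0 \<noteq> 0\<close>
      unfolding bij_betw_def by (auto simp: inj_on_def)
    then have "k = card ((\<lambda>j. w0 * cis (2 * pi * real j / real k)) ` {..<k})"
      by (simp add: card_image)
    also have "\<dots> \<le> card {w. poly (P * Q) w = 0}"
      using zero nz by (intro card_mono poly_roots_finite) (auto simp del: poly_mult)
    finally show ?thesis .
  qed
  ultimately have "?pr (GREATEST k. ?pr k)"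
    by (intro GreatestI_nat[where P = ?pr and k = 1 and b = "card {w. poly (P * Q) w = 0}"])
  then show ?thesis unfolding k_num_def .
qed

text \<open>Since \<open>P\<close> and \<open>Q\<close> have no common zero, the rotation by \<open>\<omega>\<close> maps the zeros of \<open>Q\<close> to zeros of \<open>Q\<close>.  In particular no
  rotated positive ray meets a zero of \<open>Q\<close>, so the quasi-periodicity of \<open>f\<close> really transports sample values.\<close>

lemma quasi_period_rotates_fraction:
  assumes \<alpha>: "\<alpha> > 0" and r: "represents \<alpha> P Q G" and k: "k > (0::nat)"
    and c: "\<And>z. G (z + 2 * of_real pi * \<i> / (of_nat k * of_real \<alpha>)) = c * G z"
    and \<omega>: "\<omega> = cis (2 * pi / real k)"
  shows "w \<noteq> 0 \<Longrightarrow> poly P (\<omega> * w) / poly Q (\<omega> * w) = c * (poly P w / poly Q w)"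
    and "poly Q w \<noteq> 0 \<Longrightarrow> poly Q (\<omega> * w) \<noteq> 0"
proof -
  have Geq: "G z = poly P (exp (of_real \<alpha> * z)) / poly Q (exp (of_real \<alpha> * z))" for z
    using r unfolding represents_def by blast
  have nz: "P \<noteq> 0" "Q \<noteq> 0" and cop: "\<nexists>w. poly P w = 0 \<and> poly Q w = 0"
    using r unfolding represents_def by auto
  have e: "exp (of_real \<alpha> * (z + 2 * of_real pi * \<i> / (of_nat k * of_real \<alpha>)))
      = \<omega> * exp (of_real \<alpha> * z)" for z
  proof -
    have "of_real \<alpha> * (z + 2 * of_real pi * \<i> / (of_nat k * of_real \<alpha>))
        = \<i> * of_real (2 * pi / of_nat k) + of_real \<alpha> * z"
      unfolding distrib_left using \<alpha> by simp
    then show ?thesis by (simp only: exp_add cis_conv_exp \<omega>)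
  qed
  have rot: "poly P (\<omega> * w) / poly Q (\<omega> * w) = c * (poly P w / poly Q w)" if "w \<noteq> 0" for w
  proof -
    define z where "z = Ln w / of_real \<alpha>"
    have "exp (of_real \<alpha> * z) = w" using that \<alpha> by (simp add: z_def)
    then show ?thesis using c[of z] unfolding Geq e by simp
  qed
  then show "w \<noteq> 0 \<Longrightarrow> poly P (\<omega> * w) / poly Q (\<omega> * w) = c * (poly P w / poly Q w)" .
  define P1 Q1 where "P1 = pcompose P [:0, \<omega>:]" and "Q1 = pcompose Q [:0, \<omega>:]"
  have "\<omega> \<noteq> 0" unfolding \<omega> by simp
  then have "Q1 \<noteq> 0" using nz unfolding Q1_def by (simp add: pcompose_eq_0_iff)
  have ev: "poly P1 w = poly P (\<omega> * w)" "poly Q1 w = poly Q (\<omega> * w)" for w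
    by (simp_all add: P1_def Q1_def poly_pcompose mult.commute)
  define A where "A = P1 * Q - smult c (P * Q1)"
  have "poly (A * (Q * Q1 * [:0, 1:])) w = 0" for w
  proof (cases "w = 0 \<or> poly Q w = 0 \<or> poly Q1 w = 0")
    case False
    then have "poly P1 w * poly Q w = c * (poly P w * poly Q1 w)"
      using rot[of w] unfolding ev by (simp add: field_simps)
    then have "poly A w = 0" by (simp add: A_def)
    then show ?thesis by simp
  qed auto
  then have "A * (Q * Q1 * [:0, 1:]) = 0" using poly_all_0_iff_0 by blast
  then have A0: "A = 0" using nz \<open>Q1 \<noteq> 0\<close> by simp
  show "poly Q (\<omega> * w) \<noteq> 0" if "poly Q w \<noteq> 0"
  proof
    assume "poly Q (\<omega> * w) = 0"
    moreover have "poly A w = 0" using A0 by simp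
    ultimately have "poly P (\<omega> * w) * poly Q w = 0" unfolding A_def by (simp add: ev)
    with that have "poly P (\<omega> * w) = 0" by simp
    with \<open>poly Q (\<omega> * w) = 0\<close> cop show False by blast
  qed
qed

section \<open>Counting functions and uniform densities\<close>

text \<open>Dividing by the separation and rounding down is injective on the set.\<close>

lemma card_separated_le:
  fixes S :: "real set"
  assumes "0 < s" and sep: "\<And>x y. x \<in> S \<Longrightarrow> y \<in> S \<Longrightarrow> x \<noteq> y \<Longrightarrow> s \<le> \<bar>x - y\<bar>"
    and sub: "S \<subseteq> {a..b}" and "a \<le> b"
  shows "finite S" and "real (card S) \<le> (b - a) / s + 1"
proof -
  let ?f = "\<lambda>x. nat \<lfloor>(x - a) / s\<rfloor>"
  have inj: "inj_on ?f S"
  proof (rule inj_onI, rule ccontr)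
    fix x y assume xy: "x \<in> S" "y \<in> S" "?f x = ?f y" "x \<noteq> y"
    have "0 \<le> (x - a) / s" "0 \<le> (y - a) / s" using xy sub assms(1) by (auto intro!: divide_nonneg_pos)
    then have "\<lfloor>(x - a) / s\<rfloor> = \<lfloor>(y - a) / s\<rfloor>" using xy(3) by (metis eq_nat_nat_iff zero_le_floor)
    then have "\<bar>(x - a) / s - (y - a) / s\<bar> < 1" by linarith
    moreover have "(x - a) / s - (y - a) / s = (x - y) / s" using assms(1) by (simp add: field_simps)
    ultimately have "\<bar>x - y\<bar> < s" using assms(1) by (simp add: field_simps)
    with sep[OF xy(1,2,4)] show False by linarith
  qed
  have im: "?f ` S \<subseteq> {..nat \<lfloor>(b - a) / s\<rfloor>}"
  proof (rule image_subsetI)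
    fix x assume "x \<in> S"
    then have "(x - a) / s \<le> (b - a) / s" using sub assms(1) by (auto intro!: divide_right_mono)
    then show "?f x \<in> {..nat \<lfloor>(b - a) / s\<rfloor>}" by (auto intro!: nat_mono floor_mono)
  qed
  show fin: "finite S" using inj_on_finite[OF inj im] by simp
  have "card S \<le> card {..nat \<lfloor>(b - a) / s\<rfloor>}" by (rule card_inj_on_le[OF inj im]) simp
  then have "real (card S) \<le> real (nat \<lfloor>(b - a) / s\<rfloor>) + 1" by simp
  also have "\<dots> \<le> (b - a) / s + 1" using assms by (simp add: divide_nonneg_pos)
  finally show "real (card S) \<le> (b - a) / s + 1" .
qed

lemma separated_setE:
  assumes "separated_set S"
  obtains s where "0 < s" "\<And>x y. x \<in> S \<Longrightarrow> y \<in> S \<Longrightarrow> x \<noteq> y \<Longrightarrow> s \<le> \<bar>x - y\<bar>"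
proof -
  obtain e where "e > 0" "\<And>x y. x \<in> S \<Longrightarrow> y \<in> S \<Longrightarrow> dist x y < e \<Longrightarrow> x = y"
    using assms unfolding separated_set_iff_uniform_discrete uniform_discrete_def by blast
  then show thesis by (intro that[of e]) (auto simp: dist_real_def not_less[symmetric])
qed

definition window_count :: "real set \<Rightarrow> real \<Rightarrow> real \<Rightarrow> real" where
  "window_count S R x = real (card (S \<inter> {x - R..x + R}))"

lemma separated_window_count:
  assumes "separated_set S"
  obtains D where "D > 0" "\<And>R x. R \<ge> 0 \<Longrightarrow> window_count S R x \<le> D * R + 1"
    "\<And>R x. finite (S \<inter> {x - R..x + R})"
proof -
  obtain s where s: "0 < s" "\<And>x y. x \<in> S \<Longrightarrow> y \<in> S \<Longrightarrow> x \<noteq> y \<Longrightarrow> s \<le> \<bar>x - y\<bar>"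
    using separated_setE[OF assms] by blast
  have "window_count S R x \<le> 2 / s * R + 1" if "R \<ge> 0" for R x
    unfolding window_count_def
    using card_separated_le(2)[of s "S \<inter> {x - R..x + R}" "x - R" "x + R"] s that by auto
  moreover have "finite (S \<inter> {x - R..x + R})" for R x
  proof (cases "R \<ge> 0")
    case True
    then show ?thesis
      using card_separated_le(1)[of s "S \<inter> {x - R..x + R}" "x - R" "x + R"] s by auto
  qed auto
  ultimately show thesis using s by (intro that[of "2 / s"]) auto
qed

text \<open>The limit exists by subadditivity: an interval of radius \<open>R\<close> is covered by about \<open>R / R0\<close> intervals of
  radius \<open>R0\<close>, so the limit is the infimum over \<open>R\<close>.\<close>

lemma upper_density_tendsto:
  assumes "separated_set S"
  shows "((\<lambda>R. SUP x. window_count S R x / (2 * R)) \<longlongrightarrow> upper_density S) at_top"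
proof -
  obtain D where D: "D > 0" "\<And>R x. R \<ge> 0 \<Longrightarrow> window_count S R x \<le> D * R + 1"
    and fin: "\<And>R x. finite (S \<inter> {x - R..x + R})"
    using separated_window_count[OF assms] by blast
  define u where "u R = (SUP x. window_count S R x / (2 * R))" for R
  have wc0: "window_count S R x \<ge> 0" for R x by (simp add: window_count_def)
  have bdd: "bdd_above (range (\<lambda>x. window_count S R x / (2 * R)))" if "R > 0" for R
    by (rule bdd_aboveI2[of _ _ "(D * R + 1) / (2 * R)"]) (use D(2)[of R] that in \<open>simp add: divide_right_mono\<close>)
  have le_u: "window_count S R x \<le> 2 * R * u R" if "R > 0" for R x
    using cSUP_upper[OF UNIV_I bdd[OF that], of x] that unfolding u_def by (simp add: field_simps)
  have u0: "u R \<ge> 0" if "R > 0" for R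
    using order_trans[OF wc0 le_u[OF that]] that by (simp add: zero_le_mult_iff)
  have cover: "u R \<le> (1 + R0 / R) * u R0" if R: "R > 0" "R0 > 0" for R R0
    unfolding u_def[of R]
  proof (rule cSUP_least)
    fix x :: real
    define N where "N = nat \<lceil>R / R0\<rceil>"
    have "0 < R / R0" using R by simp
    then have N: "R / R0 \<le> real N" "real N \<le> R / R0 + 1"
      unfolding N_def by linarith+
    let ?J = "\<lambda>i. S \<inter> {x - R + (2 * real i + 1) * R0 - R0..x - R + (2 * real i + 1) * R0 + R0}"
    have "S \<inter> {x - R..x + R} \<subseteq> (\<Union>i<N. ?J i)"
    proof
      fix y assume y: "y \<in> S \<inter> {x - R..x + R}"
      define i where "i = nat \<lfloor>(y - (x - R)) / (2 * R0)\<rfloor>"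
      have t0: "0 \<le> (y - (x - R)) / (2 * R0)" using y R by (auto intro!: divide_nonneg_pos)
      have i: "real i \<le> (y - (x - R)) / (2 * R0)" "(y - (x - R)) / (2 * R0) < real i + 1"
        unfolding i_def using t0 by linarith+
      have in_i: "x - R + (2 * real i + 1) * R0 - R0 \<le> y" "y \<le> x - R + (2 * real i + 1) * R0 + R0"
        using i R by (auto simp: field_simps)
      have tN: "(y - (x - R)) / (2 * R0) \<le> real N"
      proof -
        have "(y - (x - R)) / (2 * R0) \<le> (2 * R) / (2 * R0)" using y R by (intro divide_right_mono) auto
        then show ?thesis using N by simp
      qed
      show "y \<in> (\<Union>i<N. ?J i)"
      proof (cases "i < N")
        case True
        then show ?thesis using in_i y by auto
      next
        case False
        then have "real N \<le> real i" by simp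
        then have eq: "(y - (x - R)) / (2 * R0) = real N" using i tN by linarith
        have "0 < R / R0" using R by simp
        then have "N \<noteq> 0" using N by (intro notI) simp
        moreover have "y = x - R + 2 * R0 * real N" using eq R by (simp add: field_simps)
        ultimately show ?thesis using y R
          by (intro UN_I[of "N - 1"]) (auto simp: of_nat_diff algebra_simps)
      qed
    qed
    then have "card (S \<inter> {x - R..x + R}) \<le> card (\<Union>i<N. ?J i)"
      by (intro card_mono finite_UN_I fin) auto
    also have "\<dots> \<le> (\<Sum>i<N. card (?J i))"
      by (intro card_UN_le) auto
    finally have "window_count S R x \<le> (\<Sum>i<N. window_count S R0 (x - R + (2 * real i + 1) * R0))"
      unfolding window_count_def of_nat_sum[symmetric] of_nat_le_iff .
    also have "\<dots> \<le> (\<Sum>i<N. 2 * R0 * u R0)" by (intro sum_mono le_u R)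
    also have "\<dots> = real N * (2 * R0 * u R0)" by simp
    also have "\<dots> \<le> (R / R0 + 1) * (2 * R0 * u R0)"
      using N R u0[OF R(2)] by (intro mult_right_mono) auto
    also have "(R / R0 + 1) * (2 * R0 * u R0) = (1 + R0 / R) * u R0 * (2 * R)"
    proof -
      have "(R / R0 + 1) * (2 * R0) = (1 + R0 / R) * (2 * R)"
        using R by (simp add: distrib_right)
      then have "(R / R0 + 1) * (2 * R0) * u R0 = (1 + R0 / R) * (2 * R) * u R0" by simp
      then show ?thesis by (simp only: mult_ac)
    qed
    finally show "window_count S R x / (2 * R) \<le> (1 + R0 / R) * u R0"
      using R by (simp only: pos_divide_le_eq mult_pos_pos zero_less_numeral)
  qed simp
  define l where "l = (INF R\<in>{0<..}. u R)"
  have bddu: "bdd_below (u ` {0<..})" using u0 by (intro bdd_belowI2[of _ 0]) auto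
  have "(u \<longlongrightarrow> l) at_top"
  proof (rule order_tendstoI)
    fix a assume a: "a < l"
    have "\<forall>\<^sub>F R in at_top. R > (0::real)" by (rule eventually_gt_at_top)
    then show "\<forall>\<^sub>F R in at_top. a < u R"
    proof eventually_elim
      case (elim R)
      then have "l \<le> u R" unfolding l_def by (intro cINF_lower bddu) auto
      then show ?case using a by linarith
    qed
  next
    fix a assume a: "l < a"
    then obtain R0 where R0: "R0 > 0" "u R0 < a"
      unfolding l_def using cINF_less_iff[OF _ bddu, of a] by auto
    have "((\<lambda>R. (1 + R0 / R) * u R0) \<longlongrightarrow> (1 + 0) * u R0) at_top"
      by (intro tendsto_intros tendsto_divide_0[OF tendsto_const] filterlim_at_top_imp_at_infinity filterlim_ident)
    then have "\<forall>\<^sub>F R in at_top. (1 + R0 / R) * u R0 < a"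
      using R0 by (intro order_tendstoD(2)) auto
    then show "\<forall>\<^sub>F R in at_top. u R < a"
      using eventually_gt_at_top[of 0]
    proof eventually_elim
      case (elim R)
      then show ?case using cover[of R R0] R0(1) by linarith
    qed
  qed
  moreover from this have "upper_density S = l"
    unfolding upper_density_def u_def window_count_def[symmetric] by (intro tendsto_Lim) auto
  ultimately show ?thesis unfolding u_def by simp
qed

text \<open>The limit exists by superadditivity: an interval of radius \<open>R\<close> contains about \<open>R / (R0 + 1)\<close> disjoint closed
  intervals of radius \<open>R0\<close>.  The spacing \<open>R0 + 1\<close> instead of \<open>R0\<close> keeps the closed intervals disjoint, and is the
  reason for the factor \<open>R0 / (R0 + 1)\<close> in \<open>g\<close>.\<close>

lemma lower_density_tendsto:
  assumes "separated_set S"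
  shows "((\<lambda>R. INF x. window_count S R x / (2 * R)) \<longlongrightarrow> lower_density S) at_top"
proof -
  obtain D where D: "D > 0" "\<And>R x. R \<ge> 0 \<Longrightarrow> window_count S R x \<le> D * R + 1"
    and fin: "\<And>R x. finite (S \<inter> {x - R..x + R})"
    using separated_window_count[OF assms] by blast
  define v where "v R = (INF x. window_count S R x / (2 * R))" for R
  define g where "g R = R / (R + 1) * v R" for R
  have wc0: "window_count S R x \<ge> 0" for R x by (simp add: window_count_def)
  have bdd: "bdd_below (range (\<lambda>x. window_count S R x / (2 * R)))" if "R > 0" for R
    using wc0 that by (intro bdd_belowI2[of _ 0]) auto
  have v_le: "2 * R * v R \<le> window_count S R x" if "R > 0" for R x
    using cINF_lower[OF bdd[OF that], of x] that unfolding v_def by (simp add: field_simps)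
  have v0: "v R \<ge> 0" if "R > 0" for R
    unfolding v_def using wc0 that by (intro cINF_greatest) auto
  have g0: "g R \<ge> 0" if "R > 0" for R using v0[OF that] that by (simp add: g_def)
  have pack: "(1 - (R0 + 1) / R) * g R0 \<le> v R" if R: "R > 0" "R0 > 0" for R R0
    unfolding v_def[of R]
  proof (rule cINF_greatest)
    fix x :: real
    define N where "N = nat \<lfloor>R / (R0 + 1)\<rfloor>"
    have "0 \<le> R / (R0 + 1)" using R by simp
    then have N: "R / (R0 + 1) - 1 \<le> real N" "real N \<le> R / (R0 + 1)"
      unfolding N_def by linarith+
    have N2: "real N * (R0 + 1) \<le> R" using N(2) R by (simp add: field_simps)
    define y where "y i = x - R + (2 * real i + 1) * (R0 + 1)" for i :: nat
    let ?J = "\<lambda>i. S \<inter> {y i - R0..y i + R0}"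
    have disj: "?J i \<inter> ?J j = {}" if "i < j" for i j
    proof -
      have "real i + 1 \<le> real j" using that by simp
      then have "(real i + 1) * (R0 + 1) \<le> real j * (R0 + 1)" using R by (intro mult_right_mono) auto
      then have "y i + R0 < y j - R0" unfolding y_def by (simp add: algebra_simps)
      then show ?thesis by auto
    qed
    have "?J i \<inter> ?J j = {}" if "i \<noteq> j" for i j
      using disj[of i j] disj[of j i] that by (cases "i < j") (auto simp: Int_commute)
    then have "(\<Sum>i<N. card (?J i)) = card (\<Union>i<N. ?J i)"
      by (intro card_UN_disjoint[symmetric]) (auto simp: fin)
    also have "\<dots> \<le> card (S \<inter> {x - R..x + R})"
    proof (intro card_mono fin UN_least)
      fix i assume "i \<in> {..<N}"
      then have "real i + 1 \<le> real N" by simp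
      then have "(real i + 1) * (R0 + 1) \<le> real N * (R0 + 1)" using R by (intro mult_right_mono) auto
      then have "(real i + 1) * (R0 + 1) \<le> R" using N2 by linarith
      then have "y i + R0 \<le> x + R" unfolding y_def by (simp add: algebra_simps)
      moreover have "0 \<le> real i * (R0 + 1)" using R by simp
      then have "x - R \<le> y i - R0" unfolding y_def by (simp add: algebra_simps)
      ultimately show "?J i \<subseteq> S \<inter> {x - R..x + R}" by auto
    qed
    finally have *: "(\<Sum>i<N. window_count S R0 (y i)) \<le> window_count S R x"
      unfolding window_count_def of_nat_sum[symmetric] of_nat_le_iff .
    have "(R / (R0 + 1) - 1) * (2 * R0 * v R0) \<le> real N * (2 * R0 * v R0)"
      using N R v0[OF R(2)] by (intro mult_right_mono) auto
    also have "\<dots> = (\<Sum>i<N. 2 * R0 * v R0)" by simp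
    also have "\<dots> \<le> (\<Sum>i<N. window_count S R0 (y i))" by (intro sum_mono v_le R)
    also note *
    finally have "(R / (R0 + 1) - 1) * (2 * R0 * v R0) / (2 * R) \<le> window_count S R x / (2 * R)"
      using R by (intro divide_right_mono) auto
    moreover have "(R / (R0 + 1) - 1) * (2 * R0 * v R0) / (2 * R) = (1 - (R0 + 1) / R) * g R0"
      unfolding g_def using R by (simp add: divide_simps)
    ultimately show "(1 - (R0 + 1) / R) * g R0 \<le> window_count S R x / (2 * R)" by simp
  qed simp
  define l where "l = (SUP R\<in>{0<..}. g R)"
  have bddg: "bdd_above (g ` {0<..})"
  proof (intro bdd_aboveI2[of _ _ "D + 1"])
    fix R :: real assume "R \<in> {0<..}"
    then have R: "R > 0" by simp
    have "2 * R * v R \<le> D * R + 1" using order_trans[OF v_le[OF R] D(2)] R by simp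
    moreover have "0 \<le> R * v R" using v0[OF R] R by simp
    ultimately have "R * v R \<le> D * R + 1" by linarith
    also have "\<dots> \<le> (D + 1) * (R + 1)" using R D by (simp add: algebra_simps)
    finally show "g R \<le> D + 1" unfolding g_def using R by (simp add: field_simps)
  qed
  have "(v \<longlongrightarrow> l) at_top"
  proof (rule order_tendstoI)
    fix a assume a: "l < a"
    have "((\<lambda>R::real. (1 + 1 / R) * l) \<longlongrightarrow> (1 + 0) * l) at_top"
      by (intro tendsto_intros tendsto_divide_0[OF tendsto_const] filterlim_at_top_imp_at_infinity filterlim_ident)
    then have "\<forall>\<^sub>F R in at_top. (1 + 1 / R) * l < a"
      using a by (intro order_tendstoD(2)) auto
    then show "\<forall>\<^sub>F R in at_top. v R < a" using eventually_gt_at_top[of 0]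
    proof eventually_elim
      case (elim R)
      have "g R \<le> l" unfolding l_def using elim by (intro cSUP_upper bddg) auto
      then have "(1 + 1 / R) * g R \<le> (1 + 1 / R) * l" using elim by (intro mult_left_mono) auto
      moreover have "1 + 1 / R = (R + 1) / R" using elim by (simp add: add_divide_distrib)
      then have "(1 + 1 / R) * g R = v R" unfolding g_def using elim by simp
      ultimately show ?case using elim by linarith
    qed
  next
    fix a assume a: "a < l"
    then obtain R0 where R0: "R0 > 0" "a < g R0"
      unfolding l_def using less_cSUP_iff[OF _ bddg, of a] by auto
    have "((\<lambda>R. (1 - (R0 + 1) / R) * g R0) \<longlongrightarrow> (1 - 0) * g R0) at_top"
      by (intro tendsto_intros tendsto_divide_0[OF tendsto_const] filterlim_at_top_imp_at_infinity filterlim_ident)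
    then have "\<forall>\<^sub>F R in at_top. a < (1 - (R0 + 1) / R) * g R0"
      using R0 by (intro order_tendstoD(1)) auto
    then show "\<forall>\<^sub>F R in at_top. a < v R"
      using eventually_gt_at_top[of 0]
    proof eventually_elim
      case (elim R)
      then show ?case using pack[of R R0] R0(1) by linarith
    qed
  qed
  moreover from this have "lower_density S = l"
    unfolding lower_density_def v_def window_count_def[symmetric] by (intro tendsto_Lim) auto
  ultimately show ?thesis unfolding v_def by simp
qed

lemma window_count_le_of_upper_density:
  assumes S: "separated_set S" and b: "upper_density S < b" "0 \<le> b"
  obtains C where "\<And>x R. 0 \<le> R \<Longrightarrow> window_count S R x \<le> 2 * b * R + C" "C \<ge> 0"
proof -
  obtain D where D: "D > 0" "\<And>R x. R \<ge> 0 \<Longrightarrow> window_count S R x \<le> D * R + 1"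
    using separated_window_count[OF S] by metis
  obtain R0 where R0: "\<And>R. R \<ge> R0 \<Longrightarrow> (SUP x. window_count S R x / (2 * R)) < b"
    using order_tendstoD(2)[OF upper_density_tendsto[OF S] b(1)]
    unfolding eventually_at_top_linorder by blast
  define R1 where "R1 = max R0 1"
  have "window_count S R x \<le> 2 * b * R + (D * R1 + 1)" if "0 \<le> R" for R x
  proof (cases "R \<ge> R1")
    case True
    then have R: "R \<ge> R0" "R > 0" unfolding R1_def by auto
    have "bdd_above (range (\<lambda>x. window_count S R x / (2 * R)))"
      by (rule bdd_aboveI2[of _ _ "(D * R + 1) / (2 * R)"]) (use D(2)[of R] R in \<open>simp add: divide_right_mono\<close>)
    then have "window_count S R x / (2 * R) \<le> (SUP x. window_count S R x / (2 * R))"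
      by (intro cSUP_upper) auto
    then have "window_count S R x / (2 * R) \<le> b" using R0[OF R(1)] by linarith
    then have "window_count S R x \<le> 2 * b * R" using R by (simp add: field_simps)
    moreover have "0 \<le> D * R1" using D by (simp add: R1_def)
    ultimately show ?thesis by linarith
  next
    case False
    then have "D * R \<le> D * R1" using D by simp
    moreover have "0 \<le> b * R" using b that by simp
    ultimately show ?thesis using D(2)[OF that, of x] by linarith
  qed
  moreover have "D * R1 + 1 \<ge> 0" using D by (simp add: R1_def)
  ultimately show thesis by (intro that[of "D * R1 + 1"]) auto
qed

lemma window_count_ge_of_lower_density:
  assumes S: "separated_set S" and a: "a < lower_density S"
  obtains C where "\<And>x R. 0 \<le> R \<Longrightarrow> 2 * a * R - C \<le> window_count S R x" "C \<ge> 0"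
proof -
  obtain R0 where R0: "\<And>R. R \<ge> R0 \<Longrightarrow> a < (INF x. window_count S R x / (2 * R))"
    using order_tendstoD(1)[OF lower_density_tendsto[OF S] a]
    unfolding eventually_at_top_linorder by blast
  define R1 where "R1 = max R0 1"
  have wc0: "window_count S R x \<ge> 0" for R x by (simp add: window_count_def)
  have "2 * a * R - 2 * \<bar>a\<bar> * R1 \<le> window_count S R x" if "0 \<le> R" for R x
  proof (cases "R \<ge> R1")
    case True
    then have R: "R \<ge> R0" "R > 0" unfolding R1_def by auto
    have "bdd_below (range (\<lambda>x. window_count S R x / (2 * R)))"
      using wc0 R by (intro bdd_belowI2[of _ 0]) auto
    then have "(INF x. window_count S R x / (2 * R)) \<le> window_count S R x / (2 * R)"
      by (intro cINF_lower) auto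
    then have "a \<le> window_count S R x / (2 * R)" using R0[OF R(1)] by linarith
    then have "2 * a * R \<le> window_count S R x" using R by (simp add: field_simps)
    moreover have "0 \<le> 2 * \<bar>a\<bar> * R1" by (simp add: R1_def)
    ultimately show ?thesis by linarith
  next
    case False
    have "2 * a * R \<le> 2 * \<bar>a\<bar> * R" using that by (intro mult_right_mono) auto
    also have "\<dots> \<le> 2 * \<bar>a\<bar> * R1" using False by (intro mult_left_mono) auto
    finally show ?thesis using wc0[of R x] by linarith
  qed
  moreover have "2 * \<bar>a\<bar> * R1 \<ge> 0" by (simp add: R1_def)
  ultimately show thesis by (intro that[of "2 * \<bar>a\<bar> * R1"]) auto
qed

section \<open>The local estimate in one window\<close>

text \<open>The quantitative properties of a generator that the estimate in a window uses, with constants that do not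
  depend on the sets of shifts and samples.  Beyond the abscissas \<open>- L\<close> and \<open>L\<close> the
  denominator \<open>Q (exp (\<alpha> z))\<close> has no zeros and the quotient decays exponentially.\<close>

locale exponential_rational =
  fixes \<alpha> :: real and P Q :: "complex poly" and q k :: nat and \<omega> c :: complex and C \<kappa> L :: real
  assumes \<alpha>: "\<alpha> > 0" and k: "k > 0" and \<omega>: "\<omega> = cis (2 * pi / real k)"
    and C: "C \<ge> 1" and \<kappa>: "0 < \<kappa>" "\<kappa> \<le> 1" and L: "L \<ge> 0"
    and P_le: "\<And>v. norm (poly P v) \<le> C * max 1 (norm v) ^ q"
    and Q_le: "\<And>v. norm (poly Q v) \<le> C * max 1 (norm v) ^ q"
    and Q_ray: "\<And>x. x \<ge> 0 \<Longrightarrow> \<kappa> * max 1 x ^ q \<le> norm (poly Q (of_real x))"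
    and far: "\<And>v. exp (\<alpha> * L) \<le> norm v \<Longrightarrow> poly Q v \<noteq> 0 \<and> norm (poly P v / poly Q v) \<le> C / norm v"
    and near: "\<And>v. norm v \<le> exp (- (\<alpha> * L)) \<Longrightarrow> poly Q v \<noteq> 0 \<and> norm (poly P v / poly Q v) \<le> C * norm v"
    and rot: "\<And>w. w \<noteq> 0 \<Longrightarrow> poly P (\<omega> * w) / poly Q (\<omega> * w) = c * (poly P w / poly Q w)"
    and rot_nz: "\<And>w. poly Q w \<noteq> 0 \<Longrightarrow> poly Q (\<omega> * w) \<noteq> 0"
begin

definition e :: "real \<Rightarrow> complex" where "e t = of_real (exp (\<alpha> * t))"

text \<open>Written in the variable \<open>w = exp (\<alpha> z)\<close>: at \<open>w = e x\<close> it is the sum of the shifts at \<open>x\<close>.\<close>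

definition shift_sum :: "real set \<Rightarrow> (real \<Rightarrow> complex) \<Rightarrow> complex \<Rightarrow> complex" where
  "shift_sum F cc w = (\<Sum>\<gamma>\<in>F. cc \<gamma> * (poly P (w * e (- \<gamma>)) / poly Q (w * e (- \<gamma>))))"

text \<open>The product of the shift sum and the denominators that belong to \<open>W\<close>, written such that no term with \<open>\<gamma> \<in> W\<close>
  divides by its denominator; it is therefore holomorphic also at those poles.\<close>

definition cleared_sum :: "real set \<Rightarrow> real set \<Rightarrow> (real \<Rightarrow> complex) \<Rightarrow> complex \<Rightarrow> complex" where
  "cleared_sum W F cc w = (\<Sum>\<gamma>\<in>F. cc \<gamma> *
     (poly P (w * e (- \<gamma>)) / (if \<gamma> \<in> W then 1 else poly Q (w * e (- \<gamma>)))) *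
     (\<Prod>\<gamma>'\<in>W - {\<gamma>}. poly Q (w * e (- \<gamma>'))))"

lemma norm_e [simp]: "norm (e t) = exp (\<alpha> * t)"
  by (simp add: e_def)

lemma e_nonzero [simp]: "e t \<noteq> 0"
  by (simp add: e_def)

lemma e_add: "e s * e t = e (s + t)"
  by (simp add: e_def distrib_left exp_add)

lemma cleared_sum_holomorphic:
  assumes "\<And>w \<gamma>. w \<in> U \<Longrightarrow> \<gamma> \<in> F - W \<Longrightarrow> poly Q (w * e (- \<gamma>)) \<noteq> 0"
  shows "cleared_sum W F cc holomorphic_on U"
proof -
  have pol: "(\<lambda>w. poly p (w * a)) holomorphic_on U" for p :: "complex poly" and a
    unfolding poly_altdef by (intro holomorphic_intros)
  have "(\<lambda>w. poly P (w * e (- \<gamma>)) / (if \<gamma> \<in> W then 1 else poly Q (w * e (- \<gamma>)))) holomorphic_on U"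
    if "\<gamma> \<in> F" for \<gamma>
    using assms that by (cases "\<gamma> \<in> W") (auto intro!: holomorphic_on_divide pol)
  then show ?thesis
    unfolding cleared_sum_def
    by (intro holomorphic_on_sum holomorphic_on_mult holomorphic_on_prod holomorphic_on_const pol)
qed

lemma cleared_sum_eq:
  assumes "finite W" "\<And>\<gamma>. \<gamma> \<in> W \<Longrightarrow> poly Q (w * e (- \<gamma>)) \<noteq> 0"
  shows "cleared_sum W F cc w = shift_sum F cc w * (\<Prod>\<gamma>\<in>W. poly Q (w * e (- \<gamma>)))"
proof -
  have "cc \<gamma> * (poly P (w * e (- \<gamma>)) / (if \<gamma> \<in> W then 1 else poly Q (w * e (- \<gamma>)))) *
     (\<Prod>\<gamma>'\<in>W - {\<gamma>}. poly Q (w * e (- \<gamma>')))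
     = cc \<gamma> * (poly P (w * e (- \<gamma>)) / poly Q (w * e (- \<gamma>))) * (\<Prod>\<gamma>\<in>W. poly Q (w * e (- \<gamma>)))" for \<gamma>
  proof (cases "\<gamma> \<in> W")
    case True
    then have "(\<Prod>\<gamma>\<in>W. poly Q (w * e (- \<gamma>))) = poly Q (w * e (- \<gamma>)) * (\<Prod>\<gamma>'\<in>W - {\<gamma>}. poly Q (w * e (- \<gamma>')))"
      using assms(1) by (simp add: prod.remove)
    then show ?thesis using True assms(2)[OF True] by simp
  qed simp
  then show ?thesis
    unfolding cleared_sum_def shift_sum_def sum_distrib_right by (intro sum.cong) auto
qed

text \<open>A term with \<open>\<gamma> \<in> W\<close> misses one factor of the product, which the bound for \<open>P\<close> replaces; a term with \<open>\<gamma> \<notin> W\<close> decays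
  because \<open>\<gamma>\<close> is far from the circle.  The weight \<open>exp (- \<alpha> \<bar>\<gamma>\<bar>)\<close> covers both kinds of terms, at the price of a factor
  \<open>exp (\<alpha> S)\<close>.\<close>

lemma norm_cleared_sum_le:
  assumes F: "finite F" and W: "W = {\<gamma> \<in> F. \<bar>\<gamma>\<bar> \<le> S}"
    and t: "norm w = exp (\<alpha> * t)" "\<bar>t\<bar> + L \<le> S"
  shows "norm (cleared_sum W F cc w)
    \<le> C * exp (\<alpha> * S) * (\<Sum>\<gamma>\<in>F. norm (cc \<gamma>) * exp (- \<alpha> * \<bar>\<gamma>\<bar>))
       * (\<Prod>\<gamma>\<in>W. C * max 1 (exp (\<alpha> * (t - \<gamma>))) ^ q)"
proof -
  let ?b = "\<lambda>\<gamma>. C * max 1 (exp (\<alpha> * (t - \<gamma>))) ^ q"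
  have finW: "finite W" using F W by auto
  have nv: "norm (w * e (- \<gamma>)) = exp (\<alpha> * (t - \<gamma>))" for \<gamma>
    unfolding norm_mult t norm_e exp_add[symmetric] by (simp add: algebra_simps)
  have b0: "0 \<le> ?b \<gamma>" for \<gamma> using C by simp
  have Qb: "norm (\<Prod>\<gamma>\<in>V. poly Q (w * e (- \<gamma>))) \<le> (\<Prod>\<gamma>\<in>V. ?b \<gamma>)" for V
    unfolding prod_norm[symmetric] using Q_le by (intro prod_mono) (auto simp flip: nv)
  have "norm (cc \<gamma> * (poly P (w * e (- \<gamma>)) / (if \<gamma> \<in> W then 1 else poly Q (w * e (- \<gamma>)))) *
     (\<Prod>\<gamma>'\<in>W - {\<gamma>}. poly Q (w * e (- \<gamma>'))))
     \<le> norm (cc \<gamma>) * (C * exp (\<alpha> * (S - \<bar>\<gamma>\<bar>)) * (\<Prod>\<gamma>\<in>W. ?b \<gamma>))" if \<gamma>F: "\<gamma> \<in> F" for \<gamma>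
    unfolding norm_mult mult.assoc
  proof (intro mult_left_mono norm_ge_zero)
    show "norm (poly P (w * e (- \<gamma>)) / (if \<gamma> \<in> W then 1 else poly Q (w * e (- \<gamma>))))
       * norm (\<Prod>\<gamma>'\<in>W - {\<gamma>}. poly Q (w * e (- \<gamma>')))
      \<le> C * (exp (\<alpha> * (S - \<bar>\<gamma>\<bar>)) * (\<Prod>\<gamma>\<in>W. ?b \<gamma>))"
    proof (cases "\<gamma> \<in> W")
      case True
      have "norm (poly P (w * e (- \<gamma>))) * norm (\<Prod>\<gamma>'\<in>W - {\<gamma>}. poly Q (w * e (- \<gamma>')))
        \<le> ?b \<gamma> * (\<Prod>\<gamma>'\<in>W - {\<gamma>}. ?b \<gamma>')"
        using P_le[of "w * e (- \<gamma>)"] unfolding nv by (intro mult_mono Qb b0) auto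
      also have "\<dots> = (\<Prod>\<gamma>\<in>W. ?b \<gamma>)" using prod.remove[OF finW True, of ?b] by simp
      also have "\<dots> \<le> (C * exp (\<alpha> * (S - \<bar>\<gamma>\<bar>))) * (\<Prod>\<gamma>\<in>W. ?b \<gamma>)"
      proof -
        have "0 \<le> \<alpha> * (S - \<bar>\<gamma>\<bar>)" using \<alpha> True W by auto
        then have "1 * 1 \<le> C * exp (\<alpha> * (S - \<bar>\<gamma>\<bar>))" using C by (intro mult_mono) auto
        then have "1 * (\<Prod>\<gamma>\<in>W. ?b \<gamma>) \<le> (C * exp (\<alpha> * (S - \<bar>\<gamma>\<bar>))) * (\<Prod>\<gamma>\<in>W. ?b \<gamma>)"
          by (intro mult_right_mono prod_nonneg) (use b0 in auto)
        then show ?thesis by simp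
      qed
      finally show ?thesis using True by (simp add: mult.assoc)
    next
      case False
      then have out: "S < \<bar>\<gamma>\<bar>" using \<gamma>F W by auto
      have "norm (poly P (w * e (- \<gamma>)) / poly Q (w * e (- \<gamma>))) \<le> C * exp (\<alpha> * (S - \<bar>\<gamma>\<bar>))"
      proof (cases "0 \<le> \<gamma>")
        case True
        then have "t - \<gamma> \<le> - L" "t - \<gamma> \<le> S - \<bar>\<gamma>\<bar>" using out t L by auto
        then have *: "\<alpha> * (t - \<gamma>) \<le> \<alpha> * (- L)" "\<alpha> * (t - \<gamma>) \<le> \<alpha> * (S - \<bar>\<gamma>\<bar>)" using \<alpha> by (simp_all only: mult_le_cancel_left_pos)
        then have "norm (poly P (w * e (- \<gamma>)) / poly Q (w * e (- \<gamma>))) \<le> C * exp (\<alpha> * (t - \<gamma>))"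
          using near[of "w * e (- \<gamma>)"] unfolding nv by simp
        also have "\<dots> \<le> C * exp (\<alpha> * (S - \<bar>\<gamma>\<bar>))" using * C by simp
        finally show ?thesis .
      next
        case False
        then have "L \<le> t - \<gamma>" "- (t - \<gamma>) \<le> S - \<bar>\<gamma>\<bar>" using out t L by auto
        then have *: "\<alpha> * L \<le> \<alpha> * (t - \<gamma>)" "\<alpha> * - (t - \<gamma>) \<le> \<alpha> * (S - \<bar>\<gamma>\<bar>)" using \<alpha> by (auto intro: mult_left_mono)
        then have "norm (poly P (w * e (- \<gamma>)) / poly Q (w * e (- \<gamma>))) \<le> C / exp (\<alpha> * (t - \<gamma>))"
          using far[of "w * e (- \<gamma>)"] unfolding nv by simp
        also have "\<dots> = C * exp (\<alpha> * - (t - \<gamma>))"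
          by (simp only: mult_minus_right exp_minus divide_inverse)
        also have "\<dots> \<le> C * exp (\<alpha> * (S - \<bar>\<gamma>\<bar>))" using *(2) C by simp
        finally show ?thesis .
      qed
      then have "norm (poly P (w * e (- \<gamma>)) / poly Q (w * e (- \<gamma>)))
          * norm (\<Prod>\<gamma>'\<in>W. poly Q (w * e (- \<gamma>')))
        \<le> (C * exp (\<alpha> * (S - \<bar>\<gamma>\<bar>))) * (\<Prod>\<gamma>\<in>W. ?b \<gamma>)"
        using C by (intro mult_mono Qb) auto
      then show ?thesis using False by (simp add: mult.assoc)
    qed
  qed
  then have "norm (cleared_sum W F cc w)
    \<le> (\<Sum>\<gamma>\<in>F. norm (cc \<gamma>) * (C * exp (\<alpha> * (S - \<bar>\<gamma>\<bar>)) * (\<Prod>\<gamma>\<in>W. ?b \<gamma>)))"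
    unfolding cleared_sum_def by (intro sum_norm_le)
  also have "\<dots> = (\<Sum>\<gamma>\<in>F. C * exp (\<alpha> * S) * (norm (cc \<gamma>) * exp (- \<alpha> * \<bar>\<gamma>\<bar>)) * (\<Prod>\<gamma>\<in>W. ?b \<gamma>))"
  proof (intro sum.cong refl)
    fix \<gamma>
    have "exp (\<alpha> * (S - \<bar>\<gamma>\<bar>)) = exp (\<alpha> * S) * exp (- \<alpha> * \<bar>\<gamma>\<bar>)"
      unfolding exp_add[symmetric] by (simp add: algebra_simps)
    then show "norm (cc \<gamma>) * (C * exp (\<alpha> * (S - \<bar>\<gamma>\<bar>)) * (\<Prod>\<gamma>\<in>W. ?b \<gamma>))
      = C * exp (\<alpha> * S) * (norm (cc \<gamma>) * exp (- \<alpha> * \<bar>\<gamma>\<bar>)) * (\<Prod>\<gamma>\<in>W. ?b \<gamma>)"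
      by (simp only: mult_ac)
  qed
  also have "\<dots> = C * exp (\<alpha> * S) * (\<Sum>\<gamma>\<in>F. norm (cc \<gamma>) * exp (- \<alpha> * \<bar>\<gamma>\<bar>)) * (\<Prod>\<gamma>\<in>W. ?b \<gamma>)"
    by (simp only: sum_distrib_left[symmetric] sum_distrib_right[symmetric])
  finally show ?thesis .
qed

text \<open>The pair \<open>(x, j)\<close> stands for the point \<open>x + 2 \<pi> \<i> j / (k \<alpha>)\<close>, seen in the variable \<open>w\<close>.\<close>

definition node :: "real \<times> nat \<Rightarrow> complex" where
  "node p = \<omega> ^ snd p * e (fst p)"

lemma norm_omega [simp]: "norm \<omega> = 1"
  by (simp add: \<omega>)

lemma norm_node [simp]: "norm (node p) = exp (\<alpha> * fst p)"
  by (simp add: node_def norm_mult norm_power)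

lemma omega_powers_separated:
  "\<exists>\<mu>>0. \<forall>i<k. \<forall>j<k. i \<noteq> j \<longrightarrow> \<mu> \<le> norm (\<omega> ^ i - \<omega> ^ j)"
proof -
  let ?D = "(\<lambda>(i, j). norm (\<omega> ^ i - \<omega> ^ j)) ` {(i, j). i < k \<and> j < k \<and> i \<noteq> j}"
  have "finite ({..<k} \<times> {..<k})" by simp
  then have fin: "finite {(i, j). i < k \<and> j < k \<and> i \<noteq> j}"
    by (rule rev_finite_subset) auto
  have pw: "\<omega> ^ j = cis (2 * pi * real j / real k)" for j
    unfolding \<omega> Complex.DeMoivre by (simp add: mult_ac)
  have inj: "inj_on (\<lambda>j. \<omega> ^ j) {..<k}"
    using Complex.bij_betw_roots_unity[OF k] unfolding pw bij_betw_def by blast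
  have pos: "0 < x" if "x \<in> ?D" for x
    using that inj by (auto simp: inj_on_def)
  show ?thesis
  proof (intro exI conjI allI impI)
    show "0 < Min (insert 1 ?D)" using fin pos by (subst Min_gr_iff) auto
    fix i j assume "i < k" "j < k" "i \<noteq> j"
    then have "norm (\<omega> ^ i - \<omega> ^ j) \<in> insert 1 ?D" by auto
    then show "Min (insert 1 ?D) \<le> norm (\<omega> ^ i - \<omega> ^ j)"
      using fin by (intro Min_le) auto
  qed
qed

lemma nodes_separated:
  assumes "0 < s" "0 \<le> n"
  obtains \<sigma> where "0 < \<sigma>" "\<sigma> \<le> 1"
    "\<And>V p p'. (\<And>x. x \<in> V \<Longrightarrow> \<bar>x\<bar> \<le> n) \<Longrightarrow>
       (\<And>x y. x \<in> V \<Longrightarrow> y \<in> V \<Longrightarrow> x \<noteq> y \<Longrightarrow> s \<le> \<bar>x - y\<bar>) \<Longrightarrow>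
       p \<in> V \<times> {..<k} \<Longrightarrow> p' \<in> V \<times> {..<k} \<Longrightarrow> p \<noteq> p' \<Longrightarrow> \<sigma> \<le> norm (node p - node p')"
proof -
  obtain \<mu> where \<mu>: "\<mu> > 0" "\<And>i j. i < k \<Longrightarrow> j < k \<Longrightarrow> i \<noteq> j \<Longrightarrow> \<mu> \<le> norm (\<omega> ^ i - \<omega> ^ j)"
    using omega_powers_separated by blast
  \<comment> \<open>the two cases are different abscissas and equal abscissas with different rotations\<close>
  define \<sigma> where "\<sigma> = min 1 (min (exp (- (\<alpha> * n)) * (\<alpha> * s)) (exp (- (\<alpha> * n)) * \<mu>))"
  show thesis
  proof (rule that[of \<sigma>])
    show "0 < \<sigma>" "\<sigma> \<le> 1" using \<alpha> \<mu> assms by (auto simp: \<sigma>_def)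
    fix V p p'
    assume b: "\<And>x. x \<in> V \<Longrightarrow> \<bar>x\<bar> \<le> n"
      and sep: "\<And>x y. x \<in> V \<Longrightarrow> y \<in> V \<Longrightarrow> x \<noteq> y \<Longrightarrow> s \<le> \<bar>x - y\<bar>"
      and pp: "p \<in> V \<times> {..<k}" "p' \<in> V \<times> {..<k}" "p \<noteq> p'"
    obtain x i where p: "p = (x, i)" by (cases p)
    obtain y j where p': "p' = (y, j)" by (cases p')
    have m: "x \<in> V" "y \<in> V" "i < k" "j < k" using pp p p' by auto
    have low: "exp (- (\<alpha> * n)) \<le> exp (\<alpha> * z)" if "z \<in> V" for z
    proof -
      have "\<alpha> * (- n) \<le> \<alpha> * z" using b[OF that] \<alpha> by (intro mult_left_mono) auto
      then show ?thesis by simp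
    qed
    have gap: "exp (- (\<alpha> * n)) * (\<alpha> * s) \<le> \<bar>exp (\<alpha> * u) - exp (\<alpha> * v)\<bar>"
      if uv: "u \<in> V" "v \<in> V" "u < v" for u v
    proof -
      have "s \<le> v - u" using sep[OF uv(1,2)] uv(3) by auto
      then have "\<alpha> * s \<le> \<alpha> * (v - u)" using \<alpha> by simp
      also have "\<dots> \<le> exp (\<alpha> * (v - u)) - 1" using exp_ge_add_one_self[of "\<alpha> * (v - u)"] by linarith
      finally have "exp (- (\<alpha> * n)) * (\<alpha> * s) \<le> exp (\<alpha> * u) * (exp (\<alpha> * (v - u)) - 1)"
        using low[OF uv(1)] \<alpha> assms by (intro mult_mono) auto
      also have "\<dots> = exp (\<alpha> * v) - exp (\<alpha> * u)"
        unfolding right_diff_distrib exp_add[symmetric] by (simp add: algebra_simps)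
      finally show ?thesis by linarith
    qed
    show "\<sigma> \<le> norm (node p - node p')"
    proof (cases "x = y")
      case True
      then have "i \<noteq> j" using pp p p' by auto
      have "node p - node p' = (\<omega> ^ i - \<omega> ^ j) * e x"
        using True by (simp add: node_def p p' algebra_simps)
      then have "norm (node p - node p') = norm (\<omega> ^ i - \<omega> ^ j) * exp (\<alpha> * x)"
        by (simp add: norm_mult)
      moreover have "exp (- (\<alpha> * n)) * \<mu> \<le> exp (\<alpha> * x) * norm (\<omega> ^ i - \<omega> ^ j)"
        using low[OF m(1)] \<mu>(1) \<mu>(2)[OF m(3,4) \<open>i \<noteq> j\<close>] by (intro mult_mono) auto
      ultimately show ?thesis unfolding \<sigma>_def by (simp add: mult.commute)
    next
      case False
      have "exp (- (\<alpha> * n)) * (\<alpha> * s) \<le> \<bar>exp (\<alpha> * x) - exp (\<alpha> * y)\<bar>"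
        using gap[of x y] gap[of y x] m False by (cases "x < y") (auto simp: abs_minus_commute)
      also have "\<dots> = \<bar>norm (node p) - norm (node p')\<bar>" by (simp add: p p')
      also have "\<dots> \<le> norm (node p - node p')" by (rule norm_triangle_ineq3)
      finally show ?thesis unfolding \<sigma>_def by linarith
    qed
  qed
qed

lemma rotation_iterate:
  assumes "poly Q (e x) \<noteq> 0"
  shows "poly Q (\<omega> ^ j * e x) \<noteq> 0"
    and "poly P (\<omega> ^ j * e x) / poly Q (\<omega> ^ j * e x) = c ^ j * (poly P (e x) / poly Q (e x))"
proof -
  have "poly Q (\<omega> ^ j * e x) \<noteq> 0 \<and>
    poly P (\<omega> ^ j * e x) / poly Q (\<omega> ^ j * e x) = c ^ j * (poly P (e x) / poly Q (e x))"
  proof (induction j)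
    case (Suc j)
    have "\<omega> \<noteq> 0" by (simp add: \<omega>)
    then show ?case
      using Suc rot_nz[of "\<omega> ^ j * e x"] rot[of "\<omega> ^ j * e x"] by (simp add: mult.assoc)
  qed (use assms in simp)
  then show "poly Q (\<omega> ^ j * e x) \<noteq> 0"
    "poly P (\<omega> ^ j * e x) / poly Q (\<omega> ^ j * e x) = c ^ j * (poly P (e x) / poly Q (e x))"
    by auto
qed

lemma Q_e_nonzero: "poly Q (e x) \<noteq> 0"
proof -
  have "0 < \<kappa> * max 1 (exp (\<alpha> * x)) ^ q" using \<kappa> by simp
  also have "\<dots> \<le> norm (poly Q (e x))" unfolding e_def by (rule Q_ray) simp
  finally show ?thesis by simp
qed

lemma shift_sum_node: "shift_sum F cc (node p) = c ^ snd p * shift_sum F cc (e (fst p))"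
proof -
  have "node p * e (- \<gamma>) = \<omega> ^ snd p * e (fst p - \<gamma>)" "e (fst p) * e (- \<gamma>) = e (fst p - \<gamma>)" for \<gamma>
    by (simp_all add: node_def mult.assoc e_add)
  then show ?thesis
    unfolding shift_sum_def sum_distrib_left
    by (intro sum.cong) (simp_all add: rotation_iterate[OF Q_e_nonzero])
qed

lemma prod_over_nodes:
  assumes "finite V"
  shows "(\<Prod>p\<in>V \<times> {..<k}. b * exp (\<alpha> * g (fst p)))
    = b ^ (k * card V) * exp (\<alpha> * (real k * (\<Sum>x\<in>V. g x)))"
proof -
  have "(\<Sum>p\<in>V \<times> {..<k}. \<alpha> * g (fst p)) = (\<Sum>x\<in>V. \<Sum>j<k. \<alpha> * g x)"
    unfolding sum.cartesian_product by (simp only: case_prod_beta')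
  also have "\<dots> = \<alpha> * (real k * (\<Sum>x\<in>V. g x))"
    by (simp add: sum_distrib_left mult_ac)
  finally show ?thesis
    using assms by (simp add: prod.distrib exp_sum[symmetric] card_cartesian_product mult.commute)
qed

text \<open>The shifts \<open>F\<close> and samples \<open>V\<close> seen from the centre of a window of radius \<open>n\<close>.  Shifts up to distance \<open>n + 2 + L\<close>
  count as poles: the annulus reaches to \<open>n + 1\<close>, its open neighbourhood to \<open>n + 2\<close>, and a pole lies within \<open>L\<close> of its
  shift.\<close>

definition window_data :: "real \<Rightarrow> real \<Rightarrow> nat \<Rightarrow> nat \<Rightarrow> real \<Rightarrow> real set \<Rightarrow> real set \<Rightarrow> bool" where
  "window_data n s0 NG NL E F V \<longleftrightarrow>
    finite F \<and> finite V \<and> (\<forall>x\<in>V. \<bar>x\<bar> \<le> n) \<and>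
    (\<forall>x\<in>V. \<forall>y\<in>V. x \<noteq> y \<longrightarrow> s0 \<le> \<bar>x - y\<bar>) \<and>
    card {\<gamma>\<in>F. \<bar>\<gamma>\<bar> \<le> n + 2 + L} \<le> NG \<and> k * card V \<le> NL \<and>
    real q * (\<Sum>\<gamma>\<in>{\<gamma>\<in>F. \<bar>\<gamma>\<bar> \<le> n + 2 + L}. n + 2 + L - \<bar>\<gamma>\<bar>) - real k * (\<Sum>x\<in>V. n - \<bar>x\<bar>) \<le> - 2 * E"

definition window_loss :: "real \<Rightarrow> nat \<Rightarrow> nat \<Rightarrow> real \<Rightarrow> real" where
  "window_loss n NG NL E = (C * exp (\<alpha> * (L + 1)) ^ q / \<kappa>) ^ NG * (2 / (1 - exp (- \<alpha>))) ^ NL * exp (\<alpha> * (n + 1 - E))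
        * (C * exp (\<alpha> * (n + 2 + L)))"

text \<open>The central estimate.  The factor \<open>exp (\<alpha> * (n + 1 - E))\<close> carries the gain; \<open>2 * E\<close> is a lower bound for the
  number of zeros minus the number of poles, integrated over the radii of the windows.  The constant \<open>K\<close> may be
  huge, but it depends only on the window and not on the shifts, samples and coefficients.\<close>

lemma local_estimate_at_origin:
  assumes n: "0 \<le> n" and s0: "0 < s0"
  shows "\<exists>K\<ge>0. \<forall>F V cc.
    window_data n s0 NG NL E F V \<longrightarrow>
    norm (shift_sum F cc (e 0)) \<le>
      window_loss n NG NL E * (\<Sum>\<gamma>\<in>F. norm (cc \<gamma>) * exp (- \<alpha> * \<bar>\<gamma>\<bar>))
      + K * (\<Sum>x\<in>V. norm (shift_sum F cc (e x)))"
proof -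
  define T S r d C1 where "T = n + 1" and "S = n + 2 + L" and "r = exp (\<alpha> * T)" and "d = 1 - exp (- \<alpha>)"
    and "C1 = C * exp (\<alpha> * (L + 1)) ^ q"
  have T: "T > 0" and d: "0 < d" "d \<le> 1" using n \<alpha> by (auto simp: T_def d_def)
  have r: "1 < r" using T \<alpha> by (simp add: r_def)
  have "1 \<le> exp (\<alpha> * (L + 1))" using \<alpha> L by simp
  then have pw1: "1 \<le> exp (\<alpha> * (L + 1)) ^ q" by (rule one_le_power)
  then have C1: "C \<le> C1" using C unfolding C1_def by (simp add: mult_le_cancel_left1)
  then have C1_1: "1 \<le> C1" using C by linarith
  obtain \<sigma> where \<sigma>: "0 < \<sigma>" "\<sigma> \<le> 1" and sep\<sigma>:
    "\<And>V p p'. (\<And>x. x \<in> V \<Longrightarrow> \<bar>x\<bar> \<le> n) \<Longrightarrow>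
       (\<And>x y. x \<in> V \<Longrightarrow> y \<in> V \<Longrightarrow> x \<noteq> y \<Longrightarrow> s0 \<le> \<bar>x - y\<bar>) \<Longrightarrow>
       p \<in> V \<times> {..<k} \<Longrightarrow> p' \<in> V \<times> {..<k} \<Longrightarrow> p \<noteq> p' \<Longrightarrow> \<sigma> \<le> norm (node p - node p')"
    using nodes_separated[OF s0 n] by blast
  define cb where "cb = (1 + norm c) ^ k * (C * exp (\<alpha> * (n + S)) ^ q) ^ NG"
  define K1 where "K1 = (2 * r / \<sigma>) ^ NL * (real k * cb)"
  define \<delta> where "\<delta> = (C1 / \<kappa>) ^ NG * (2 / d) ^ NL * exp (\<alpha> * (T - E))"
  define K where "K = (\<delta> + 1 / \<kappa> ^ NG) * K1"
  have cb0: "0 \<le> cb" using C by (simp add: cb_def)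
  have K10: "0 \<le> K1" using r \<sigma> cb0 by (simp add: K1_def)
  have \<delta>0: "0 \<le> \<delta>" using C1_1 \<kappa> d by (simp add: \<delta>_def)
  have K0: "0 \<le> K" using K10 \<delta>0 \<kappa> by (simp add: K_def)
  show ?thesis
  proof (intro exI[of _ K] conjI allI impI K0)
    fix F V :: "real set" and cc :: "real \<Rightarrow> complex"
    define W where "W = {\<gamma>\<in>F. \<bar>\<gamma>\<bar> \<le> S}"
    define M where "M = C * exp (\<alpha> * S) * (\<Sum>\<gamma>\<in>F. norm (cc \<gamma>) * exp (- \<alpha> * \<bar>\<gamma>\<bar>))"
    assume "window_data n s0 NG NL E F V"
    then have F: "finite F" and V: "finite V" "\<And>x. x \<in> V \<Longrightarrow> \<bar>x\<bar> \<le> n"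
      and sep0: "\<And>x y. x \<in> V \<Longrightarrow> y \<in> V \<Longrightarrow> x \<noteq> y \<Longrightarrow> s0 \<le> \<bar>x - y\<bar>"
      and cards: "card W \<le> NG" "k * card V \<le> NL"
      and energy: "real q * (\<Sum>\<gamma>\<in>W. S - \<bar>\<gamma>\<bar>) - real k * (\<Sum>x\<in>V. n - \<bar>x\<bar>) \<le> - 2 * E"
      unfolding window_data_def W_def S_def by blast+
    have finW: "finite W" and W: "\<And>\<gamma>. \<gamma> \<in> W \<Longrightarrow> \<bar>\<gamma>\<bar> \<le> S" using F by (auto simp: W_def)
    define I where "I = V \<times> {..<k}"
    define Z where "Z = node ` I"
    define \<Phi> where "\<Phi> = cleared_sum W F cc"
    define h where "h = (2 * r / \<sigma>) ^ NL * (\<Sum>a\<in>Z. norm (\<Phi> a))"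
    define \<epsilon> where "\<epsilon> = (\<Sum>x\<in>V. norm (shift_sum F cc (e x)))"
    have M0: "0 \<le> M" using C unfolding M_def by (intro mult_nonneg_nonneg sum_nonneg) auto
    have h0: "0 \<le> h" using r \<sigma> unfolding h_def by (intro mult_nonneg_nonneg sum_nonneg) auto
    have sepI: "\<sigma> \<le> norm (node p - node p')" if "p \<in> I" "p' \<in> I" "p \<noteq> p'" for p p'
      using sep\<sigma>[OF V(2) sep0 that[unfolded I_def]] .
    have inj: "inj_on node I"
    proof (rule inj_onI, rule ccontr)
      fix p p' assume "p \<in> I" "p' \<in> I" "node p = node p'" "p \<noteq> p'"
      then show False using sepI[of p p'] \<sigma>(1) by simp
    qed
    have finI: "finite I" "card I = k * card V" using V by (auto simp: I_def card_cartesian_product)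
    have cardZ: "card Z \<le> NL" unfolding Z_def card_image[OF inj] using finI cards by simp
    have prodZ: "(\<Prod>a\<in>Z. f a) = (\<Prod>p\<in>I. f (node p))" for f :: "complex \<Rightarrow> real"
      unfolding Z_def prod.reindex[OF inj] by simp
    have bI: "\<bar>fst p\<bar> \<le> n" if "p \<in> I" for p using that V(2) by (auto simp: I_def)
    \<comment> \<open>the error term is controlled by the samples\<close>
    have \<Phi>_node: "norm (\<Phi> (node p)) \<le> cb * norm (shift_sum F cc (e (fst p)))" if p: "p \<in> I" for p
    proof -
      have nz: "poly Q (node p * e (- \<gamma>)) \<noteq> 0" for \<gamma>
        using rotation_iterate(1)[OF Q_e_nonzero, of "snd p" "fst p - \<gamma>"]
        by (simp add: node_def mult.assoc e_add)
      have "norm (poly Q (node p * e (- \<gamma>))) \<le> C * exp (\<alpha> * (n + S)) ^ q" if "\<gamma> \<in> W" for \<gamma>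
      proof -
        have "0 \<le> n + S" using n L unfolding S_def by simp
        moreover have "fst p - \<gamma> \<le> n + S" using bI[OF p] W[OF that] by linarith
        ultimately have "\<alpha> * (fst p - \<gamma>) \<le> \<alpha> * (n + S)" "0 \<le> \<alpha> * (n + S)" using \<alpha> by simp_all
        moreover have "norm (node p * e (- \<gamma>)) = exp (\<alpha> * (fst p - \<gamma>))"
          unfolding norm_mult norm_node norm_e exp_add[symmetric] by (simp add: algebra_simps)
        ultimately have "max 1 (norm (node p * e (- \<gamma>))) \<le> exp (\<alpha> * (n + S))" by simp
        then have "C * max 1 (norm (node p * e (- \<gamma>))) ^ q \<le> C * exp (\<alpha> * (n + S)) ^ q"
          using C by (intro mult_left_mono power_mono) auto
        then show ?thesis using Q_le order_trans by blast
      qed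
      then have "(\<Prod>\<gamma>\<in>W. norm (poly Q (node p * e (- \<gamma>)))) \<le> (\<Prod>\<gamma>\<in>W. C * exp (\<alpha> * (n + S)) ^ q)"
        by (intro prod_mono) auto
      also have "\<dots> \<le> (C * exp (\<alpha> * (n + S)) ^ q) ^ NG"
      proof -
        have "1 \<le> exp (\<alpha> * (n + S)) ^ q" using \<alpha> n L unfolding S_def by (intro one_le_power) simp
        then have "1 * 1 \<le> C * exp (\<alpha> * (n + S)) ^ q" using C by (intro mult_mono) auto
        then show ?thesis using cards(1) by (simp add: power_increasing)
      qed
      finally have Qp: "norm (\<Prod>\<gamma>\<in>W. poly Q (node p * e (- \<gamma>))) \<le> (C * exp (\<alpha> * (n + S)) ^ q) ^ NG"
        by (simp only: prod_norm)
      have "norm c ^ snd p \<le> (1 + norm c) ^ snd p" by (intro power_mono) auto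
      also have "\<dots> \<le> (1 + norm c) ^ k" using p by (intro power_increasing) (auto simp: I_def)
      finally have cp: "norm c ^ snd p \<le> (1 + norm c) ^ k" .
      have "norm (\<Phi> (node p)) = norm c ^ snd p * norm (shift_sum F cc (e (fst p))) * norm (\<Prod>\<gamma>\<in>W. poly Q (node p * e (- \<gamma>)))"
        unfolding \<Phi>_def cleared_sum_eq[OF finW nz] shift_sum_node by (simp add: norm_mult norm_power)
      also have "\<dots> \<le> (1 + norm c) ^ k * norm (shift_sum F cc (e (fst p))) * (C * exp (\<alpha> * (n + S)) ^ q) ^ NG"
        using cp Qp by (intro mult_mono) auto
      also have "\<dots> = cb * norm (shift_sum F cc (e (fst p)))" unfolding cb_def by (simp only: mult_ac)
      finally show ?thesis .
    qed
    have h_le: "h \<le> K1 * \<epsilon>"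
    proof -
      have "(\<Sum>a\<in>Z. norm (\<Phi> a)) = (\<Sum>p\<in>I. norm (\<Phi> (node p)))"
        unfolding Z_def sum.reindex[OF inj] by simp
      also have "\<dots> \<le> (\<Sum>p\<in>I. cb * norm (shift_sum F cc (e (fst p))))" by (intro sum_mono \<Phi>_node)
      also have "\<dots> = (\<Sum>x\<in>V. \<Sum>j<k. cb * norm (shift_sum F cc (e x)))"
        unfolding I_def sum.cartesian_product by (simp only: case_prod_unfold)
      also have "\<dots> = real k * cb * \<epsilon>" unfolding \<epsilon>_def sum_distrib_left by (simp add: mult_ac)
      finally show ?thesis unfolding h_def K1_def using r \<sigma> by (simp add: mult.assoc mult_left_mono)
    qed
    \<comment> \<open>up to \<open>ln (M + h)\<close> and a constant per point, \<open>ln \<bar>\<Phi>\<bar>\<close> is at most \<open>\<alpha> a\<close> on the outer circle and \<open>0\<close> on the inner one, and \<open>ln \<bar>D\<bar>\<close> is at least \<open>\<alpha> b\<close> and \<open>0\<close>; the exponent \<open>s\<close> balances the two circles up to rounding\<close>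
    define a where "a = real q * (\<Sum>\<gamma>\<in>W. S - \<gamma>)"
    define b where "b = real k * (\<Sum>x\<in>V. n - x)"
    define s where "s = \<lfloor>(a - b) / (2 * T)\<rfloor>"
    have s_le: "T * of_int s \<le> (a - b) / 2" and s_ge: "(a - b) / 2 - T \<le> T * of_int s"
    proof -
      have *: "(a - b) / 2 = T * ((a - b) / (2 * T))" using T by simp
      show "T * of_int s \<le> (a - b) / 2" unfolding * s_def using T by (intro mult_left_mono) auto
      have "(a - b) / (2 * T) - 1 \<le> of_int s" unfolding s_def by linarith
      then have "T * ((a - b) / (2 * T) - 1) \<le> T * of_int s" using T by (intro mult_left_mono) auto
      then show "(a - b) / 2 - T \<le> T * of_int s" unfolding * by (simp only: right_diff_distrib mult_1_right)
    qed
    have rs: "r powi s = exp (\<alpha> * (T * of_int s))"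
      unfolding r_def exp_power_int by (simp only: mult_ac)
    define B where "B = (M + h) * C1 ^ NG / d ^ NL * exp (\<alpha> * ((a - b) / 2 + T))"
    define D where "D w = (\<Prod>a\<in>Z. norm (1 - w / a))" for w
    have B0: "0 \<le> B" using M0 h0 C1_1 d by (simp add: B_def)
    have C1pow: "1 \<le> C1 ^ NG" using C1_1 by (rule one_le_power)
    have dpow: "d ^ NL \<le> d ^ card I" using d cards finI by (intro power_decreasing) auto
    have D_inner: "d ^ NL \<le> D w" if w: "norm w = exp (\<alpha> * (- T))" for w
    proof -
      have "d \<le> norm (1 - w / node p)" if p: "p \<in> I" for p
      proof -
        have "norm (w / node p) = exp (\<alpha> * (- T - fst p))"
          unfolding norm_divide w norm_node exp_diff[symmetric] by (simp add: algebra_simps)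
        also have "\<dots> \<le> exp (- \<alpha>)"
        proof -
          have "- T - fst p \<le> - 1" using bI[OF p] by (simp add: T_def)
          then have "\<alpha> * (- T - fst p) \<le> \<alpha> * - 1" using \<alpha> by (intro mult_left_mono) auto
          then show ?thesis by simp
        qed
        finally show ?thesis using norm_triangle_ineq2[of 1 "w / node p"] unfolding d_def by simp
      qed
      then have "(\<Prod>p\<in>I. d) \<le> D w" unfolding D_def prodZ using d by (intro prod_mono) auto
      then show ?thesis using dpow by simp
    qed
    have D_outer: "d ^ NL * exp (\<alpha> * b) \<le> D w" if w: "norm w = exp (\<alpha> * T)" for w
    proof -
      have "d * exp (\<alpha> * (n - fst p)) \<le> norm (1 - w / node p)" if p: "p \<in> I" for p
      proof -
        have "norm (w / node p) = exp (\<alpha> * (T - fst p))"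
          unfolding norm_divide w norm_node exp_diff[symmetric] by (simp add: algebra_simps)
        moreover have "norm (w / node p) - 1 \<le> norm (1 - w / node p)"
          using norm_triangle_ineq2[of "w / node p" 1] by (simp add: norm_minus_commute)
        moreover have "d * exp (\<alpha> * (n - fst p)) \<le> exp (\<alpha> * (T - fst p)) - 1"
        proof -
          have "d * exp (\<alpha> * (n - fst p)) \<le> d * exp (\<alpha> * (T - fst p))"
            using d \<alpha> by (simp add: T_def)
          also have "\<dots> = exp (\<alpha> * (T - fst p)) - exp (\<alpha> * (n - fst p))"
            unfolding d_def left_diff_distrib exp_add[symmetric] T_def by (simp add: algebra_simps)
          finally have "d * exp (\<alpha> * (n - fst p)) \<le> exp (\<alpha> * (T - fst p)) - exp (\<alpha> * (n - fst p))" .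
          moreover have "0 \<le> n - fst p" using bI[OF p] by linarith
          then have "1 \<le> exp (\<alpha> * (n - fst p))" using \<alpha> by simp
          ultimately show ?thesis by linarith
        qed
        ultimately show ?thesis by linarith
      qed
      then have "(\<Prod>p\<in>I. d * exp (\<alpha> * (n - fst p))) \<le> D w"
        unfolding D_def prodZ using d by (intro prod_mono) auto
      moreover have "(\<Prod>p\<in>I. d * exp (\<alpha> * (n - fst p))) = d ^ card I * exp (\<alpha> * b)"
        unfolding I_def b_def finI[unfolded I_def] using prod_over_nodes[OF V(1), of d "\<lambda>x. n - x"] .
      moreover have "d ^ NL * exp (\<alpha> * b) \<le> d ^ card I * exp (\<alpha> * b)"
        using dpow by (intro mult_right_mono) auto
      ultimately show ?thesis by linarith
    qed
    have D_one: "D 1 \<le> 2 ^ NL * exp (\<alpha> * (real k * (\<Sum>x\<in>V. max 0 (- x))))"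
    proof -
      have "norm (1 - 1 / node p) \<le> 2 * exp (\<alpha> * max 0 (- fst p))" for p
      proof -
        have "norm (1 - 1 / node p) \<le> 1 + exp (\<alpha> * (- fst p))"
          using norm_triangle_ineq4[of 1 "1 / node p"] by (simp add: norm_divide exp_minus inverse_eq_divide)
        also have "\<dots> \<le> exp (\<alpha> * max 0 (- fst p)) + exp (\<alpha> * max 0 (- fst p))"
          using \<alpha> mult_left_mono[of "- fst p" "max 0 (- fst p)" \<alpha>] by (intro add_mono) auto
        finally show ?thesis by simp
      qed
      then have "D 1 \<le> (\<Prod>p\<in>I. 2 * exp (\<alpha> * max 0 (- fst p)))"
        unfolding D_def prodZ by (intro prod_mono) auto
      also have "\<dots> = 2 ^ (k * card V) * exp (\<alpha> * (real k * (\<Sum>x\<in>V. max 0 (- x))))"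
        unfolding I_def using prod_over_nodes[OF V(1), of 2 "\<lambda>x. max 0 (- x)"] .
      also have "\<dots> \<le> 2 ^ NL * exp (\<alpha> * (real k * (\<Sum>x\<in>V. max 0 (- x))))"
        using cards(2) by (intro mult_right_mono power_increasing) auto
      finally show ?thesis .
    qed
    have LS: "T + 1 + L = S" by (simp add: S_def T_def)
    have max1: "max 1 (exp x) \<le> exp y" if "0 \<le> y" "x \<le> y" for x y :: real using that by simp
    have \<Phi>_inner: "norm (\<Phi> w) \<le> M * C1 ^ NG" if w: "norm w = exp (\<alpha> * (- T))" for w
    proof -
      have "norm (\<Phi> w) \<le> M * (\<Prod>\<gamma>\<in>W. C * max 1 (exp (\<alpha> * (- T - \<gamma>))) ^ q)"
        unfolding \<Phi>_def M_def using norm_cleared_sum_le[OF F W_def w, of cc] LS T by simp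
      also have "\<dots> \<le> M * (\<Prod>\<gamma>\<in>W. C1)"
      proof (intro mult_left_mono prod_mono conjI M0)
        fix \<gamma> assume "\<gamma> \<in> W"
        then have "- T - \<gamma> \<le> L + 1" using W[of \<gamma>] LS by linarith
        then have "\<alpha> * (- T - \<gamma>) \<le> \<alpha> * (L + 1)" "0 \<le> \<alpha> * (L + 1)" using \<alpha> L by simp_all
        then have "max 1 (exp (\<alpha> * (- T - \<gamma>))) \<le> exp (\<alpha> * (L + 1))" using max1 by blast
        then show "C * max 1 (exp (\<alpha> * (- T - \<gamma>))) ^ q \<le> C1"
          unfolding C1_def using C by (intro mult_left_mono power_mono) auto
      qed (use C in auto)
      also have "\<dots> \<le> M * C1 ^ NG" using C1_1 cards(1) M0 by (simp add: mult_left_mono power_increasing)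
      finally show ?thesis .
    qed
    have a0: "0 \<le> a" unfolding a_def using W by (intro mult_nonneg_nonneg sum_nonneg) force+
    have \<Phi>_outer: "norm (\<Phi> w) \<le> M * (C1 ^ NG * exp (\<alpha> * a))" if w: "norm w = exp (\<alpha> * T)" for w
    proof -
      have "norm (\<Phi> w) \<le> M * (\<Prod>\<gamma>\<in>W. C * max 1 (exp (\<alpha> * (T - \<gamma>))) ^ q)"
        unfolding \<Phi>_def M_def using norm_cleared_sum_le[OF F W_def w, of cc] LS T by simp
      also have "\<dots> \<le> M * (\<Prod>\<gamma>\<in>W. C1 * exp (\<alpha> * (S - \<gamma>)) ^ q)"
      proof (intro mult_left_mono prod_mono conjI M0)
        fix \<gamma> assume "\<gamma> \<in> W"
        then have "0 \<le> S - \<gamma>" "T - \<gamma> \<le> S - \<gamma>" using W[of \<gamma>] LS L by auto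
        then have "\<alpha> * (T - \<gamma>) \<le> \<alpha> * (S - \<gamma>)" "0 \<le> \<alpha> * (S - \<gamma>)" using \<alpha> by simp_all
        then have "max 1 (exp (\<alpha> * (T - \<gamma>))) \<le> exp (\<alpha> * (S - \<gamma>))" using max1 by blast
        then show "C * max 1 (exp (\<alpha> * (T - \<gamma>))) ^ q \<le> C1 * exp (\<alpha> * (S - \<gamma>)) ^ q"
          using C C1 C1_1 by (intro mult_mono power_mono) auto
      qed (use C in auto)
      also have "(\<Prod>\<gamma>\<in>W. C1 * exp (\<alpha> * (S - \<gamma>)) ^ q) = C1 ^ card W * exp (\<alpha> * a)"
        unfolding prod.distrib prod_power_distrib[symmetric] exp_sum[OF finW, symmetric]
          exp_of_nat_mult[symmetric] a_def sum_distrib_left[symmetric] prod_constant by (simp only: mult_ac)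
      also have "M * (C1 ^ card W * exp (\<alpha> * a)) \<le> M * (C1 ^ NG * exp (\<alpha> * a))"
        using C1_1 cards(1) M0 by (intro mult_left_mono mult_right_mono power_increasing) auto
      finally show ?thesis .
    qed
    let ?U = "{w::complex. exp (- (\<alpha> * (T + 1))) < norm w \<and> norm w < exp (\<alpha> * (T + 1))}"
    have est: "norm (\<Phi> 1) \<le> h + B * D 1"
      unfolding D_def
    proof (rule interpolation_error_at_one[OF r, where U = ?U])
      show "open ?U"
        by (intro open_Collect_conj open_Collect_less continuous_intros)
      show "\<Phi> holomorphic_on ?U"
        unfolding \<Phi>_def
      proof (rule cleared_sum_holomorphic)
        fix w \<gamma> assume w: "w \<in> ?U" and \<gamma>: "\<gamma> \<in> F - W"
        then have out: "S < \<bar>\<gamma>\<bar>" by (auto simp: W_def)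
        have nv: "norm (w * e (- \<gamma>)) = norm w * exp (\<alpha> * (- \<gamma>))" by (simp add: norm_mult)
        show "poly Q (w * e (- \<gamma>)) \<noteq> 0"
        proof (cases "0 \<le> \<gamma>")
          case True
          have "norm (w * e (- \<gamma>)) \<le> exp (\<alpha> * (T + 1)) * exp (\<alpha> * (- \<gamma>))"
            unfolding nv using w by (intro mult_right_mono) auto
          also have "\<dots> = exp (\<alpha> * (T + 1 - \<gamma>))" unfolding exp_add[symmetric] by (simp add: algebra_simps)
          also have "\<dots> \<le> exp (\<alpha> * (- L))"
          proof -
            have "T + 1 - \<gamma> \<le> - L" using out LS True by linarith
            then show ?thesis using \<alpha> by (simp only: exp_le_cancel_iff mult_le_cancel_left_pos)
          qed
          finally show ?thesis using near by simp
        next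
          case False
          have "exp (\<alpha> * L) \<le> exp (\<alpha> * (- (T + 1) - \<gamma>))" using out LS False \<alpha> by simp
          also have "\<dots> = exp (- (\<alpha> * (T + 1))) * exp (\<alpha> * (- \<gamma>))" unfolding exp_add[symmetric] by (simp add: algebra_simps)
          also have "\<dots> \<le> norm (w * e (- \<gamma>))" unfolding nv using w by (intro mult_right_mono) auto
          finally show ?thesis using far by simp
        qed
      qed
      have invr: "1 / r = exp (\<alpha> * (- T))" unfolding r_def by (simp add: exp_minus inverse_eq_divide)
      show "{w. 1 / r \<le> norm w \<and> norm w \<le> r} \<subseteq> ?U"
      proof -
        have "exp (- (\<alpha> * (T + 1))) < 1 / r" "r < exp (\<alpha> * (T + 1))"
          unfolding invr unfolding r_def using \<alpha> by (simp_all add: algebra_simps)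
        then show ?thesis by auto
      qed
      show "finite Z" unfolding Z_def using finI by simp
      show "card Z \<le> NL" by (rule cardZ)
      fix x assume "x \<in> Z"
      then obtain p where p: "p \<in> I" "x = node p" by (auto simp: Z_def)
      have "- T \<le> fst p" "fst p \<le> T" using bI[OF p(1)] by (auto simp: T_def)
      then have "\<alpha> * (- T) \<le> \<alpha> * fst p" "\<alpha> * fst p \<le> \<alpha> * T" using \<alpha> by (simp_all only: mult_le_cancel_left_pos)
      then show "1 / r \<le> norm x" "norm x \<le> r" unfolding invr p norm_node unfolding r_def by auto
    next
      fix x y assume "x \<in> Z" "y \<in> Z" "x \<noteq> y"
      then show "\<sigma> \<le> norm (x - y)" using sepI by (auto simp: Z_def)
    next
      show "0 < \<sigma>" "\<sigma> \<le> 1" by fact+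
      show "h = (2 * r / \<sigma>) ^ NL * (\<Sum>a\<in>Z. norm (\<Phi> a))" by (rule h_def)
    next
      have invr: "1 / r = exp (\<alpha> * (- T))" unfolding r_def by (simp add: exp_minus inverse_eq_divide)
      fix w :: complex assume "norm w = 1 / r"
      then have w: "norm w = exp (\<alpha> * (- T))" by (simp only: invr)
      have "norm (\<Phi> w) + h \<le> M * C1 ^ NG + h * C1 ^ NG"
        using \<Phi>_inner[OF w] mult_left_mono[OF C1pow h0] by simp
      also have "\<dots> = (M + h) * C1 ^ NG" by (simp only: distrib_right)
      finally have *: "norm (\<Phi> w) + h \<le> (M + h) * C1 ^ NG" .
      have "T * of_int s \<le> (a - b) / 2 + T" using s_le T by linarith
      then have "r powi s \<le> exp (\<alpha> * ((a - b) / 2 + T))"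
        unfolding rs using \<alpha> by (simp only: exp_le_cancel_iff mult_le_cancel_left_pos)
      with * have "(norm (\<Phi> w) + h) * r powi s \<le> (M + h) * C1 ^ NG * exp (\<alpha> * ((a - b) / 2 + T))"
        using r M0 h0 C1pow by (intro mult_mono) auto
      also have "\<dots> = B * d ^ NL" using d by (simp add: B_def)
      also have "\<dots> \<le> B * D w" using D_inner[OF w] B0 by (intro mult_left_mono)
      finally show "(norm (\<Phi> w) + h) * r powi s \<le> B * (\<Prod>a\<in>Z. norm (1 - w / a))" unfolding D_def .
    next
      fix w :: complex assume "norm w = r"
      then have w: "norm w = exp (\<alpha> * T)" by (simp only: r_def)
      have "1 \<le> exp (\<alpha> * a)" using a0 \<alpha> by simp
      then have "1 * 1 \<le> C1 ^ NG * exp (\<alpha> * a)" using C1pow by (intro mult_mono) auto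
      then have "h * 1 \<le> h * (C1 ^ NG * exp (\<alpha> * a))" using h0 by (intro mult_left_mono) auto
      then have "norm (\<Phi> w) + h \<le> (M + h) * (C1 ^ NG * exp (\<alpha> * a))"
        using \<Phi>_outer[OF w] unfolding distrib_right by linarith
      also have "\<dots> \<le> (M + h) * (C1 ^ NG * exp (\<alpha> * ((a - b) / 2 + T) + \<alpha> * (T * of_int s) + \<alpha> * b))" 
      proof -
        have "a \<le> (a - b) / 2 + T + T * of_int s + b" using s_ge by argo
        then have "\<alpha> * a \<le> \<alpha> * ((a - b) / 2 + T + T * of_int s + b)" using \<alpha> by simp
        then have "exp (\<alpha> * a) \<le> exp (\<alpha> * ((a - b) / 2 + T) + \<alpha> * (T * of_int s) + \<alpha> * b)"
          by (simp add: distrib_left)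
        then show ?thesis using M0 h0 C1pow by (intro mult_left_mono) auto
      qed
      also have "\<dots> = B * r powi s * (d ^ NL * exp (\<alpha> * b))"
        unfolding B_def rs exp_add using d by simp
      also have "\<dots> \<le> B * r powi s * D w" using D_outer[OF w] B0 r by (intro mult_left_mono) auto
      finally show "norm (\<Phi> w) + h \<le> B * r powi s * (\<Prod>a\<in>Z. norm (1 - w / a))" unfolding D_def .
    next
      have invr: "1 / r = exp (\<alpha> * (- T))" unfolding r_def by (simp add: exp_minus inverse_eq_divide)
      fix w :: complex assume "norm w = 1 / r \<or> norm w = r"
      then have "norm w = exp (\<alpha> * (- T)) \<or> norm w = exp (\<alpha> * T)" using invr r_def by metis
      moreover have "0 < d ^ NL" "0 < d ^ NL * exp (\<alpha> * b)" using d by simp_all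
      ultimately have "0 < D w" using D_inner[of w] D_outer[of w] by linarith
      then show "0 < (\<Prod>a\<in>Z. norm (1 - w / a))" unfolding D_def .
    qed
    define u where "u = real q * (\<Sum>\<gamma>\<in>W. max 0 (- \<gamma>))"
    define v where "v = real k * (\<Sum>x\<in>V. max 0 (- x))"
    have lower: "\<kappa> ^ NG * exp (\<alpha> * u) * norm (shift_sum F cc (e 0)) \<le> norm (\<Phi> 1)"
    proof -
      have e0: "1 = e 0" "1 * e (- \<gamma>) = e (- \<gamma>)" for \<gamma> by (simp_all add: e_def)
      have "norm (\<Phi> 1) = norm (shift_sum F cc (e 0)) * (\<Prod>\<gamma>\<in>W. norm (poly Q (e (- \<gamma>))))"
        unfolding \<Phi>_def using Q_e_nonzero
        by (subst cleared_sum_eq[OF finW]) (simp_all add: norm_mult prod_norm e0(1)[symmetric])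
      moreover have "\<kappa> ^ NG * exp (\<alpha> * u) \<le> (\<Prod>\<gamma>\<in>W. norm (poly Q (e (- \<gamma>))))"
      proof -
        have "\<kappa> * exp (\<alpha> * max 0 (- \<gamma>)) ^ q \<le> norm (poly Q (e (- \<gamma>)))" for \<gamma>
        proof -
          have "exp (\<alpha> * max 0 (- \<gamma>)) = max 1 (exp (\<alpha> * (- \<gamma>)))"
            using \<alpha> by (cases "\<gamma> \<le> 0") (auto simp: max_def mult_le_0_iff)
          then show ?thesis using Q_ray[of "exp (\<alpha> * (- \<gamma>))"] unfolding e_def by simp
        qed
        then have "(\<Prod>\<gamma>\<in>W. \<kappa> * exp (\<alpha> * max 0 (- \<gamma>)) ^ q) \<le> (\<Prod>\<gamma>\<in>W. norm (poly Q (e (- \<gamma>))))"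
          using \<kappa> by (intro prod_mono) auto
        moreover have "(\<Prod>\<gamma>\<in>W. \<kappa> * exp (\<alpha> * max 0 (- \<gamma>)) ^ q) = \<kappa> ^ card W * exp (\<alpha> * u)"
          unfolding prod.distrib prod_power_distrib[symmetric] exp_sum[OF finW, symmetric]
            exp_of_nat_mult[symmetric] u_def sum_distrib_left[symmetric] prod_constant by (simp only: mult_ac)
        moreover have "\<kappa> ^ NG * exp (\<alpha> * u) \<le> \<kappa> ^ card W * exp (\<alpha> * u)"
          using \<kappa> cards(1) by (intro mult_right_mono power_decreasing) auto
        ultimately show ?thesis by linarith
      qed
      ultimately show ?thesis
        by (simp only: mult.commute[of "norm (shift_sum F cc (e 0))"] mult_right_mono norm_ge_zero)
    qed
    \<comment> \<open>the one-sided sums of the boundary and of the centre combine to the symmetric sums in the assumption\<close>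
    have key: "(a - b) / 2 + T + v - u \<le> T - E"
    proof -
      have "a - 2 * u = real q * (\<Sum>\<gamma>\<in>W. S - \<bar>\<gamma>\<bar>)"
      proof -
        have "(\<Sum>\<gamma>\<in>W. S - \<bar>\<gamma>\<bar>) = (\<Sum>\<gamma>\<in>W. (S - \<gamma>) - 2 * max 0 (- \<gamma>))"
          by (intro sum.cong) (auto simp: max_def)
        then show ?thesis unfolding a_def u_def
          by (simp only: sum_subtractf sum_distrib_left[symmetric] right_diff_distrib mult.left_commute)
      qed
      moreover have "b - 2 * v = real k * (\<Sum>x\<in>V. n - \<bar>x\<bar>)"
      proof -
        have "(\<Sum>x\<in>V. n - \<bar>x\<bar>) = (\<Sum>x\<in>V. (n - x) - 2 * max 0 (- x))"
          by (intro sum.cong) (auto simp: max_def)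
        then show ?thesis unfolding b_def v_def
          by (simp only: sum_subtractf sum_distrib_left[symmetric] right_diff_distrib mult.left_commute)
      qed
      ultimately show ?thesis using energy by argo
    qed
    have "u \<ge> 0" unfolding u_def by (intro mult_nonneg_nonneg sum_nonneg) auto
    then have eu: "1 \<le> exp (\<alpha> * u)" using \<alpha> by simp
    have \<kappa>N: "0 < \<kappa> ^ NG" using \<kappa> by simp
    have "\<kappa> ^ NG * exp (\<alpha> * u) * norm (shift_sum F cc (e 0)) \<le> h + B * (2 ^ NL * exp (\<alpha> * v))"
      using lower est mult_left_mono[OF D_one B0] unfolding v_def by linarith
    then have "norm (shift_sum F cc (e 0)) \<le> (h + B * (2 ^ NL * exp (\<alpha> * v))) / (\<kappa> ^ NG * exp (\<alpha> * u))"
      using \<kappa>N by (simp add: pos_le_divide_eq mult.commute)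
    also have "\<dots> = h / \<kappa> ^ NG / exp (\<alpha> * u) + B * (2 ^ NL * exp (\<alpha> * v)) / (\<kappa> ^ NG * exp (\<alpha> * u))"
      by (simp add: add_divide_distrib)
    also have "\<dots> \<le> h / \<kappa> ^ NG + \<delta> * (M + h)"
    proof (rule add_mono)
      have "0 \<le> h / \<kappa> ^ NG" using h0 \<kappa>N by simp
      then show "h / \<kappa> ^ NG / exp (\<alpha> * u) \<le> h / \<kappa> ^ NG"
        using divide_left_mono[OF eu, of "h / \<kappa> ^ NG"] by simp
      have "B * (2 ^ NL * exp (\<alpha> * v)) / (\<kappa> ^ NG * exp (\<alpha> * u))
        = (M + h) * ((C1 / \<kappa>) ^ NG * (2 / d) ^ NL) * (exp (\<alpha> * ((a - b) / 2 + T)) * exp (\<alpha> * v) / exp (\<alpha> * u))"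
        unfolding B_def power_divide by (simp add: mult_ac)
      also have "exp (\<alpha> * ((a - b) / 2 + T)) * exp (\<alpha> * v) / exp (\<alpha> * u) = exp (\<alpha> * ((a - b) / 2 + T + v - u))"
        unfolding exp_add[symmetric] exp_diff[symmetric] by (simp only: right_diff_distrib distrib_left)
      also have "(M + h) * ((C1 / \<kappa>) ^ NG * (2 / d) ^ NL) * exp (\<alpha> * ((a - b) / 2 + T + v - u))
        \<le> (M + h) * ((C1 / \<kappa>) ^ NG * (2 / d) ^ NL) * exp (\<alpha> * (T - E))"
        using key \<alpha> M0 h0 C1_1 \<kappa> d by (intro mult_left_mono) auto
      also have "\<dots> = \<delta> * (M + h)" unfolding \<delta>_def by (simp only: mult_ac)
      finally show "B * (2 ^ NL * exp (\<alpha> * v)) / (\<kappa> ^ NG * exp (\<alpha> * u)) \<le> \<delta> * (M + h)" .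
    qed
    also have "\<dots> = \<delta> * M + (\<delta> + 1 / \<kappa> ^ NG) * h" by (simp add: algebra_simps)
    also have "\<dots> \<le> \<delta> * M + (\<delta> + 1 / \<kappa> ^ NG) * (K1 * \<epsilon>)"
      using h_le \<delta>0 \<kappa>N by (intro add_left_mono mult_left_mono) auto
    also have "\<dots> = \<delta> * (C * exp (\<alpha> * S)) * (\<Sum>\<gamma>\<in>F. norm (cc \<gamma>) * exp (- \<alpha> * \<bar>\<gamma>\<bar>)) + K * \<epsilon>"
      unfolding M_def K_def by (simp only: mult.assoc)
    finally show "norm (shift_sum F cc (e 0)) \<le>
      window_loss n NG NL E * (\<Sum>\<gamma>\<in>F. norm (cc \<gamma>) * exp (- \<alpha> * \<bar>\<gamma>\<bar>))
      + K * (\<Sum>x\<in>V. norm (shift_sum F cc (e x)))"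
      unfolding \<delta>_def \<epsilon>_def T_def S_def d_def C1_def window_loss_def .
  qed
qed

end

section \<open>Local estimates uniform in the position of the window\<close>

abbreviation expker :: "real \<Rightarrow> real \<Rightarrow> real \<Rightarrow> real" where
  "expker \<alpha> x s \<equiv> exp (- \<alpha> * \<bar>x - s\<bar>)"

abbreviation kersum :: "real \<Rightarrow> real set \<Rightarrow> (real \<Rightarrow> complex) \<Rightarrow> real \<Rightarrow> real" where
  "kersum \<alpha> S v x \<equiv> infsum (\<lambda>s. norm (v s) * expker \<alpha> x s) S"

lemma sum_thresholds_le:
  fixes t :: real
  assumes "0 \<le> t" "t \<le> real n"
  shows "(\<Sum>j<n. if t \<le> real j then 1 else 0) \<le> real n - t"
proof -
  have eq: "{j. j < n \<and> t \<le> real j} = {nat \<lceil>t\<rceil>..<n}"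
    using assms by (auto simp: nat_le_iff ceiling_le_iff)
  have "(\<Sum>j<n. if t \<le> real j then 1 else 0) = real (card {j. j < n \<and> t \<le> real j})"
    by (simp add: sum.If_cases Int_def lessThan_def)
  also have "\<dots> = real (n - nat \<lceil>t\<rceil>)" unfolding eq by simp
  also have "\<dots> \<le> real n - t" using assms by linarith
  finally show ?thesis .
qed

lemma le_sum_thresholds:
  fixes t :: real
  assumes "0 \<le> t"
  shows "real n - t \<le> (\<Sum>j\<le>n. if t \<le> real j then 1 else 0)"
proof -
  have eq: "{j. j \<le> n \<and> t \<le> real j} = {nat \<lceil>t\<rceil>..n}"
    using assms by (auto simp: nat_le_iff ceiling_le_iff)
  have "real n - t \<le> real (Suc n - nat \<lceil>t\<rceil>)" using assms by linarith
  also have "\<dots> = real (card {j. j \<le> n \<and> t \<le> real j})" unfolding eq by simp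
  also have "\<dots> = (\<Sum>j\<le>n. if t \<le> real j then 1 else 0)"
    by (simp add: sum.If_cases Int_def atMost_def)
  finally show ?thesis .
qed

lemma window_count_eq_sum:
  assumes "finite (S \<inter> {x - R..x + R})" "r \<le> R"
  shows "window_count S r x = (\<Sum>y\<in>S \<inter> {x - R..x + R}. if \<bar>y - x\<bar> \<le> r then 1 else 0)"
proof -
  have "S \<inter> {x - r..x + r} = {y \<in> S \<inter> {x - R..x + R}. \<bar>y - x\<bar> \<le> r}"
    using assms(2) by auto
  then show ?thesis unfolding window_count_def using assms(1)
    by (simp add: sum.If_cases Int_def)
qed

text \<open>This and the next lemma replace the identity of \<open>\<Sum>(n - \<bar>y - x\<bar>)\<close> with the integral of the counting
  function over the radii below \<open>n\<close>.\<close>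

lemma sum_window_count_le:
  assumes fin: "finite (S \<inter> {x - real n..x + real n})"
  shows "(\<Sum>j<n. window_count S (real j) x) \<le> (\<Sum>y\<in>S \<inter> {x - real n..x + real n}. real n - \<bar>y - x\<bar>)"
proof -
  have "(\<Sum>j<n. window_count S (real j) x)
      = (\<Sum>j<n. \<Sum>y\<in>S \<inter> {x - real n..x + real n}. if \<bar>y - x\<bar> \<le> real j then 1 else 0)"
    by (intro sum.cong refl window_count_eq_sum fin) auto
  also have "\<dots> = (\<Sum>y\<in>S \<inter> {x - real n..x + real n}. \<Sum>j<n. if \<bar>y - x\<bar> \<le> real j then 1 else 0)"
    by (rule sum.swap)
  also have "\<dots> \<le> (\<Sum>y\<in>S \<inter> {x - real n..x + real n}. real n - \<bar>y - x\<bar>)"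
    by (intro sum_mono sum_thresholds_le) auto
  finally show ?thesis .
qed

lemma le_sum_window_count:
  assumes fin: "finite (S \<inter> {x - real n..x + real n})"
  shows "(\<Sum>y\<in>S \<inter> {x - real n..x + real n}. real n - \<bar>y - x\<bar>) \<le> (\<Sum>j\<le>n. window_count S (real j) x)"
proof -
  have "(\<Sum>y\<in>S \<inter> {x - real n..x + real n}. real n - \<bar>y - x\<bar>)
    \<le> (\<Sum>y\<in>S \<inter> {x - real n..x + real n}. \<Sum>j\<le>n. if \<bar>y - x\<bar> \<le> real j then 1 else 0)"
    by (intro sum_mono le_sum_thresholds) auto
  also have "\<dots> = (\<Sum>j\<le>n. \<Sum>y\<in>S \<inter> {x - real n..x + real n}. if \<bar>y - x\<bar> \<le> real j then 1 else 0)"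
    by (rule sum.swap)
  also have "\<dots> = (\<Sum>j\<le>n. window_count S (real j) x)"
    by (intro sum.cong refl window_count_eq_sum[symmetric] fin) auto
  finally show ?thesis .
qed

lemma triangle_sum_ge:
  assumes fin: "\<And>R. finite (S \<inter> {x - R..x + R})"
    and lower: "\<And>R. 0 \<le> R \<Longrightarrow> 2 * a * R - C \<le> window_count S R x"
  shows "a * real n * (real n - 1) - C * real n \<le> (\<Sum>y\<in>S \<inter> {x - real n..x + real n}. real n - \<bar>y - x\<bar>)"
proof -
  have "(\<Sum>j<n. 2 * a * real j - C) = a * real n * (real n - 1) - C * real n"
    by (induction n) (auto simp: algebra_simps)
  moreover have "(\<Sum>j<n. 2 * a * real j - C) \<le> (\<Sum>j<n. window_count S (real j) x)"
    by (intro sum_mono lower) auto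
  ultimately show ?thesis using sum_window_count_le[OF fin, of n] by linarith
qed

lemma triangle_sum_le:
  assumes fin: "\<And>R. finite (S \<inter> {x - R..x + R})"
    and upper: "\<And>R. 0 \<le> R \<Longrightarrow> window_count S R x \<le> 2 * b * R + C"
    and b: "0 \<le> b" "0 \<le> C" and R: "0 \<le> R"
  shows "(\<Sum>y\<in>S \<inter> {x - R..x + R}. R - \<bar>y - x\<bar>) \<le> b * (R + 1) * (R + 2) + C * (R + 2)"
proof -
  define n where "n = nat \<lceil>R\<rceil>"
  have n: "R \<le> real n" "real n \<le> R + 1" unfolding n_def using R by linarith+
  have "(\<Sum>y\<in>S \<inter> {x - R..x + R}. R - \<bar>y - x\<bar>) \<le> (\<Sum>y\<in>S \<inter> {x - R..x + R}. real n - \<bar>y - x\<bar>)"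
    using n by (intro sum_mono) auto
  also have "\<dots> \<le> (\<Sum>y\<in>S \<inter> {x - real n..x + real n}. real n - \<bar>y - x\<bar>)"
    using n by (intro sum_mono2 fin) auto
  also have "\<dots> \<le> (\<Sum>j\<le>n. window_count S (real j) x)" by (rule le_sum_window_count[OF fin])
  also have "\<dots> \<le> (\<Sum>j\<le>n. 2 * b * real j + C)" by (intro sum_mono upper) auto
  also have "\<dots> = b * real n * (real n + 1) + C * (real n + 1)"
    by (induction n) (auto simp: algebra_simps)
  also have "\<dots> \<le> b * (R + 1) * (R + 2) + C * (R + 2)"
    using n b R by (rule_tac add_mono; intro mult_mono) auto
  finally show ?thesis .
qed

lemma quadratic_dominates_linear:
  fixes \<theta> \<beta> \<tau> :: real
  assumes "\<theta> > 0"
  shows "\<exists>n::nat. - \<theta> * (real n * real n) + \<beta> * real n + \<tau> \<le> 0"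
proof -
  obtain m :: nat where m: "(\<bar>\<beta>\<bar> + \<bar>\<tau>\<bar>) / \<theta> \<le> real m" using real_arch_simple by blast
  define n where "n = Suc m"
  have n: "1 \<le> real n" "\<bar>\<beta>\<bar> + \<bar>\<tau>\<bar> \<le> \<theta> * real n"
    using m assms unfolding n_def by (auto simp: field_simps)
  have "\<beta> * real n + \<tau> \<le> \<bar>\<beta>\<bar> * real n + \<bar>\<tau>\<bar> * real n"
  proof (rule add_mono)
    show "\<beta> * real n \<le> \<bar>\<beta>\<bar> * real n" by (intro mult_right_mono) auto
    have "\<bar>\<tau>\<bar> * 1 \<le> \<bar>\<tau>\<bar> * real n" using n by (intro mult_left_mono) auto
    then show "\<tau> \<le> \<bar>\<tau>\<bar> * real n" by linarith
  qed
  also have "\<dots> = (\<bar>\<beta>\<bar> + \<bar>\<tau>\<bar>) * real n" by (simp only: distrib_right)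
  also have "\<dots> \<le> \<theta> * real n * real n" using n by (intro mult_right_mono) auto
  finally have "- \<theta> * (real n * real n) + \<beta> * real n + \<tau> \<le> 0" by (simp add: mult.assoc)
  then show ?thesis by blast
qed

context exponential_rational
begin

lemma shift_sum_translate:
  "shift_sum ((\<lambda>\<gamma>. \<gamma> - x) ` F) (\<lambda>\<gamma>. cc (\<gamma> + x)) (e y) = shift_sum F cc (e (x + y))"
  unfolding shift_sum_def
  by (subst sum.reindex) (auto simp: inj_on_def e_add algebra_simps)

text \<open>The density assumption makes the exponent in \<open>local_estimate_at_origin\<close> at most \<open>- \<theta> n^2\<close> plus a linear
  function of \<open>n\<close>, so that a large window makes the first constant as small as desired.\<close>

lemma uniform_local_estimate:
  assumes \<Lambda>: "separated_set \<Lambda>" and \<Gamma>: "separated_set \<Gamma>"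
    and dens: "real q / real k * upper_density \<Gamma> < lower_density \<Lambda>" and \<eta>: "0 < \<eta>"
  shows "\<exists>n K. 0 \<le> n \<and> 0 \<le> K \<and> (\<forall>F cc x. finite F \<and> F \<subseteq> \<Gamma> \<longrightarrow>
    norm (shift_sum F cc (e x)) \<le> \<eta> * (\<Sum>\<gamma>\<in>F. norm (cc \<gamma>) * expker \<alpha> x \<gamma>)
      + K * (\<Sum>y\<in>\<Lambda> \<inter> {x - n..x + n}. norm (shift_sum F cc (e y))))"
proof -
  obtain D1 where D1: "D1 > 0" "\<And>R x. R \<ge> 0 \<Longrightarrow> window_count \<Gamma> R x \<le> D1 * R + 1"
    and fin\<Gamma>: "\<And>R x. finite (\<Gamma> \<inter> {x - R..x + R})"
    using separated_window_count[OF \<Gamma>] by blast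
  obtain D2 where D2: "D2 > 0" "\<And>R x. R \<ge> 0 \<Longrightarrow> window_count \<Lambda> R x \<le> D2 * R + 1"
    and fin\<Lambda>: "\<And>R x. finite (\<Lambda> \<inter> {x - R..x + R})"
    using separated_window_count[OF \<Lambda>] by blast
  obtain s0 where s0: "0 < s0" "\<And>x y. x \<in> \<Lambda> \<Longrightarrow> y \<in> \<Lambda> \<Longrightarrow> x \<noteq> y \<Longrightarrow> s0 \<le> \<bar>x - y\<bar>"
    using separated_setE[OF \<Lambda>] by blast
  define u l where "u = upper_density \<Gamma>" and "l = lower_density \<Lambda>"
  \<comment> \<open>half of the gap between \<open>k * l\<close> and \<open>q * u\<close> is spent on replacing them by the strict bounds \<open>a\<close> and \<open>b\<close>\<close>
  define \<epsilon> where "\<epsilon> = (real k * l - real q * u) / 2 / (real k + real q)"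
  have pos: "0 < real k * l - real q * u"
    using dens k unfolding u_def l_def by (simp add: field_simps)
  have \<epsilon>: "\<epsilon> > 0" unfolding \<epsilon>_def using pos k by simp
  have \<epsilon>2: "(real k + real q) * \<epsilon> = (real k * l - real q * u) / 2"
  proof -
    have cancel: "y * (z / y) = z" if "y \<noteq> 0" for y z :: real using that by simp
    show ?thesis unfolding \<epsilon>_def using k by (intro cancel) simp
  qed
  define a b where "a = l - \<epsilon>" and "b = max 0 (u + \<epsilon>)"
  have u0: "0 \<le> u"
  proof (rule tendsto_lowerbound[OF upper_density_tendsto[OF \<Gamma>, folded u_def]])
    have "0 \<le> (SUP x. window_count \<Gamma> R x / (2 * R))" if "R > 0" for R
    proof -
      have "bdd_above (range (\<lambda>x. window_count \<Gamma> R x / (2 * R)))"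
        by (rule bdd_aboveI2[of _ _ "(D1 * R + 1) / (2 * R)"]) (use D1(2)[of R] that in \<open>simp add: divide_right_mono\<close>)
      then have "window_count \<Gamma> R 0 / (2 * R) \<le> (SUP x. window_count \<Gamma> R x / (2 * R))"
        by (intro cSUP_upper) auto
      moreover have "0 \<le> window_count \<Gamma> R 0 / (2 * R)" using that by (simp add: window_count_def)
      ultimately show ?thesis by linarith
    qed
    then show "\<forall>\<^sub>F R in at_top. 0 \<le> (SUP x. window_count \<Gamma> R x / (2 * R))"
      using eventually_gt_at_top[of 0] by (rule eventually_mono[rotated])
  qed simp
  have b_eq: "b = u + \<epsilon>" using u0 \<epsilon> by (simp add: b_def)
  have ab: "real q * b < real k * a"
    using \<epsilon>2 pos unfolding b_eq a_def by (simp add: algebra_simps)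
  obtain Cb where Cb: "\<And>x R. 0 \<le> R \<Longrightarrow> window_count \<Gamma> R x \<le> 2 * b * R + Cb" "Cb \<ge> 0"
    using window_count_le_of_upper_density[OF \<Gamma>, of b] \<epsilon> u0 unfolding b_eq u_def by auto
  obtain Ca where Ca: "\<And>x R. 0 \<le> R \<Longrightarrow> 2 * a * R - Ca \<le> window_count \<Lambda> R x" "Ca \<ge> 0"
    using window_count_ge_of_lower_density[OF \<Lambda>, of a] \<epsilon> unfolding a_def l_def by auto
  define A1 A2 where "A1 = C * exp (\<alpha> * (L + 1)) ^ q / \<kappa>" and "A2 = 2 / (1 - exp (- \<alpha>))"
  define E where "E n = (real k * (a * n * (n - 1) - Ca * n)
      - real q * (b * (n + 2 + L + 1) * (n + 2 + L + 2) + Cb * (n + 2 + L + 2))) / 2" for n :: real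
  define NG NL where "NG n = nat \<lceil>D1 * (n + 2 + L) + 1\<rceil>" and "NL n = k * nat \<lceil>D2 * n + 1\<rceil>" for n
  define \<delta> where "\<delta> n = A1 ^ NG n * A2 ^ NL n * exp (\<alpha> * (n + 1 - E n)) * (C * exp (\<alpha> * (n + 2 + L)))" for n
  have A1: "1 \<le> A1"
  proof -
    have "1 \<le> exp (\<alpha> * (L + 1)) ^ q" using \<alpha> L by (intro one_le_power) simp
    then have "1 * 1 \<le> C * exp (\<alpha> * (L + 1)) ^ q" using C by (intro mult_mono) auto
    then show ?thesis unfolding A1_def using \<kappa> by (simp add: le_divide_eq)
  qed
  have A2: "1 \<le> A2"
  proof -
    have "0 < 1 - exp (- \<alpha>)" using \<alpha> by simp
    moreover have "- 1 \<le> exp (- \<alpha>)" by (rule order_trans[of _ 0]) simp_all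
    then have "1 - exp (- \<alpha>) \<le> 2" by simp
    ultimately show ?thesis unfolding A2_def by (simp only: pos_le_divide_eq mult_1)
  qed
  have "\<exists>n::nat. \<delta> (real n) \<le> \<eta>"
  proof -
    \<comment> \<open>the coefficients of the logarithm of the bound for \<open>\<delta> n\<close>, a quadratic polynomial in \<open>n\<close>\<close>
    define \<theta> where "\<theta> = \<alpha> * (real k * a - real q * b) / 2"
    define \<beta> where "\<beta> = ln A1 * D1 + ln A2 * (real k * D2) + 2 * \<alpha>
      + \<alpha> / 2 * (real k * a + real k * Ca + real q * b * (2 * L + 7) + real q * Cb)"
    define \<tau> where "\<tau> = ln A1 * (D1 * (2 + L) + 2) + ln A2 * (real k * 2) + \<alpha> * (3 + L) + ln C - ln \<eta>
      + \<alpha> / 2 * (real q * b * (L + 3) * (L + 4) + real q * Cb * (L + 4))"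
    have "\<theta> > 0" unfolding \<theta>_def using ab \<alpha> by simp
    then obtain m :: nat where m: "- \<theta> * (real m * real m) + \<beta> * real m + \<tau> \<le> 0"
      using quadratic_dominates_linear by blast
    let ?n = "real m"
    have expo: "ln A1 * (D1 * (?n + 2 + L) + 2) + ln A2 * (real k * (D2 * ?n + 2)) + \<alpha> * (?n + 1 - E ?n) + \<alpha> * (?n + 2 + L) + ln C
        = - \<theta> * (?n * ?n) + \<beta> * ?n + \<tau> + ln \<eta>"
      unfolding \<theta>_def \<beta>_def \<tau>_def E_def by (simp add: field_simps)
    have "A1 ^ NG ?n \<le> exp (ln A1 * (D1 * (?n + 2 + L) + 2))"
    proof -
      have "0 \<le> D1 * (?n + 2 + L)" using D1 L by simp
      then have "real (NG ?n) \<le> D1 * (?n + 2 + L) + 2" unfolding NG_def by linarith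
      then have "A1 powr real (NG ?n) \<le> A1 powr (D1 * (?n + 2 + L) + 2)" using A1 by (intro powr_mono) auto
      moreover have "A1 powr real (NG ?n) = A1 ^ NG ?n" using A1 by (intro powr_realpow) simp
      ultimately show ?thesis using A1 by (simp add: powr_def[of _ "D1 * _ + 2"] mult.commute)
    qed
    moreover have "A2 ^ NL ?n \<le> exp (ln A2 * (real k * (D2 * ?n + 2)))"
    proof -
      have "0 \<le> D2 * ?n" using D2 by simp
      then have "real (nat \<lceil>D2 * ?n + 1\<rceil>) \<le> D2 * ?n + 2" by linarith
      then have "real (NL ?n) \<le> real k * (D2 * ?n + 2)" unfolding NL_def of_nat_mult by (intro mult_left_mono) auto
      then have "A2 powr real (NL ?n) \<le> A2 powr (real k * (D2 * ?n + 2))" using A2 by (intro powr_mono) auto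
      moreover have "A2 powr real (NL ?n) = A2 ^ NL ?n" using A2 by (intro powr_realpow) simp
      ultimately show ?thesis using A2 by (simp add: powr_def[of _ "real k * _"] mult.commute)
    qed
    ultimately have "\<delta> ?n \<le> exp (ln A1 * (D1 * (?n + 2 + L) + 2)) * exp (ln A2 * (real k * (D2 * ?n + 2)))
        * exp (\<alpha> * (?n + 1 - E ?n)) * (C * exp (\<alpha> * (?n + 2 + L)))"
      unfolding \<delta>_def using A1 A2 C by (intro mult_mono) auto
    also have "\<dots> = exp (ln A1 * (D1 * (?n + 2 + L) + 2) + ln A2 * (real k * (D2 * ?n + 2)) + \<alpha> * (?n + 1 - E ?n) + \<alpha> * (?n + 2 + L) + ln C)"
      using C by (simp add: exp_add mult_ac)
    also have "\<dots> \<le> exp (ln \<eta>)" unfolding expo using m by simp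
    also have "\<dots> = \<eta>" using \<eta> by simp
    finally show ?thesis by blast
  qed
  then obtain m :: nat where m: "\<delta> (real m) \<le> \<eta>" by blast
  define n where "n = real m"
  have n0: "0 \<le> n" by (simp add: n_def)
  define estimate where "estimate K \<longleftrightarrow> (\<forall>F V cc. window_data n s0 (NG n) (NL n) (E n) F V \<longrightarrow>
    norm (shift_sum F cc (e 0)) \<le> \<delta> n * (\<Sum>\<gamma>\<in>F. norm (cc \<gamma>) * exp (- \<alpha> * \<bar>\<gamma>\<bar>))
      + K * (\<Sum>x\<in>V. norm (shift_sum F cc (e x))))" for K
  have "\<exists>K\<ge>0. estimate K"
    unfolding estimate_def \<delta>_def A1_def A2_def by (rule local_estimate_at_origin[OF n0 s0(1), unfolded window_loss_def])
  then obtain K where K: "K \<ge> 0" and loc: "estimate K" by blast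
  show ?thesis
  proof (rule exI[of _ n], rule exI[of _ K], intro conjI allI impI n0 K)
    fix F :: "real set" and cc :: "real \<Rightarrow> complex" and x :: real
    assume "finite F \<and> F \<subseteq> \<Gamma>"
    then have F: "finite F" "F \<subseteq> \<Gamma>" by auto
    define F' V cc' where "F' = (\<lambda>\<gamma>. \<gamma> - x) ` F" and "V = (\<lambda>y. y - x) ` (\<Lambda> \<inter> {x - n..x + n})"
      and "cc' = (\<lambda>\<gamma>. cc (\<gamma> + x))"
    let ?S = "n + 2 + L"
    have S0: "0 \<le> ?S" using n0 L by simp
    have injx: "inj_on (\<lambda>y. y - x) A" for A by (auto simp: inj_on_def)
    have W': "{\<gamma>\<in>F'. \<bar>\<gamma>\<bar> \<le> ?S} = (\<lambda>\<gamma>. \<gamma> - x) ` (F \<inter> {x - ?S..x + ?S})"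
      by (auto simp: F'_def abs_le_iff intro!: imageI)
    have cardW: "card {\<gamma>\<in>F'. \<bar>\<gamma>\<bar> \<le> ?S} \<le> NG n"
    proof -
      have "card {\<gamma>\<in>F'. \<bar>\<gamma>\<bar> \<le> ?S} = card (F \<inter> {x - ?S..x + ?S})" unfolding W' card_image[OF injx] ..
      also have "\<dots> \<le> card (\<Gamma> \<inter> {x - ?S..x + ?S})" using F fin\<Gamma> by (intro card_mono) auto
      finally have "real (card {\<gamma>\<in>F'. \<bar>\<gamma>\<bar> \<le> ?S}) \<le> window_count \<Gamma> ?S x"
        unfolding window_count_def by simp
      also have "\<dots> \<le> D1 * ?S + 1" by (rule D1(2)[OF S0])
      finally show ?thesis unfolding NG_def by linarith
    qed
    have card\<Lambda>: "k * card V \<le> NL n"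
    proof -
      have "real (card V) = window_count \<Lambda> n x" unfolding window_count_def V_def card_image[OF injx] ..
      also have "\<dots> \<le> D2 * n + 1" by (rule D2(2)[OF n0])
      finally have "card V \<le> nat \<lceil>D2 * n + 1\<rceil>" by linarith
      then show ?thesis unfolding NL_def by simp
    qed
    have energy: "real q * (\<Sum>\<gamma>\<in>{\<gamma>\<in>F'. \<bar>\<gamma>\<bar> \<le> ?S}. ?S - \<bar>\<gamma>\<bar>) - real k * (\<Sum>x\<in>V. n - \<bar>x\<bar>) \<le> - 2 * E n"
    proof -
      have "(\<Sum>\<gamma>\<in>{\<gamma>\<in>F'. \<bar>\<gamma>\<bar> \<le> ?S}. ?S - \<bar>\<gamma>\<bar>) = (\<Sum>\<gamma>\<in>F \<inter> {x - ?S..x + ?S}. ?S - \<bar>\<gamma> - x\<bar>)"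
        unfolding W' by (subst sum.reindex[OF injx]) simp
      also have "\<dots> \<le> (\<Sum>\<gamma>\<in>\<Gamma> \<inter> {x - ?S..x + ?S}. ?S - \<bar>\<gamma> - x\<bar>)"
        using F fin\<Gamma> by (intro sum_mono2) auto
      also have "\<dots> \<le> b * (?S + 1) * (?S + 2) + Cb * (?S + 2)"
        by (rule triangle_sum_le[OF fin\<Gamma> Cb(1) _ Cb(2) S0]) (auto simp: b_def)
      finally have 1: "real q * (\<Sum>\<gamma>\<in>{\<gamma>\<in>F'. \<bar>\<gamma>\<bar> \<le> ?S}. ?S - \<bar>\<gamma>\<bar>) \<le> real q * (b * (?S + 1) * (?S + 2) + Cb * (?S + 2))"
        by (intro mult_left_mono) auto
      have "a * n * (n - 1) - Ca * n \<le> (\<Sum>y\<in>\<Lambda> \<inter> {x - n..x + n}. n - \<bar>y - x\<bar>)"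
        unfolding n_def by (rule triangle_sum_ge[OF fin\<Lambda> Ca(1)])
      also have "\<dots> = (\<Sum>x\<in>V. n - \<bar>x\<bar>)" unfolding V_def by (subst sum.reindex[OF injx]) simp
      finally have 2: "real k * (a * n * (n - 1) - Ca * n) \<le> real k * (\<Sum>x\<in>V. n - \<bar>x\<bar>)"
        by (intro mult_left_mono) auto
      have half: "- 2 * ((X - Y) / 2) = Y - X" for X Y :: real by simp
      show ?thesis unfolding E_def half using 1 2 by linarith
    qed
    have "norm (shift_sum F' cc' (e 0)) \<le> \<delta> n * (\<Sum>\<gamma>\<in>F'. norm (cc' \<gamma>) * exp (- \<alpha> * \<bar>\<gamma>\<bar>))
      + K * (\<Sum>x\<in>V. norm (shift_sum F' cc' (e x)))"
    proof (rule loc[unfolded estimate_def, THEN spec, THEN spec, THEN spec, THEN mp], unfold window_data_def, intro conjI cardW card\<Lambda> energy)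
      show "finite F'" "finite V" using F fin\<Lambda> by (auto simp: F'_def V_def)
      show "\<forall>x\<in>V. \<bar>x\<bar> \<le> n" by (auto simp: V_def)
      show "\<forall>x\<in>V. \<forall>y\<in>V. x \<noteq> y \<longrightarrow> s0 \<le> \<bar>x - y\<bar>" using s0(2) by (auto simp: V_def)
    qed
    moreover have "shift_sum F' cc' (e y) = shift_sum F cc (e (x + y))" for y
      unfolding F'_def cc'_def by (rule shift_sum_translate)
    moreover have "(\<Sum>\<gamma>\<in>F'. norm (cc' \<gamma>) * exp (- \<alpha> * \<bar>\<gamma>\<bar>)) = (\<Sum>\<gamma>\<in>F. norm (cc \<gamma>) * expker \<alpha> x \<gamma>)"
      unfolding F'_def cc'_def by (subst sum.reindex[OF injx]) (simp add: abs_minus_commute)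
    moreover have "(\<Sum>y\<in>V. norm (shift_sum F cc (e (x + y)))) = (\<Sum>y\<in>\<Lambda> \<inter> {x - n..x + n}. norm (shift_sum F cc (e y)))"
      unfolding V_def by (subst sum.reindex[OF injx]) simp
    ultimately have "norm (shift_sum F cc (e x)) \<le> \<delta> n * (\<Sum>\<gamma>\<in>F. norm (cc \<gamma>) * expker \<alpha> x \<gamma>)
      + K * (\<Sum>y\<in>\<Lambda> \<inter> {x - n..x + n}. norm (shift_sum F cc (e y)))"
      by simp
    also have "\<dots> \<le> \<eta> * (\<Sum>\<gamma>\<in>F. norm (cc \<gamma>) * expker \<alpha> x \<gamma>)
      + K * (\<Sum>y\<in>\<Lambda> \<inter> {x - n..x + n}. norm (shift_sum F cc (e y)))"
      using m unfolding n_def by (intro add_right_mono mult_right_mono sum_nonneg) auto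
    finally show "norm (shift_sum F cc (e x)) \<le> \<eta> * (\<Sum>\<gamma>\<in>F. norm (cc \<gamma>) * expker \<alpha> x \<gamma>)
      + K * (\<Sum>y\<in>\<Lambda> \<inter> {x - n..x + n}. norm (shift_sum F cc (e y)))" .
  qed
qed

end

section \<open>The exponential kernel on separated sets\<close>

lemma nn_integral_count_space_from_nat_into:
  fixes f :: "'a \<Rightarrow> ennreal"
  assumes "countable A" "infinite A"
  shows "(\<integral>\<^sup>+x. f x \<partial>count_space A) = (\<Sum>n. f (from_nat_into A n))"
  using bij_betw_from_nat_into[OF assms]
  by (simp add: nn_integral_bij_count_space[symmetric] nn_integral_count_space_nat)

lemma borel_measurable_nn_integral_count_space:
  fixes f :: "'i \<Rightarrow> 'a \<Rightarrow> ennreal"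
  assumes A: "countable A" and f: "\<And>i. i \<in> A \<Longrightarrow> f i \<in> borel_measurable M"
  shows "(\<lambda>x. \<integral>\<^sup>+i. f i x \<partial>count_space A) \<in> borel_measurable M"
proof (cases "finite A")
  case True
  then show ?thesis using f by (simp add: nn_integral_count_space_finite borel_measurable_sum)
next
  case False
  then have "A \<noteq> {}" by auto
  then have [measurable]: "f (from_nat_into A n) \<in> borel_measurable M" for n
    by (intro f from_nat_into)
  show ?thesis unfolding nn_integral_count_space_from_nat_into[OF A False] by measurable
qed

lemma infsum_ennreal_eq_nn_integral:
  fixes f :: "'a \<Rightarrow> ennreal"
  assumes A: "countable A"
  shows "infsum f A = (\<integral>\<^sup>+x. f x \<partial>count_space A)"
proof (rule antisym)
  have "f summable_on A" by (rule nonneg_summable_on_complete) simp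
  then show "infsum f A \<le> (\<integral>\<^sup>+x. f x \<partial>count_space A)"
  proof (rule infsum_le_finite_sums)
    fix F assume F: "finite F" "F \<subseteq> A"
    have "sum f F = (\<integral>\<^sup>+x. f x * indicator F x \<partial>count_space A)"
      using F by (subst nn_integral_count_space'[of F]) auto
    also have "\<dots> \<le> (\<integral>\<^sup>+x. f x \<partial>count_space A)"
      by (intro nn_integral_mono) (auto simp: indicator_def)
    finally show "sum f F \<le> (\<integral>\<^sup>+x. f x \<partial>count_space A)" .
  qed
next
  have fin_le: "sum f F \<le> infsum f A" if "finite F" "F \<subseteq> A" for F
    using that nonneg_infsum_complete[of A f] by (auto intro: SUP_upper)
  show "(\<integral>\<^sup>+x. f x \<partial>count_space A) \<le> infsum f A"
  proof (cases "finite A")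
    case True
    then show ?thesis by (simp add: nn_integral_count_space_finite)
  next
    case False
    have ne: "A \<noteq> {}" using False by auto
    have inj: "inj (from_nat_into A)"
      using bij_betw_from_nat_into[OF A False] by (simp add: bij_betw_def)
    have "(\<Sum>n. f (from_nat_into A n)) \<le> infsum f A"
      unfolding suminf_eq_SUP
    proof (rule SUP_least)
      fix n
      have "(\<Sum>i<n. f (from_nat_into A i)) = sum f (from_nat_into A ` {..<n})"
        using inj by (subst sum.reindex) (auto simp: inj_on_def)
      also have "\<dots> \<le> infsum f A" using from_nat_into[OF ne] by (intro fin_le) auto
      finally show "(\<Sum>i<n. f (from_nat_into A i)) \<le> infsum f A" .
    qed
    then show ?thesis unfolding nn_integral_count_space_from_nat_into[OF A False] .
  qed
qed

lemma ennreal_infsum: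
  fixes g :: "'a \<Rightarrow> real"
  assumes "g summable_on A" "\<And>x. x \<in> A \<Longrightarrow> 0 \<le> g x"
  shows "ennreal (infsum g A) = infsum (\<lambda>x. ennreal (g x)) A"
proof -
  have "(SUP F\<in>{F. finite F \<and> F \<subseteq> A}. ennreal (sum g F)) = (SUP F\<in>{F. finite F \<and> F \<subseteq> A}. \<Sum>x\<in>F. ennreal (g x))"
    using assms(2) by (intro SUP_cong refl sum_ennreal[symmetric]) auto
  then show ?thesis
    using infsum_nonneg_is_SUPREMUM_ennreal[OF assms] nonneg_infsum_complete[of A "\<lambda>x. ennreal (g x)"] by simp
qed

text \<open>A separated set has boundedly many points at distance between \<open>j\<close> and \<open>j + 1\<close> from \<open>x\<close>; sum a geometric series.\<close>

lemma kernel_sum_bound: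
  assumes S: "separated_set S" and \<alpha>: "\<alpha> > 0"
  obtains W where "W > 0" "\<And>x F. finite F \<Longrightarrow> F \<subseteq> S \<Longrightarrow> (\<Sum>s\<in>F. expker \<alpha> x s) \<le> W"
proof -
  obtain D where D: "D > 0" "\<And>R x. R \<ge> 0 \<Longrightarrow> window_count S R x \<le> D * R + 1"
    and fin: "\<And>R x. finite (S \<inter> {x - R..x + R})"
    using separated_window_count[OF S] by blast
  define r where "r = exp (- \<alpha>)"
  have r: "0 < r" "r < 1" using \<alpha> by (auto simp: r_def)
  have "(\<Sum>s\<in>F. expker \<alpha> x s) \<le> (D + 2) * (1 / (1 - r))" if F: "finite F" "F \<subseteq> S" for x F
  proof -
    define m where "m s = nat \<lfloor>\<bar>x - s\<bar>\<rfloor>" for s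
    have m: "real (m s) \<le> \<bar>x - s\<bar>" "\<bar>x - s\<bar> \<le> real (m s) + 1" for s
      unfolding m_def by linarith+
    obtain N where N: "m ` F \<subseteq> {..<N}" using finite_nat_bounded[of "m ` F"] F by auto
    have "(\<Sum>s\<in>F. expker \<alpha> x s) \<le> (\<Sum>s\<in>F. r ^ m s)"
    proof (rule sum_mono)
      fix s
      have "- \<alpha> * \<bar>x - s\<bar> \<le> real (m s) * - \<alpha>" using mult_left_mono[OF m(1)[of s], of \<alpha>] \<alpha> by (simp add: mult.commute)
      then show "expker \<alpha> x s \<le> r ^ m s" unfolding r_def exp_of_nat_mult[symmetric] by simp
    qed
    also have "\<dots> = (\<Sum>j<N. \<Sum>s\<in>{s\<in>F. m s = j}. r ^ m s)"
      using sum.group[OF F(1) finite_lessThan N, of "\<lambda>s. r ^ m s"] by simp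
    also have "\<dots> \<le> (\<Sum>j<N. (D + 2) * r ^ j)"
    proof (rule sum_mono)
      fix j :: nat
      let ?J1 = "S \<inter> {x + j + 1/2 - 1/2..x + j + 1/2 + 1/2}" and ?J2 = "S \<inter> {x - j - 1/2 - 1/2..x - j - 1/2 + 1/2}"
      have "{s\<in>F. m s = j} \<subseteq> ?J1 \<union> ?J2"
      proof
        fix s assume "s \<in> {s\<in>F. m s = j}"
        then have s: "s \<in> S" "real j \<le> \<bar>x - s\<bar>" "\<bar>x - s\<bar> \<le> real j + 1" using m[of s] F by auto
        show "s \<in> ?J1 \<union> ?J2"
          using s by (cases "x \<le> s") (auto simp: abs_if split: if_splits)
      qed
      then have "card {s\<in>F. m s = j} \<le> card (?J1 \<union> ?J2)"
        using fin by (intro card_mono) blast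
      also have "\<dots> \<le> card ?J1 + card ?J2"
        by (rule card_Un_le)
      finally have "real (card {s\<in>F. m s = j}) \<le> window_count S (1/2) (x + j + 1/2) + window_count S (1/2) (x - j - 1/2)"
        unfolding window_count_def by linarith
      also have "\<dots> \<le> D + 2" using D(2)[of "1/2" "x + j + 1/2"] D(2)[of "1/2" "x - j - 1/2"] by simp
      finally have c: "real (card {s\<in>F. m s = j}) \<le> D + 2" .
      have "(\<Sum>s\<in>{s\<in>F. m s = j}. r ^ m s) = (\<Sum>s\<in>{s\<in>F. m s = j}. r ^ j)" by (intro sum.cong) auto
      also have "\<dots> = real (card {s\<in>F. m s = j}) * r ^ j" by simp
      also have "\<dots> \<le> (D + 2) * r ^ j" using c r by (intro mult_right_mono) auto
      finally show "(\<Sum>s\<in>{s\<in>F. m s = j}. r ^ m s) \<le> (D + 2) * r ^ j" .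
    qed
    also have "\<dots> = (D + 2) * (\<Sum>j<N. r ^ j)" by (simp only: sum_distrib_left)
    also have "\<dots> \<le> (D + 2) * (1 / (1 - r))"
    proof (rule mult_left_mono)
      have "(\<Sum>j<N. r ^ j) = (1 - r ^ N) / (1 - r)"
        using r by (subst geometric_sum) (auto simp: field_simps)
      also have "\<dots> \<le> 1 / (1 - r)" using r by (intro divide_right_mono) auto
      finally show "(\<Sum>j<N. r ^ j) \<le> 1 / (1 - r)" .
    qed (use D in auto)
    finally show ?thesis .
  qed
  moreover have "(D + 2) * (1 / (1 - r)) > 0" using D r by simp
  ultimately show thesis by (rule that[rotated])
qed

lemma kernel_sum_summable:
  fixes a :: "real \<Rightarrow> real"
  assumes W: "\<And>F. finite F \<Longrightarrow> F \<subseteq> S \<Longrightarrow> (\<Sum>s\<in>F. expker \<alpha> x s) \<le> W"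
    and a: "\<And>s. s \<in> S \<Longrightarrow> 0 \<le> a s" "\<And>s. s \<in> S \<Longrightarrow> a s \<le> B" and B: "0 \<le> B"
  shows "(\<lambda>s. a s * expker \<alpha> x s) summable_on S"
    and "infsum (\<lambda>s. a s * expker \<alpha> x s) S \<le> B * W"
proof -
  have le: "(\<Sum>s\<in>F. a s * expker \<alpha> x s) \<le> B * W" if F: "finite F" "F \<subseteq> S" for F
  proof -
    have "(\<Sum>s\<in>F. a s * expker \<alpha> x s) \<le> (\<Sum>s\<in>F. B * expker \<alpha> x s)"
      using F a by (intro sum_mono mult_right_mono) auto
    also have "\<dots> = B * (\<Sum>s\<in>F. expker \<alpha> x s)" by (simp only: sum_distrib_left)
    also have "\<dots> \<le> B * W" using B by (intro mult_left_mono W F)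
    finally show ?thesis .
  qed
  show sm: "(\<lambda>s. a s * expker \<alpha> x s) summable_on S"
    using a le by (intro nonneg_bdd_above_summable_on) (auto intro!: bdd_aboveI[of _ "B * W"])
  show "infsum (\<lambda>s. a s * expker \<alpha> x s) S \<le> B * W"
    by (rule infsum_le_finite_sums[OF sm le])
qed

text \<open>Jensen's inequality for the convex function \<open>\<lambda>y. y powr p\<close> on the positive reals; terms with \<open>a s = 0\<close> contribute to
  neither side.\<close>

lemma weighted_power_mean:
  fixes w a :: "'a \<Rightarrow> real"
  assumes p: "1 \<le> p" and F: "finite F" and w: "\<And>s. s \<in> F \<Longrightarrow> 0 < w s" and a: "\<And>s. s \<in> F \<Longrightarrow> 0 \<le> a s"
    and W: "sum w F \<le> W"
  shows "(\<Sum>s\<in>F. a s * w s) powr p \<le> W powr (p - 1) * (\<Sum>s\<in>F. a s powr p * w s)"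
proof -
  define F' where "F' = {s\<in>F. 0 < a s}"
  have F': "finite F'" "F' \<subseteq> F" using F by (auto simp: F'_def)
  have s1: "(\<Sum>s\<in>F. a s * w s) = (\<Sum>s\<in>F'. a s * w s)"
    using F a by (intro sum.mono_neutral_right) (force simp: F'_def)+
  have s2: "(\<Sum>s\<in>F. a s powr p * w s) = (\<Sum>s\<in>F'. a s powr p * w s)"
    using F a by (intro sum.mono_neutral_right) (force simp: F'_def)+
  show ?thesis
  proof (cases "F' = {}")
    case True
    then show ?thesis unfolding s1 s2 by simp
  next
    case False
    define W' where "W' = sum w F'"
    have W': "0 < W'" unfolding W'_def using F' False w by (intro sum_pos) auto
    have "W' \<le> W" using sum_mono2[OF F F'(2), of w] w W unfolding W'_def by (auto simp: less_imp_le)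
    have "(\<Sum>s\<in>F'. (w s / W') *\<^sub>R a s) powr p \<le> (\<Sum>s\<in>F'. (w s / W') * a s powr p)"
      using False F' w W' by (intro convex_on_sum[OF _ _ powr_convex[OF p]])
        (auto simp: F'_def W'_def sum_divide_distrib[symmetric] less_imp_le)
    then have jensen: "((\<Sum>s\<in>F'. a s * w s) / W') powr p \<le> (\<Sum>s\<in>F'. a s powr p * w s) / W'"
      by (simp add: sum_divide_distrib mult.commute)
    have nn: "0 \<le> (\<Sum>s\<in>F'. a s * w s)" using F' w a by (intro sum_nonneg) (auto simp: less_imp_le)
    have nn2: "0 \<le> (\<Sum>s\<in>F'. a s powr p * w s)" using F' w by (intro sum_nonneg) (auto simp: less_imp_le)
    have "(\<Sum>s\<in>F'. a s * w s) powr p = W' powr p * ((\<Sum>s\<in>F'. a s * w s) / W') powr p"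
      using W' nn by (simp add: powr_divide)
    also have "\<dots> \<le> W' powr p * ((\<Sum>s\<in>F'. a s powr p * w s) / W')"
      by (intro mult_left_mono jensen) auto
    also have "\<dots> = W' powr (p - 1) * (\<Sum>s\<in>F'. a s powr p * w s)"
      using W' by (simp add: powr_diff)
    also have "\<dots> \<le> W powr (p - 1) * (\<Sum>s\<in>F'. a s powr p * w s)"
      using W' \<open>W' \<le> W\<close> p nn2 by (intro mult_right_mono powr_mono2) auto
    finally show ?thesis unfolding s1 s2 .
  qed
qed

lemma kernel_sum_powr_le:
  fixes a :: "real \<Rightarrow> real"
  assumes p: "1 \<le> p"
    and W: "\<And>F. finite F \<Longrightarrow> F \<subseteq> S \<Longrightarrow> (\<Sum>s\<in>F. expker \<alpha> x s) \<le> W"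
    and a: "\<And>s. s \<in> S \<Longrightarrow> 0 \<le> a s" "\<And>s. s \<in> S \<Longrightarrow> a s \<le> B" and B: "0 \<le> B"
  shows "infsum (\<lambda>s. a s * expker \<alpha> x s) S powr p
    \<le> W powr (p - 1) * infsum (\<lambda>s. a s powr p * expker \<alpha> x s) S"
proof -
  let ?e = "\<lambda>s. expker \<alpha> x s"
  define R where "R = W powr (p - 1) * infsum (\<lambda>s. a s powr p * ?e s) S"
  have sm: "(\<lambda>s. a s * ?e s) summable_on S" by (rule kernel_sum_summable(1)[OF W a B])
  have smp: "(\<lambda>s. a s powr p * ?e s) summable_on S"
    using a p by (intro kernel_sum_summable(1)[OF W, where B = "B powr p"]) (auto intro: powr_mono2)
  have "infsum (\<lambda>s. a s * ?e s) S \<le> R powr (1 / p)"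
  proof (rule infsum_le_finite_sums[OF sm])
    fix F assume F: "finite F" "F \<subseteq> S"
    have "(\<Sum>s\<in>F. a s * ?e s) powr p \<le> W powr (p - 1) * (\<Sum>s\<in>F. a s powr p * ?e s)"
      using F a by (intro weighted_power_mean[OF p F(1)] W) auto
    also have "\<dots> \<le> R" unfolding R_def using F by (intro mult_left_mono finite_sum_le_infsum[OF smp]) auto
    finally have "((\<Sum>s\<in>F. a s * ?e s) powr p) powr (1 / p) \<le> R powr (1 / p)"
      using p by (intro powr_mono2) auto
    moreover have "0 \<le> (\<Sum>s\<in>F. a s * ?e s)" using F a by (intro sum_nonneg) auto
    ultimately show "(\<Sum>s\<in>F. a s * ?e s) \<le> R powr (1 / p)" using p by (simp add: powr_powr)
  qed
  moreover have "0 \<le> infsum (\<lambda>s. a s * ?e s) S" using a by (intro infsum_nonneg) auto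
  ultimately have "infsum (\<lambda>s. a s * ?e s) S powr p \<le> (R powr (1 / p)) powr p"
    using p by (intro powr_mono2) auto
  moreover have "0 \<le> R" unfolding R_def by (intro mult_nonneg_nonneg infsum_nonneg) auto
  ultimately show ?thesis using p unfolding R_def by (simp add: powr_powr)
qed

text \<open>The power mean inequality under the sum, followed by Tonelli's theorem.  The measurable majorant \<open>g\<close> is part of the
  conclusion so that two such sums can be added under the integral.\<close>

lemma schur_test_kernel:
  fixes a :: "real \<Rightarrow> real"
  assumes p: "1 \<le> p" and S: "countable S"
    and W: "\<And>x F. finite F \<Longrightarrow> F \<subseteq> S \<Longrightarrow> (\<Sum>s\<in>F. expker \<alpha> x s) \<le> W"
    and meas: "\<And>s. s \<in> S \<Longrightarrow> (\<lambda>x. ennreal (expker \<alpha> x s)) \<in> borel_measurable M"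
    and b: "\<And>s. s \<in> S \<Longrightarrow> (\<integral>\<^sup>+x. ennreal (expker \<alpha> x s) \<partial>M) \<le> ennreal b"
    and a: "\<And>s. s \<in> S \<Longrightarrow> 0 \<le> a s" "\<And>s. s \<in> S \<Longrightarrow> a s \<le> B" and B: "0 \<le> B"
  obtains g where "g \<in> borel_measurable M"
    "\<And>x. ennreal (infsum (\<lambda>s. a s * expker \<alpha> x s) S powr p) \<le> g x"
    "(\<integral>\<^sup>+x. g x \<partial>M) \<le> ennreal (W powr (p - 1) * b) * infsum (\<lambda>s. ennreal (a s powr p)) S"
proof -
  let ?e = "\<lambda>x s. expker \<alpha> x s"
  define g where "g x = ennreal (W powr (p - 1)) * (\<integral>\<^sup>+s. ennreal (a s powr p) * ennreal (?e x s) \<partial>count_space S)" for x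
  have meas1: "(\<lambda>x. ennreal (a s powr p) * ennreal (?e x s)) \<in> borel_measurable M" if "s \<in> S" for s
    using meas[OF that] by measurable
  have meas2: "(\<lambda>x. \<integral>\<^sup>+s. ennreal (a s powr p) * ennreal (?e x s) \<partial>count_space S) \<in> borel_measurable M"
    by (rule borel_measurable_nn_integral_count_space[OF S meas1])
  show thesis
  proof (rule that[of g])
    show "g \<in> borel_measurable M" unfolding g_def using meas2 by measurable
    fix x
    have smp: "(\<lambda>s. a s powr p * ?e x s) summable_on S"
      using a p by (intro kernel_sum_summable(1)[OF W, where B = "B powr p"]) (auto intro: powr_mono2)
    have "ennreal (infsum (\<lambda>s. a s * ?e x s) S powr p)
        \<le> ennreal (W powr (p - 1) * infsum (\<lambda>s. a s powr p * ?e x s) S)"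
      by (intro ennreal_leI kernel_sum_powr_le[OF p W a B])
    also have "\<dots> = ennreal (W powr (p - 1)) * ennreal (infsum (\<lambda>s. a s powr p * ?e x s) S)"
      by (intro ennreal_mult infsum_nonneg) auto
    also have "ennreal (infsum (\<lambda>s. a s powr p * ?e x s) S) = infsum (\<lambda>s. ennreal (a s powr p * ?e x s)) S"
      by (intro ennreal_infsum smp) auto
    also have "\<dots> = (\<integral>\<^sup>+s. ennreal (a s powr p) * ennreal (?e x s) \<partial>count_space S)"
      unfolding infsum_ennreal_eq_nn_integral[OF S] by (intro nn_integral_cong) (simp add: ennreal_mult)
    finally show "ennreal (infsum (\<lambda>s. a s * ?e x s) S powr p) \<le> g x" unfolding g_def .
  next
    have "(\<integral>\<^sup>+x. g x \<partial>M) = ennreal (W powr (p - 1)) *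
        (\<integral>\<^sup>+x. \<integral>\<^sup>+s. ennreal (a s powr p) * ennreal (?e x s) \<partial>count_space S \<partial>M)"
      unfolding g_def by (rule nn_integral_cmult[OF meas2])
    also have "(\<integral>\<^sup>+x. \<integral>\<^sup>+s. ennreal (a s powr p) * ennreal (?e x s) \<partial>count_space S \<partial>M)
        = (\<integral>\<^sup>+s. \<integral>\<^sup>+x. ennreal (a s powr p) * ennreal (?e x s) \<partial>M \<partial>count_space S)"
      by (rule nn_integral_count_space_nn_integral[OF S meas1])
    also have "\<dots> \<le> (\<integral>\<^sup>+s. ennreal b * ennreal (a s powr p) \<partial>count_space S)"
    proof (rule nn_integral_mono)
      fix s assume "s \<in> space (count_space S)"
      then have s: "s \<in> S" by simp
      have "(\<integral>\<^sup>+x. ennreal (a s powr p) * ennreal (?e x s) \<partial>M) = ennreal (a s powr p) * (\<integral>\<^sup>+x. ennreal (?e x s) \<partial>M)"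
        by (rule nn_integral_cmult[OF meas[OF s]])
      also have "\<dots> \<le> ennreal (a s powr p) * ennreal b" by (intro mult_left_mono b s) auto
      finally show "(\<integral>\<^sup>+x. ennreal (a s powr p) * ennreal (?e x s) \<partial>M) \<le> ennreal b * ennreal (a s powr p)"
        by (simp add: mult.commute)
    qed
    also have "\<dots> = ennreal b * infsum (\<lambda>s. ennreal (a s powr p)) S"
      unfolding infsum_ennreal_eq_nn_integral[OF S] by (intro nn_integral_cmult) simp
    also have "ennreal (W powr (p - 1)) * (ennreal b * infsum (\<lambda>s. ennreal (a s powr p)) S)
        = ennreal (W powr (p - 1) * b) * infsum (\<lambda>s. ennreal (a s powr p)) S"
      by (simp add: ennreal_mult' mult.assoc)
    finally show "(\<integral>\<^sup>+x. g x \<partial>M) \<le> ennreal (W powr (p - 1) * b) * infsum (\<lambda>s. ennreal (a s powr p)) S"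
      by (simp add: mult_left_mono)
  qed
qed

text \<open>The kernel is \<open>1 / \<alpha>\<close> times two exponential densities, one on each side of \<open>s\<close>.\<close>

lemma kernel_integral_lborel:
  assumes "\<alpha> > 0"
  shows "(\<integral>\<^sup>+x. ennreal (expker \<alpha> x s) \<partial>lborel) \<le> ennreal (2 / \<alpha>)"
proof -
  let ?d = "exponential_density \<alpha>"
  interpret prob_space "density lborel ?d" by (rule prob_space_exponential_density[OF assms])
  have one: "(\<integral>\<^sup>+x. ennreal (?d x) \<partial>lborel) = 1"
    using emeasure_space_1 by (simp add: emeasure_density)
  have r: "(\<integral>\<^sup>+x. ennreal (?d (x - s)) \<partial>lborel) = 1"
    using nn_integral_real_affine[of "\<lambda>x. ennreal (?d x)" 1 "- s"] one by simp
  have l: "(\<integral>\<^sup>+x. ennreal (?d (s - x)) \<partial>lborel) = 1"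
    using nn_integral_real_affine[of "\<lambda>x. ennreal (?d x)" "- 1" s] one by simp
  have d0: "0 \<le> ?d x" for x using assms by (simp add: exponential_density_def)
  have "(\<integral>\<^sup>+x. ennreal (expker \<alpha> x s) \<partial>lborel)
      \<le> (\<integral>\<^sup>+x. ennreal (1 / \<alpha>) * (ennreal (?d (x - s)) + ennreal (?d (s - x))) \<partial>lborel)"
  proof (rule nn_integral_mono)
    fix x
    have "expker \<alpha> x s \<le> 1 / \<alpha> * (?d (x - s) + ?d (s - x))"
      using assms by (auto simp: exponential_density_def abs_if algebra_simps)
    then have "ennreal (expker \<alpha> x s) \<le> ennreal (1 / \<alpha> * (?d (x - s) + ?d (s - x)))"
      by (rule ennreal_leI)
    also have "\<dots> = ennreal (1 / \<alpha>) * (ennreal (?d (x - s)) + ennreal (?d (s - x)))"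
      using assms d0 by (simp only: ennreal_mult'' ennreal_plus d0 add_nonneg_nonneg)
    finally show "ennreal (expker \<alpha> x s) \<le> ennreal (1 / \<alpha>) * (ennreal (?d (x - s)) + ennreal (?d (s - x)))" .
  qed
  also have "\<dots> = ennreal (1 / \<alpha>) * (1 + 1)"
    by (subst nn_integral_cmult, measurable) (subst nn_integral_add, measurable, simp add: r l)
  also have "\<dots> = ennreal (1 / \<alpha> * 2)" using assms by (subst ennreal_mult) (auto simp: one_add_one)
  finally show ?thesis by simp
qed

lemma kernel_integral_count_space:
  assumes S: "countable S"
    and W: "\<And>F. finite F \<Longrightarrow> F \<subseteq> S \<Longrightarrow> (\<Sum>s\<in>F. expker \<alpha> x s) \<le> W"
  shows "(\<integral>\<^sup>+s. ennreal (expker \<alpha> s x) \<partial>count_space S) \<le> ennreal W"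
  unfolding infsum_ennreal_eq_nn_integral[OF S, symmetric]
proof (rule infsum_le_finite_sums[OF nonneg_summable_on_complete])
  fix F assume F: "finite F" "F \<subseteq> S"
  then show "(\<Sum>s\<in>F. ennreal (expker \<alpha> s x)) \<le> ennreal W"
    using W[OF F] by (simp add: abs_minus_commute ennreal_leI)
qed simp

section \<open>Sampling\<close>

lemma class_K_constants:
  assumes \<alpha>: "\<alpha> > 0" and G: "G \<in> class_K \<alpha>"
  obtains P Q \<omega> c C \<kappa> L where
    "exponential_rational \<alpha> P Q (q_num \<alpha> G) (k_num \<alpha> G) \<omega> c C \<kappa> L"
    "\<And>x. G (of_real x) = poly P (of_real (exp (\<alpha> * x))) / poly Q (of_real (exp (\<alpha> * x)))"
    "\<And>x. norm (G (of_real x)) \<le> C * exp (- \<alpha> * \<bar>x\<bar>)"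
proof -
  obtain P Q where r: "represents \<alpha> P Q G" using G unfolding class_K_def by blast
  have deg: "degree P < degree Q" and Geq: "\<And>z. G z = poly P (exp (of_real \<alpha> * z)) / poly Q (exp (of_real \<alpha> * z))"
    using r unfolding represents_def by auto
  have q: "q_num \<alpha> G = degree Q" using q_num_eq[OF _ r] \<alpha> by simp
  have Gx: "G (of_real x) = poly P (of_real (exp (\<alpha> * x))) / poly Q (of_real (exp (\<alpha> * x)))" for x :: real
    unfolding Geq by (simp only: of_real_mult[symmetric] exp_of_real)
  obtain c where k: "k_num \<alpha> G > 0"
    and c: "\<And>z. G (z + 2 * of_real pi * \<i> / (of_nat (k_num \<alpha> G) * of_real \<alpha>)) = c * G z"
    using k_num_quasi_period[OF \<alpha> r] by blast
  define \<omega> where "\<omega> = cis (2 * pi / real (k_num \<alpha> G))"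
  note rot = quasi_period_rotates_fraction[OF \<alpha> r k c \<omega>_def]
  obtain Ca where Ca: "Ca \<ge> 1" "\<And>v. norm (poly P v) \<le> Ca * max 1 (norm v) ^ degree Q"
    using poly_norm_le_max_power[of P "degree Q"] deg by (metis less_imp_le)
  obtain Cb where Cb: "Cb \<ge> 1" "\<And>v. norm (poly Q v) \<le> Cb * max 1 (norm v) ^ degree Q"
    using poly_norm_le_max_power[of Q "degree Q"] by blast
  obtain Cc B where Cc: "Cc \<ge> 1" "B \<ge> 1"
    and far: "\<And>v. B \<le> norm v \<Longrightarrow> poly Q v \<noteq> 0 \<and> norm (poly P v / poly Q v) \<le> Cc / norm v"
    and near: "\<And>v. norm v \<le> 1 / B \<Longrightarrow> poly Q v \<noteq> 0 \<and> norm (poly P v / poly Q v) \<le> Cc * norm v"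
    using rational_function_decay[OF r] by blast
  obtain Cd where Cd: "Cd \<ge> 1" "\<And>x. x > 0 \<Longrightarrow> norm (poly P (of_real x) / poly Q (of_real x)) \<le> Cd * min x (1 / x)"
    using rational_function_ray_decay[OF r] by blast
  obtain k0 where k0: "k0 > 0" "\<And>x. x \<ge> 0 \<Longrightarrow> k0 * max 1 x ^ degree Q \<le> norm (poly Q (of_real x))"
    using denominator_ray_lower_bound[OF r] by blast
  define C where "C = Ca + Cb + Cc + Cd"
  have CC: "1 \<le> C" "Ca \<le> C" "Cb \<le> C" "Cc \<le> C" "Cd \<le> C" unfolding C_def using Ca(1) Cb(1) Cc(1) Cd(1) by auto
  define L where "L = ln B / \<alpha>"
  have expL: "exp (\<alpha> * L) = B" "exp (- (\<alpha> * L)) = 1 / B"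
    unfolding L_def using \<alpha> Cc(2) by (simp_all add: exp_minus inverse_eq_divide)
  have loc: "exponential_rational \<alpha> P Q (q_num \<alpha> G) (k_num \<alpha> G) \<omega> c C (min 1 k0) L"
  proof
    show "\<alpha> > 0" "k_num \<alpha> G > 0" "1 \<le> C" "0 < min 1 k0" "min 1 k0 \<le> 1" using \<alpha> k CC k0 by auto
    show "\<omega> = cis (2 * pi / real (k_num \<alpha> G))" by (rule \<omega>_def)
    show "0 \<le> L" unfolding L_def using \<alpha> Cc by simp
    fix v :: complex
    show "norm (poly P v) \<le> C * max 1 (norm v) ^ q_num \<alpha> G"
      unfolding q by (rule order_trans[OF Ca(2) mult_right_mono[OF CC(2)]]) simp
    show "norm (poly Q v) \<le> C * max 1 (norm v) ^ q_num \<alpha> G"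
      unfolding q by (rule order_trans[OF Cb(2) mult_right_mono[OF CC(3)]]) simp
  next
    fix x :: real assume x: "0 \<le> x"
    have "min 1 k0 * max 1 x ^ degree Q \<le> k0 * max 1 x ^ degree Q" by (intro mult_right_mono) auto
    also have "\<dots> \<le> norm (poly Q (of_real x))" by (rule k0(2)[OF x])
    finally show "min 1 k0 * max 1 x ^ q_num \<alpha> G \<le> norm (poly Q (of_real x))" unfolding q .
  next
    fix v :: complex assume "exp (\<alpha> * L) \<le> norm v"
    then have v: "B \<le> norm v" by (simp only: expL)
    have "Cc / norm v \<le> C / norm v" by (rule divide_right_mono[OF CC(4)]) simp
    then show "poly Q v \<noteq> 0 \<and> norm (poly P v / poly Q v) \<le> C / norm v"
      using far[OF v] by linarith
  next
    fix v :: complex assume "norm v \<le> exp (- (\<alpha> * L))"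
    then have v: "norm v \<le> 1 / B" by (simp only: expL)
    have "Cc * norm v \<le> C * norm v" by (rule mult_right_mono[OF CC(4)]) simp
    then show "poly Q v \<noteq> 0 \<and> norm (poly P v / poly Q v) \<le> C * norm v"
      using near[OF v] by linarith
  next
    fix w :: complex
    show "w \<noteq> 0 \<Longrightarrow> poly P (\<omega> * w) / poly Q (\<omega> * w) = c * (poly P w / poly Q w)" by (rule rot(1))
    show "poly Q w \<noteq> 0 \<Longrightarrow> poly Q (\<omega> * w) \<noteq> 0" by (rule rot(2))
  qed
  have dec: "norm (G (of_real x)) \<le> C * exp (- \<alpha> * \<bar>x\<bar>)" for x :: real
  proof -
    have "norm (G (of_real x)) \<le> Cd * min (exp (\<alpha> * x)) (1 / exp (\<alpha> * x))"
      unfolding Gx by (rule Cd(2)) simp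
    also have "min (exp (\<alpha> * x)) (1 / exp (\<alpha> * x)) \<le> exp (- \<alpha> * \<bar>x\<bar>)"
    proof (cases "0 \<le> x")
      case True
      then have "exp (- \<alpha> * \<bar>x\<bar>) = 1 / exp (\<alpha> * x)" by (simp add: exp_minus inverse_eq_divide)
      then show ?thesis by (simp only: min.cobounded2)
    next
      case False
      then have "exp (- \<alpha> * \<bar>x\<bar>) = exp (\<alpha> * x)" by simp
      then show ?thesis by (simp only: min.cobounded1)
    qed
    then have "Cd * min (exp (\<alpha> * x)) (1 / exp (\<alpha> * x)) \<le> C * exp (- \<alpha> * \<bar>x\<bar>)"
      using CC Cd(1) by (intro mult_mono) auto
    finally show ?thesis .
  qed
  show thesis by (rule that[OF loc Gx dec])
qed

lemma shift_series_tendsto: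
  assumes decay: "\<And>x. norm (G (of_real x)) \<le> C * exp (- \<alpha> * \<bar>x\<bar>)"
    and W: "\<And>F. finite F \<Longrightarrow> F \<subseteq> \<Gamma> \<Longrightarrow> (\<Sum>s\<in>F. expker \<alpha> x s) \<le> W"
    and c: "\<And>\<gamma>. \<gamma> \<in> \<Gamma> \<Longrightarrow> norm (c \<gamma>) \<le> B" and B: "0 \<le> B"
  shows "((\<lambda>F. \<Sum>\<gamma>\<in>F. c \<gamma> * G (of_real (x - \<gamma>))) \<longlongrightarrow> shift_series G \<Gamma> c x) (finite_subsets_at_top \<Gamma>)"
    and "norm (shift_series G \<Gamma> c x) \<le> C * kersum \<alpha> \<Gamma> c x"
proof -
  have sm: "(\<lambda>\<gamma>. norm (c \<gamma>) * expker \<alpha> x \<gamma>) summable_on \<Gamma>"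
    by (rule kernel_sum_summable(1)[OF W _ c B]) auto
  then have smC: "(\<lambda>\<gamma>. C * (norm (c \<gamma>) * expker \<alpha> x \<gamma>)) summable_on \<Gamma>"
    by (rule summable_on_cmult_right)
  have le: "norm (c \<gamma> * G (of_real (x - \<gamma>))) \<le> C * (norm (c \<gamma>) * expker \<alpha> x \<gamma>)" for \<gamma>
  proof -
    have "norm (c \<gamma>) * norm (G (of_real (x - \<gamma>))) \<le> norm (c \<gamma>) * (C * expker \<alpha> x \<gamma>)"
      by (intro mult_left_mono decay) simp
    then show ?thesis by (simp only: norm_mult mult.left_commute)
  qed
  have abs: "(\<lambda>\<gamma>. norm (c \<gamma> * G (of_real (x - \<gamma>)))) summable_on \<Gamma>"
    by (rule Infinite_Sum.abs_summable_on_comparison_test'[OF smC le])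
  then have "(\<lambda>\<gamma>. c \<gamma> * G (of_real (x - \<gamma>))) summable_on \<Gamma>" by (rule abs_summable_summable)
  then have "((\<lambda>\<gamma>. c \<gamma> * G (of_real (x - \<gamma>))) has_sum shift_series G \<Gamma> c x) \<Gamma>"
    unfolding shift_series_def by (rule has_sum_infsum)
  then show "((\<lambda>F. \<Sum>\<gamma>\<in>F. c \<gamma> * G (of_real (x - \<gamma>))) \<longlongrightarrow> shift_series G \<Gamma> c x) (finite_subsets_at_top \<Gamma>)"
    unfolding has_sum_def .
  have "norm (shift_series G \<Gamma> c x) \<le> infsum (\<lambda>\<gamma>. norm (c \<gamma> * G (of_real (x - \<gamma>)))) \<Gamma>"
    unfolding shift_series_def by (rule norm_infsum_bound[OF abs])
  also have "\<dots> \<le> infsum (\<lambda>\<gamma>. C * (norm (c \<gamma>) * expker \<alpha> x \<gamma>)) \<Gamma>"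
    by (rule infsum_mono[OF abs smC le])
  also have "\<dots> = C * kersum \<alpha> \<Gamma> c x"
    by (rule infsum_cmult_right')
  finally show "norm (shift_series G \<Gamma> c x) \<le> C * kersum \<alpha> \<Gamma> c x" .
qed

text \<open>The estimate for finite sums passes to the limit along the finite subsets of \<open>\<Gamma>\<close>, since its constants do not
  depend on the subset.  The cut-off of the samples at distance \<open>n\<close> is then replaced by the kernel, so that the Schur
  test covers both sums.\<close>

lemma shift_series_local_estimate:
  assumes \<alpha>: "\<alpha> > 0" and G: "G \<in> class_K \<alpha>" and \<Lambda>: "separated_set \<Lambda>" and \<Gamma>: "separated_set \<Gamma>"
    and dens: "lower_density \<Lambda> > real (q_num \<alpha> G) / real (k_num \<alpha> G) * upper_density \<Gamma>" and \<eta>: "0 < \<eta>"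
  obtains K where "0 \<le> K" "\<And>c B x. 0 \<le> B \<Longrightarrow> (\<And>\<gamma>. \<gamma> \<in> \<Gamma> \<Longrightarrow> norm (c \<gamma>) \<le> B) \<Longrightarrow>
    norm (shift_series G \<Gamma> c x) \<le> \<eta> * kersum \<alpha> \<Gamma> c x
      + K * kersum \<alpha> \<Lambda> (shift_series G \<Gamma> c) x"
proof -
  obtain P Q \<omega> c0 C \<kappa> L where er: "exponential_rational \<alpha> P Q (q_num \<alpha> G) (k_num \<alpha> G) \<omega> c0 C \<kappa> L"
    and Gx: "\<And>x. G (of_real x) = poly P (of_real (exp (\<alpha> * x))) / poly Q (of_real (exp (\<alpha> * x)))"
    and decay: "\<And>x. norm (G (of_real x)) \<le> C * exp (- \<alpha> * \<bar>x\<bar>)"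
    using class_K_constants[OF \<alpha> G] by blast
  interpret exponential_rational \<alpha> P Q "q_num \<alpha> G" "k_num \<alpha> G" \<omega> c0 C \<kappa> L by (rule er)
  obtain W1 where W1: "W1 > 0" "\<And>x F. finite F \<Longrightarrow> F \<subseteq> \<Gamma> \<Longrightarrow> (\<Sum>s\<in>F. expker \<alpha> x s) \<le> W1"
    using kernel_sum_bound[OF \<Gamma> \<alpha>] by blast
  obtain W2 where W2: "W2 > 0" "\<And>x F. finite F \<Longrightarrow> F \<subseteq> \<Lambda> \<Longrightarrow> (\<Sum>s\<in>F. expker \<alpha> x s) \<le> W2"
    using kernel_sum_bound[OF \<Lambda> \<alpha>] by blast
  have fin\<Lambda>: "finite (\<Lambda> \<inter> {x - R..x + R})" for x R using separated_window_count[OF \<Lambda>] by metis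
  obtain n K where nK: "0 \<le> n" "0 \<le> K" and est1: "\<forall>F cc x. finite F \<and> F \<subseteq> \<Gamma> \<longrightarrow>
    norm (shift_sum F cc (e x)) \<le> \<eta> * (\<Sum>\<gamma>\<in>F. norm (cc \<gamma>) * expker \<alpha> x \<gamma>)
      + K * (\<Sum>y\<in>\<Lambda> \<inter> {x - n..x + n}. norm (shift_sum F cc (e y)))"
    using uniform_local_estimate[OF \<Lambda> \<Gamma> dens \<eta>] by (elim exE conjE)
  note est0 = est1[THEN spec, THEN spec, THEN spec, THEN mp, OF conjI]
  have fs: "shift_sum F cc (e x) = (\<Sum>\<gamma>\<in>F. cc \<gamma> * G (of_real (x - \<gamma>)))" for F cc x
    unfolding shift_sum_def e_add Gx by (simp add: e_def)
  show thesis
  proof (rule that[of "K * exp (\<alpha> * n)"])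
    show "0 \<le> K * exp (\<alpha> * n)" using nK by simp
    fix c :: "real \<Rightarrow> complex" and B x :: real
    assume B: "0 \<le> B" and c: "\<And>\<gamma>. \<gamma> \<in> \<Gamma> \<Longrightarrow> norm (c \<gamma>) \<le> B"
    let ?f = "shift_series G \<Gamma> c"
    let ?E = "kersum \<alpha> \<Gamma> c x"
    note lim = shift_series_tendsto(1)[OF decay W1(2) c B]
    have smc: "(\<lambda>\<gamma>. norm (c \<gamma>) * expker \<alpha> x \<gamma>) summable_on \<Gamma>"
      by (rule kernel_sum_summable(1)[OF W1(2) _ c B]) auto
    then have limE: "((\<lambda>F. \<Sum>\<gamma>\<in>F. norm (c \<gamma>) * expker \<alpha> x \<gamma>) \<longlongrightarrow> ?E) (finite_subsets_at_top \<Gamma>)"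
      using has_sum_infsum unfolding has_sum_def by blast
    have step: "norm (?f x) \<le> \<eta> * ?E + K * (\<Sum>y\<in>\<Lambda> \<inter> {x - n..x + n}. norm (?f y))"
    proof (rule tendsto_le)
      show "finite_subsets_at_top \<Gamma> \<noteq> bot" by simp
      show "((\<lambda>F. norm (\<Sum>\<gamma>\<in>F. c \<gamma> * G (of_real (x - \<gamma>)))) \<longlongrightarrow> norm (?f x)) (finite_subsets_at_top \<Gamma>)"
        by (intro tendsto_norm lim)
      show "((\<lambda>F. \<eta> * (\<Sum>\<gamma>\<in>F. norm (c \<gamma>) * expker \<alpha> x \<gamma>)
          + K * (\<Sum>y\<in>\<Lambda> \<inter> {x - n..x + n}. norm (\<Sum>\<gamma>\<in>F. c \<gamma> * G (of_real (y - \<gamma>)))))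
        \<longlongrightarrow> \<eta> * ?E + K * (\<Sum>y\<in>\<Lambda> \<inter> {x - n..x + n}. norm (?f y))) (finite_subsets_at_top \<Gamma>)"
        by (intro tendsto_add tendsto_mult tendsto_const limE tendsto_sum tendsto_norm lim)
      show "\<forall>\<^sub>F F in finite_subsets_at_top \<Gamma>. norm (\<Sum>\<gamma>\<in>F. c \<gamma> * G (of_real (x - \<gamma>)))
        \<le> \<eta> * (\<Sum>\<gamma>\<in>F. norm (c \<gamma>) * expker \<alpha> x \<gamma>)
          + K * (\<Sum>y\<in>\<Lambda> \<inter> {x - n..x + n}. norm (\<Sum>\<gamma>\<in>F. c \<gamma> * G (of_real (y - \<gamma>))))"
        using est0[unfolded fs] by (intro eventually_finite_subsets_at_top_weakI)
    qed
    have fB: "norm (?f y) \<le> C * (B * W1)" for y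
    proof -
      have "norm (?f y) \<le> C * kersum \<alpha> \<Gamma> c y"
        by (rule shift_series_tendsto(2)[OF decay W1(2) c B])
      also have "\<dots> \<le> C * (B * W1)"
        using C by (intro mult_left_mono kernel_sum_summable(2)[OF W1(2) _ c B]) auto
      finally show ?thesis .
    qed
    have smf: "(\<lambda>y. norm (?f y) * expker \<alpha> x y) summable_on \<Lambda>"
      using C B W1(1) by (intro kernel_sum_summable(1)[OF W2(2) _ fB]) auto
    have "(\<Sum>y\<in>\<Lambda> \<inter> {x - n..x + n}. norm (?f y)) \<le> (\<Sum>y\<in>\<Lambda> \<inter> {x - n..x + n}. exp (\<alpha> * n) * (norm (?f y) * expker \<alpha> x y))"
    proof (rule sum_mono)
      fix y assume "y \<in> \<Lambda> \<inter> {x - n..x + n}"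
      then have "\<bar>x - y\<bar> \<le> n" by auto
      then have "\<alpha> * \<bar>x - y\<bar> \<le> \<alpha> * n" using \<alpha> by simp
      then have "1 \<le> exp (\<alpha> * n) * expker \<alpha> x y" unfolding exp_add[symmetric] by simp
      then have "norm (?f y) * 1 \<le> norm (?f y) * (exp (\<alpha> * n) * expker \<alpha> x y)"
        by (intro mult_left_mono) auto
      then show "norm (?f y) \<le> exp (\<alpha> * n) * (norm (?f y) * expker \<alpha> x y)"
        by (simp only: mult_1_right mult.left_commute)
    qed
    also have "\<dots> = exp (\<alpha> * n) * (\<Sum>y\<in>\<Lambda> \<inter> {x - n..x + n}. norm (?f y) * expker \<alpha> x y)"
      by (simp only: sum_distrib_left)
    also have "\<dots> \<le> exp (\<alpha> * n) * kersum \<alpha> \<Lambda> ?f x"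
      by (intro mult_left_mono finite_sum_le_infsum[OF smf fin\<Lambda>]) auto
    finally have "K * (\<Sum>y\<in>\<Lambda> \<inter> {x - n..x + n}. norm (?f y))
      \<le> K * (exp (\<alpha> * n) * kersum \<alpha> \<Lambda> ?f x)"
      using nK by (intro mult_left_mono) auto
    then show "norm (?f x) \<le> \<eta> * ?E + K * exp (\<alpha> * n) * kersum \<alpha> \<Lambda> ?f x"
      using step by (simp only: mult.assoc)
  qed
qed

lemma ennreal_powr_ennreal: "ennreal_powr (ennreal x) r = ennreal (max 0 x powr r)"
  by (simp add: ennreal_powr_def enn2real_ennreal max_def) (simp add: ennreal_neg)

lemma ennreal_powr_inverse_exponent:
  assumes "0 < r"
  shows "ennreal_powr (ennreal_powr x (1 / r)) r = x"
proof (cases x)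
  case (real y)
  then show ?thesis using assms by (simp add: ennreal_powr_ennreal powr_powr max_def)
qed (simp add: ennreal_powr_def)

text \<open>With \<open>\<eta> W1 = C1 / 2\<close> the coefficient term is at most half of the norm of \<open>f\<close>, by stability.\<close>

lemma sampling_exponent_infinity:
  assumes \<alpha>: "\<alpha> > 0" and G: "G \<in> class_K \<alpha>" and \<Lambda>: "separated_set \<Lambda>" and \<Gamma>: "separated_set \<Gamma>"
    and stable: "stable_shifts \<Gamma> G"
    and dens: "lower_density \<Lambda> > real (q_num \<alpha> G) / real (k_num \<alpha> G) * upper_density \<Gamma>"
  shows "sampling_set \<Lambda> \<infinity> \<Gamma> G"
proof -
  obtain W1 where W1: "W1 > 0" "\<And>x F. finite F \<Longrightarrow> F \<subseteq> \<Gamma> \<Longrightarrow> (\<Sum>s\<in>F. expker \<alpha> x s) \<le> W1"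
    using kernel_sum_bound[OF \<Gamma> \<alpha>] by blast
  obtain W2 where W2: "W2 > 0" "\<And>x F. finite F \<Longrightarrow> F \<subseteq> \<Lambda> \<Longrightarrow> (\<Sum>s\<in>F. expker \<alpha> x s) \<le> W2"
    using kernel_sum_bound[OF \<Lambda> \<alpha>] by blast
  have "1 \<le> (\<infinity>::ennreal)" by simp
  then obtain C1 C2 where C1: "C1 > 0" "C2 > 0" and st: "\<And>c. c \<in> lp_space \<infinity> \<Gamma> \<Longrightarrow>
      ennreal C1 * lp_norm \<infinity> \<Gamma> c \<le> Lp_norm \<infinity> (shift_series G \<Gamma> c) \<and>
      Lp_norm \<infinity> (shift_series G \<Gamma> c) \<le> ennreal C2 * lp_norm \<infinity> \<Gamma> c"
    using stable unfolding stable_shifts_def by blast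
  define \<eta> where "\<eta> = C1 / (2 * W1)"
  have \<eta>: "\<eta> > 0" unfolding \<eta>_def using C1 W1 by simp
  obtain K where K: "0 \<le> K" and est: "\<And>c B x. 0 \<le> B \<Longrightarrow> (\<And>\<gamma>. \<gamma> \<in> \<Gamma> \<Longrightarrow> norm (c \<gamma>) \<le> B) \<Longrightarrow>
    norm (shift_series G \<Gamma> c x) \<le> \<eta> * kersum \<alpha> \<Gamma> c x
      + K * kersum \<alpha> \<Lambda> (shift_series G \<Gamma> c) x"
    using shift_series_local_estimate[OF \<alpha> G \<Lambda> \<Gamma> dens \<eta>] by blast
  define A where "A = 2 * K * W2 + 1"
  have A: "A > 0" unfolding A_def using K W2(1) by (simp add: add_nonneg_pos)
  have "Lp_norm \<infinity> f \<le> ennreal A * (SUP \<mu>\<in>\<Lambda>. ennreal (norm (f \<mu>)))" if f: "f \<in> V_space \<infinity> \<Gamma> G" for f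
  proof -
    obtain c where c: "c \<in> lp_space \<infinity> \<Gamma>" and feq: "f = shift_series G \<Gamma> c"
      using f unfolding V_space_def by blast
    define m where "m = (SUP \<mu>\<in>\<Lambda>. ennreal (norm (f \<mu>)))"
    have "lp_norm \<infinity> \<Gamma> c < \<infinity>" using c unfolding lp_space_def by simp
    then obtain B where B: "0 \<le> B" "lp_norm \<infinity> \<Gamma> c = ennreal B"
      by (cases "lp_norm \<infinity> \<Gamma> c") auto
    have cB: "norm (c \<gamma>) \<le> B" if "\<gamma> \<in> \<Gamma>" for \<gamma>
    proof -
      have "ennreal (norm (c \<gamma>)) \<le> lp_norm \<infinity> \<Gamma> c" unfolding lp_norm_def using that by (auto intro: SUP_upper)
      then show ?thesis using B by (simp add: ennreal_le_iff)
    qed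
    have "Lp_norm \<infinity> f \<le> ennreal C2 * ennreal B" using st[OF c] unfolding feq B by simp
    also have "\<dots> < \<infinity>" by (simp add: ennreal_mult[symmetric] C1 B less_imp_le)
    finally have fin: "Lp_norm \<infinity> f < \<infinity>" .
    then obtain i where i: "0 \<le> i" "Lp_norm \<infinity> f = ennreal i" by (cases "Lp_norm \<infinity> f") auto
    have meas: "(\<lambda>x. ennreal (norm (f x))) \<in> borel_measurable lborel"
    proof (rule ccontr)
      assume "\<not> ?thesis"
      then have "esssup lborel (\<lambda>x. ennreal (norm (f x))) = top" by (rule esssup_non_measurable)
      then show False using fin by (simp add: Lp_norm_def)
    qed
    have "ennreal C1 * ennreal B \<le> ennreal i" using st[OF c] unfolding feq[symmetric] B i by simp
    then have C1B: "C1 * B \<le> i" using C1 B i by (simp add: ennreal_mult[symmetric])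
    show ?thesis
    proof (cases m)
      case (real s)
      have fs: "norm (f y) \<le> s" if "y \<in> \<Lambda>" for y
      proof -
        have "ennreal (norm (f y)) \<le> m" unfolding m_def using that by (rule SUP_upper)
        then show ?thesis using real by simp
      qed
      have pt: "norm (f x) \<le> \<eta> * (B * W1) + K * (s * W2)" for x
      proof -
        have "norm (f x) \<le> \<eta> * kersum \<alpha> \<Gamma> c x
          + K * kersum \<alpha> \<Lambda> f x"
          unfolding feq by (rule est[OF B(1) cB])
        also have "\<dots> \<le> \<eta> * (B * W1) + K * (s * W2)"
          using \<eta> K real B by (intro add_mono mult_left_mono kernel_sum_summable(2)[OF W1(2) _ cB]
              kernel_sum_summable(2)[OF W2(2) _ fs]) auto
        finally show ?thesis .
      qed
      have "esssup lborel (\<lambda>x. ennreal (norm (f x))) \<le> ennreal (\<eta> * (B * W1) + K * (s * W2))"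
        using pt by (intro esssup_I[OF meas] AE_I2 ennreal_leI)
      then have "ennreal i \<le> ennreal (\<eta> * (B * W1) + K * (s * W2))"
        using i unfolding Lp_norm_def by simp
      moreover have "0 \<le> \<eta> * (B * W1) + K * (s * W2)" using \<eta> B W1(1) K W2(1) real by simp
      ultimately have "i \<le> \<eta> * (B * W1) + K * (s * W2)" by (simp add: ennreal_le_iff)
      moreover have "\<eta> * (B * W1) = C1 * B / 2" unfolding \<eta>_def using W1(1) by simp
      ultimately have "i \<le> 2 * (K * (s * W2))" using C1B by linarith
      then have "i \<le> 2 * K * W2 * s" by (simp only: mult_ac)
      also have "\<dots> \<le> A * s" unfolding A_def using real by (intro mult_right_mono) auto
      finally have "ennreal i \<le> ennreal (A * s)" by (rule ennreal_leI)
      then show ?thesis unfolding m_def[symmetric] i real using A real by (simp add: ennreal_mult)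
    next
      case top
      then show ?thesis unfolding m_def[symmetric] using A by (simp add: ennreal_mult_top)
    qed
  qed
  then show ?thesis unfolding sampling_set_def using \<Lambda> A by auto
qed

text \<open>As for the supremum norm, with the Schur test in place of the trivial bound for the kernel sums.\<close>

lemma sampling_exponent_finite:
  fixes p :: ennreal
  assumes \<alpha>: "\<alpha> > 0" and G: "G \<in> class_K \<alpha>" and \<Lambda>: "separated_set \<Lambda>" and \<Gamma>: "separated_set \<Gamma>"
    and stable: "stable_shifts \<Gamma> G"
    and dens: "lower_density \<Lambda> > real (q_num \<alpha> G) / real (k_num \<alpha> G) * upper_density \<Gamma>"
    and p: "1 \<le> p" "p \<noteq> \<infinity>"
  shows "sampling_set \<Lambda> p \<Gamma> G"
proof -
  define r where "r = enn2real p"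
  have r: "1 \<le> r"
  proof -
    have "enn2real 1 \<le> enn2real p" using p by (intro enn2real_mono) (auto simp: top.not_eq_extremum)
    then show ?thesis unfolding r_def by simp
  qed
  have count: "countable \<Lambda>" "countable \<Gamma>" using \<Lambda> \<Gamma> unfolding separated_set_def by auto
  obtain W1 where W1: "W1 > 0" "\<And>x F. finite F \<Longrightarrow> F \<subseteq> \<Gamma> \<Longrightarrow> (\<Sum>s\<in>F. expker \<alpha> x s) \<le> W1"
    using kernel_sum_bound[OF \<Gamma> \<alpha>] by blast
  obtain W2 where W2: "W2 > 0" "\<And>x F. finite F \<Longrightarrow> F \<subseteq> \<Lambda> \<Longrightarrow> (\<Sum>s\<in>F. expker \<alpha> x s) \<le> W2"
    using kernel_sum_bound[OF \<Lambda> \<alpha>] by blast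
  obtain C0 where C0: "\<And>x. norm (G (of_real x)) \<le> C0 * exp (- \<alpha> * \<bar>x\<bar>)" "C0 \<ge> 1"
  proof -
    obtain P Q \<omega> c0 C \<kappa> L where er: "exponential_rational \<alpha> P Q (q_num \<alpha> G) (k_num \<alpha> G) \<omega> c0 C \<kappa> L"
      and "\<And>x. G (of_real x) = poly P (of_real (exp (\<alpha> * x))) / poly Q (of_real (exp (\<alpha> * x)))"
      and decay: "\<And>x. norm (G (of_real x)) \<le> C * exp (- \<alpha> * \<bar>x\<bar>)"
      using class_K_constants[OF \<alpha> G] by blast
    show thesis by (rule that[OF decay exponential_rational.C[OF er]])
  qed
  obtain C1 C2 where C1: "C1 > 0" "C2 > 0" and st: "\<And>c. c \<in> lp_space p \<Gamma> \<Longrightarrow>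
      ennreal C1 * lp_norm p \<Gamma> c \<le> Lp_norm p (shift_series G \<Gamma> c) \<and>
      Lp_norm p (shift_series G \<Gamma> c) \<le> ennreal C2 * lp_norm p \<Gamma> c"
    using stable p(1) unfolding stable_shifts_def by blast
  define X1 where "X1 = W1 powr (r - 1) * (2 / \<alpha>)"
  define X2 where "X2 = W2 powr (r - 1) * (2 / \<alpha>)"
  define X3 where "X3 = W1 powr (r - 1) * W2"
  have X: "0 < X1" "0 < X2" "0 < X3" unfolding X1_def X2_def X3_def using W1(1) W2(1) \<alpha> by auto
  \<comment> \<open>chosen such that the coefficient term contributes at most half of the integral of \<open>\<bar>f\<bar> powr r\<close>\<close>
  define \<eta> where "\<eta> = C1 / 2 * (1 / (2 * X1)) powr (1 / r)"
  have \<eta>: "\<eta> > 0" unfolding \<eta>_def using C1 X by simp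
  have \<eta>r: "(2 * \<eta>) powr r * X1 = C1 powr r / 2"
  proof -
    have "2 * \<eta> = C1 * (1 / (2 * X1)) powr (1 / r)" unfolding \<eta>_def by simp
    then have "(2 * \<eta>) powr r = C1 powr r * (1 / (2 * X1))"
      using C1 X r by (simp add: powr_mult powr_powr)
    then show ?thesis using X by simp
  qed
  obtain K where K: "0 \<le> K" and est: "\<And>c B x. 0 \<le> B \<Longrightarrow> (\<And>\<gamma>. \<gamma> \<in> \<Gamma> \<Longrightarrow> norm (c \<gamma>) \<le> B) \<Longrightarrow>
    norm (shift_series G \<Gamma> c x) \<le> \<eta> * kersum \<alpha> \<Gamma> c x
      + K * kersum \<alpha> \<Lambda> (shift_series G \<Gamma> c) x"
    using shift_series_local_estimate[OF \<alpha> G \<Lambda> \<Gamma> dens \<eta>] by blast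
  define Y where "Y = (2 * K) powr r * X2"
  have Y: "0 \<le> Y" unfolding Y_def using X by simp
  define A Bc where "A = 1 / (2 * (Y + 1))" and "Bc = C0 powr r * X3 / C1 powr r"
  have A: "A > 0" unfolding A_def using Y by simp
  have Bc: "Bc > 0" unfolding Bc_def using C0 X C1 by simp
  have "ennreal A * ennreal_powr (Lp_norm p f) (enn2real p)
          \<le> (\<Sum>\<^sub>\<infinity>\<mu>\<in>\<Lambda>. ennreal (norm (f \<mu>) powr enn2real p)) \<and>
        (\<Sum>\<^sub>\<infinity>\<mu>\<in>\<Lambda>. ennreal (norm (f \<mu>) powr enn2real p))
          \<le> ennreal Bc * ennreal_powr (Lp_norm p f) (enn2real p)" if f: "f \<in> V_space p \<Gamma> G" for f
  proof -
    obtain c where c: "c \<in> lp_space p \<Gamma>" and feq: "f = shift_series G \<Gamma> c"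
      using f unfolding V_space_def by blast
    define Sc where "Sc = (\<Sum>\<^sub>\<infinity>\<gamma>\<in>\<Gamma>. ennreal (norm (c \<gamma>) powr r))"
    define I where "I = (\<integral>\<^sup>+x. ennreal (norm (f x) powr r) \<partial>lborel)"
    define T where "T = (\<Sum>\<^sub>\<infinity>\<mu>\<in>\<Lambda>. ennreal (norm (f \<mu>) powr r))"
    have lpn: "lp_norm p \<Gamma> c = ennreal_powr Sc (1 / r)" unfolding lp_norm_def Sc_def r_def using p by simp
    have Lpn: "Lp_norm p f = ennreal_powr I (1 / r)" unfolding Lp_norm_def I_def r_def using p by simp
    have "lp_norm p \<Gamma> c < \<infinity>" using c unfolding lp_space_def by simp
    then have "ennreal_powr Sc (1 / r) < \<infinity>" by (simp only: lpn)
    then have "Sc \<noteq> \<infinity>" unfolding ennreal_powr_def by (auto split: if_splits)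
    then obtain sc where sc: "0 \<le> sc" "Sc = ennreal sc" by (cases Sc) auto
    have lpn': "lp_norm p \<Gamma> c = ennreal (sc powr (1 / r))" unfolding lpn sc using sc by (simp add: ennreal_powr_ennreal max_def)
    have "Lp_norm p f \<le> ennreal C2 * ennreal (sc powr (1 / r))" using st[OF c] unfolding feq lpn' by simp
    also have "\<dots> < \<infinity>" by (simp add: ennreal_mult[symmetric] C1 less_imp_le)
    finally have "I \<noteq> \<infinity>" unfolding Lpn ennreal_powr_def by (auto split: if_splits)
    then obtain i where i: "0 \<le> i" "I = ennreal i" by (cases I) auto
    have Lpn': "Lp_norm p f = ennreal (i powr (1 / r))" unfolding Lpn i using i by (simp add: ennreal_powr_ennreal max_def)
    have "ennreal C1 * ennreal (sc powr (1 / r)) \<le> ennreal (i powr (1 / r))"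
      using st[OF c] unfolding feq[symmetric] lpn' Lpn' by simp
    then have "C1 * sc powr (1 / r) \<le> i powr (1 / r)" using C1 by (simp add: ennreal_mult[symmetric])
    then have "(C1 * sc powr (1 / r)) powr r \<le> (i powr (1 / r)) powr r"
      using C1 r by (intro powr_mono2) auto
    then have C1sc: "C1 powr r * sc \<le> i" using C1 sc i r by (simp add: powr_mult powr_powr)
    define B where "B = sc powr (1 / r)"
    have B: "0 \<le> B" by (simp add: B_def)
    have cB: "norm (c \<gamma>) \<le> B" if "\<gamma> \<in> \<Gamma>" for \<gamma>
    proof -
      have "(\<Sum>\<gamma>\<in>{\<gamma>}. ennreal (norm (c \<gamma>) powr r)) \<le> Sc"
        unfolding Sc_def nonneg_infsum_complete[OF zero_le] using that by (intro SUP_upper) auto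
      then have "norm (c \<gamma>) powr r \<le> sc" using sc by simp
      then have "(norm (c \<gamma>) powr r) powr (1 / r) \<le> B" unfolding B_def using r by (intro powr_mono2) auto
      then show ?thesis using r by (simp add: powr_powr)
    qed
    define E where "E x = kersum \<alpha> \<Gamma> c x" for x
    define H where "H x = kersum \<alpha> \<Lambda> f x" for x
    have E0: "0 \<le> E x" for x unfolding E_def by (intro infsum_nonneg) auto
    have H0: "0 \<le> H x" for x unfolding H_def by (intro infsum_nonneg) auto
    have fE: "norm (f x) \<le> C0 * E x" for x
      unfolding feq E_def by (rule shift_series_tendsto(2)[OF C0(1) W1(2) cB B])
    have fB: "norm (f x) \<le> C0 * (B * W1)" for x
    proof -
      have "C0 * E x \<le> C0 * (B * W1)"
        unfolding E_def using C0(2) by (intro mult_left_mono kernel_sum_summable(2)[OF W1(2) _ cB B]) auto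
      then show ?thesis using fE[of x] by linarith
    qed
    have fEH: "norm (f x) \<le> \<eta> * E x + K * H x" for x
      unfolding feq E_def H_def by (rule est[OF B cB])
    \<comment> \<open>the samples are controlled by the coefficients\<close>
    have T_le: "T \<le> ennreal (C0 powr r * X3 * sc)"
    proof -
      obtain g where g: "\<And>x. ennreal (E x powr r) \<le> g x"
        "(\<integral>\<^sup>+x. g x \<partial>count_space \<Lambda>) \<le> ennreal (W1 powr (r - 1) * W2) * (\<Sum>\<^sub>\<infinity>s\<in>\<Gamma>. ennreal (norm (c s) powr r))"
        unfolding E_def
        by (rule schur_test_kernel[OF r count(2) W1(2), where M = "count_space \<Lambda>" and b = W2 and B = B and a = "\<lambda>s. norm (c s)"])
          (use kernel_integral_count_space[OF count(1) W2(2)] cB B in auto)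
      have "T \<le> (\<integral>\<^sup>+\<mu>. ennreal (C0 powr r) * g \<mu> \<partial>count_space \<Lambda>)"
        unfolding T_def infsum_ennreal_eq_nn_integral[OF count(1)]
      proof (rule nn_integral_mono)
        fix x
        have "norm (f x) powr r \<le> (C0 * E x) powr r" using r by (intro powr_mono2 fE) auto
        also have "\<dots> = C0 powr r * E x powr r" using C0 E0 by (simp add: powr_mult)
        finally have "ennreal (norm (f x) powr r) \<le> ennreal (C0 powr r) * ennreal (E x powr r)"
          by (simp add: ennreal_mult[symmetric] ennreal_leI)
        also have "\<dots> \<le> ennreal (C0 powr r) * g x" by (intro mult_left_mono g) auto
        finally show "ennreal (norm (f x) powr r) \<le> ennreal (C0 powr r) * g x" .
      qed
      also have "\<dots> = ennreal (C0 powr r) * (\<integral>\<^sup>+\<mu>. g \<mu> \<partial>count_space \<Lambda>)"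
        by (rule nn_integral_cmult) simp
      also have "\<dots> \<le> ennreal (C0 powr r) * (ennreal X3 * ennreal sc)"
        using g(2) unfolding X3_def sc(2)[symmetric] Sc_def by (intro mult_left_mono) auto
      also have "\<dots> = ennreal (C0 powr r * X3 * sc)"
        using X sc by (simp add: ennreal_mult[symmetric] mult.assoc)
      finally show ?thesis .
    qed
    then have "T \<noteq> \<infinity>" by (auto simp: top_unique)
    then obtain t where t: "0 \<le> t" "T = ennreal t" by (cases T) auto
    have upper: "t \<le> Bc * i"
    proof -
      have "t \<le> C0 powr r * X3 * sc" using T_le t X sc by (simp add: ennreal_le_iff)
      also have "\<dots> = Bc * (C1 powr r * sc)" unfolding Bc_def using C1 by simp
      also have "\<dots> \<le> Bc * i" using C1sc Bc by (intro mult_left_mono) auto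
      finally show ?thesis .
    qed
    have lower: "i \<le> 2 * Y * t"
    proof -
      obtain g1 where g1: "g1 \<in> borel_measurable lborel" "\<And>x. ennreal (E x powr r) \<le> g1 x"
        "(\<integral>\<^sup>+x. g1 x \<partial>lborel) \<le> ennreal (W1 powr (r - 1) * (2 / \<alpha>)) * (\<Sum>\<^sub>\<infinity>s\<in>\<Gamma>. ennreal (norm (c s) powr r))"
        unfolding E_def
        by (rule schur_test_kernel[OF r count(2) W1(2), where M = lborel and b = "2 / \<alpha>" and B = B and a = "\<lambda>s. norm (c s)"])
          (use kernel_integral_lborel[OF \<alpha>] cB B in auto)
      obtain g2 where g2: "g2 \<in> borel_measurable lborel" "\<And>x. ennreal (H x powr r) \<le> g2 x"
        "(\<integral>\<^sup>+x. g2 x \<partial>lborel) \<le> ennreal (W2 powr (r - 1) * (2 / \<alpha>)) * (\<Sum>\<^sub>\<infinity>s\<in>\<Lambda>. ennreal (norm (f s) powr r))"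
        unfolding H_def
        by (rule schur_test_kernel[OF r count(1) W2(2), where M = lborel and b = "2 / \<alpha>" and B = "C0 * (B * W1)" and a = "\<lambda>s. norm (f s)"])
          (use kernel_integral_lborel[OF \<alpha>] fB B C0(2) W1(1) in auto)
      have "I \<le> (\<integral>\<^sup>+x. ennreal ((2 * \<eta>) powr r) * g1 x + ennreal ((2 * K) powr r) * g2 x \<partial>lborel)"
        unfolding I_def
      proof (rule nn_integral_mono)
        fix x
        have "norm (f x) powr r \<le> (2 * max (\<eta> * E x) (K * H x)) powr r"
          using fEH[of x] r by (intro powr_mono2) auto
        also have "\<dots> \<le> (2 * \<eta> * E x) powr r + (2 * K * H x) powr r"
          by (cases "\<eta> * E x \<le> K * H x") (simp_all add: max_def mult.assoc)
        also have "\<dots> = (2 * \<eta>) powr r * E x powr r + (2 * K) powr r * H x powr r"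
          using \<eta> K E0 H0 by (simp add: powr_mult)
        finally have "ennreal (norm (f x) powr r)
          \<le> ennreal ((2 * \<eta>) powr r) * ennreal (E x powr r) + ennreal ((2 * K) powr r) * ennreal (H x powr r)"
          by (simp add: ennreal_mult[symmetric] ennreal_plus[symmetric] ennreal_leI del: ennreal_plus)
        also have "\<dots> \<le> ennreal ((2 * \<eta>) powr r) * g1 x + ennreal ((2 * K) powr r) * g2 x"
          by (intro add_mono mult_left_mono g1 g2) auto
        finally show "ennreal (norm (f x) powr r)
          \<le> ennreal ((2 * \<eta>) powr r) * g1 x + ennreal ((2 * K) powr r) * g2 x" .
      qed
      also have "\<dots> = (\<integral>\<^sup>+x. ennreal ((2 * \<eta>) powr r) * g1 x \<partial>lborel) + (\<integral>\<^sup>+x. ennreal ((2 * K) powr r) * g2 x \<partial>lborel)"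
        using g1(1) g2(1) by (intro nn_integral_add borel_measurable_times) auto
      also have "\<dots> = ennreal ((2 * \<eta>) powr r) * (\<integral>\<^sup>+x. g1 x \<partial>lborel) + ennreal ((2 * K) powr r) * (\<integral>\<^sup>+x. g2 x \<partial>lborel)"
        using g1(1) g2(1) by (simp only: nn_integral_cmult)
      also have "\<dots> \<le> ennreal ((2 * \<eta>) powr r) * (ennreal X1 * ennreal sc) + ennreal ((2 * K) powr r) * (ennreal X2 * ennreal t)"
        using g1(3) g2(3) unfolding X1_def X2_def sc(2)[symmetric] t(2)[symmetric] Sc_def T_def
        by (intro add_mono mult_left_mono) auto
      also have "\<dots> = ennreal ((2 * \<eta>) powr r * X1 * sc + Y * t)"
        using X sc t Y unfolding Y_def
        by (simp add: ennreal_mult[symmetric] ennreal_plus[symmetric] mult.assoc del: ennreal_plus)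
      finally have "i \<le> (2 * \<eta>) powr r * X1 * sc + Y * t"
        using i X sc t Y by (simp add: ennreal_le_iff del: ennreal_plus)
      then show ?thesis using C1sc unfolding \<eta>r by simp
    qed
    have "A * i \<le> t"
    proof -
      have "i \<le> 2 * (Y + 1) * t" using lower t by (simp add: algebra_simps)
      then show ?thesis unfolding A_def using Y by (simp add: divide_le_eq mult.commute)
    qed
    then have "ennreal A * ennreal i \<le> ennreal t" "ennreal t \<le> ennreal Bc * ennreal i"
      using upper A Bc i by (simp_all add: ennreal_mult[symmetric] ennreal_leI)
    moreover have "ennreal_powr (Lp_norm p f) (enn2real p) = ennreal i"
      unfolding Lpn i r_def[symmetric] using r by (intro ennreal_powr_inverse_exponent) simp
    ultimately show ?thesis using t unfolding T_def r_def by simp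
  qed
  then show ?thesis unfolding sampling_set_def using \<Lambda> A Bc p by auto
qed

theorem theorem1p8:
  fixes \<alpha> :: real and G :: "complex \<Rightarrow> complex" and \<Lambda> \<Gamma> :: "real set"
  assumes "\<alpha> > 0"
    and "G \<in> class_K \<alpha>"
    and "separated_set \<Lambda>"
    and "separated_set \<Gamma>"
    and "relatively_dense \<Gamma>"
    and "stable_shifts \<Gamma> G"
    and "lower_density \<Lambda> > real (q_num \<alpha> G) / real (k_num \<alpha> G) * upper_density \<Gamma>"
  shows "\<forall>p::ennreal. 1 \<le> p \<longrightarrow> sampling_set \<Lambda> p \<Gamma> G"
proof (intro allI impI)
  fix p :: ennreal assume "1 \<le> p"
  then show "sampling_set \<Lambda> p \<Gamma> G"
    using sampling_exponent_infinity[OF assms(1-4,6,7)] sampling_exponent_finite[OF assms(1-4,6,7)]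
    by (cases "p = \<infinity>") auto
qed

end
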